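(* Let $H$ be a reproducing kernel Hilbert space on a set $X$, let $\mathfrak{A}$ be a dual algebra of multipliers on $H$, and let $r\ge1$. (1) If $\mathcal{M}_r(\mathfrak{A})$ has property $\mathbb{A}_1(1)$, then $\operatorname{Lat}\mathfrak{A}$ is an $r\times r$ Nevanlinna-Pick family for $\mathfrak{A}$. (2) More generally, if the ampliation $\mathcal{M}_r(\mathfrak{A}^{(s)})$ has property $\mathbb{A}_1(1)$, then $\operatorname{Lat}(\mathfrak{A}^{(s)})$ is an $r\times r$ Nevanlinna-Pick family for $\mathfrak{A}$ (here $s$ is a positive integer or $\infty$). (3) In particular, $\operatorname{Lat}(\mathfrak{A}^{(\infty)})$ is a complete Nevanlinna-Pick family for any dual algebra of multipliers $\mathfrak{A}$.
   Context: $H$ is a Hilbert space of complex-valued functions on $X$ with reproducing kernels $k_\lambda\ne0$, $h(\lambda)=\langle h,k_\lambda\rangle$. $\mathfrak{M}(H)=\{f:X\to\mathbb{C}:fh\in H\ \forall h\in H\}$, identified with multiplication operators $M_f\in\mathcal{B}(H)$. A dual algebra of multipliers on $H$ is a subalgebra of $\mathfrak{M}(H)$ containing $I$ and closed in the weak-$*$ topology of $\mathcal{B}(H)$. $\mathcal{M}_r(\mathfrak{A})$ is the algebra of $r\times r$ matrices over $\mathfrak{A}$ acting on $H\otimes\mathbb{C}^r$, with the operator norm; $F\in\mathcal{M}_r(\mathfrak{A})$ acts as $M_F$. For $s\in\{1,2,\dots\}\cup\{\infty\}$, $\mathfrak{A}^{(s)}=\{A^{(s)}:A\in\mathfrak{A}\}$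 acts on $H^{(s)}$, the direct sum of $s$ (countably infinitely many if $s=\infty$) copies of $H$, $A^{(s)}$ being the direct sum of $s$ copies of $A$; $\mathcal{M}_r(\mathfrak{A}^{(s)})$ acts on $H^{(s)}\otimes\mathbb{C}^r$, and $M_F^{(s)}=[M_{f_{ij}}^{(s)}]$ for $F=[f_{ij}]$. A dual algebra $\mathfrak{B}$ (unital weak-$*$ closed) on a Hilbert space $K$ has property $\mathbb{A}_1(1)$ if every weak-$*$ continuous functional $\varphi$ on $\mathfrak{B}$ with $\|\varphi\|<1$ has the form $\varphi(B)=\langle Bx,y\rangle$ for some $x,y\in K$ with $\|x\|\|y\|<1$. $\operatorname{Lat}$ denotes the lattice of closed invariant subspaces. $\mathfrak{A}$ separates a finite set $E\subset X$ if for distinct $\lambda,\mu\in E$ some $f\in\mathfrak{A}$ has $f(\lambda)\neq f(\mu)$; $\mathfrak{J}_E=\{f\in\mathfrak{A}:f|_E=0\}$. For $L\in\operatorname{Lat}(\mathfrak{A}^{(s)})$, $N_L=L\ominus\mathfrak{J}_E^{(s)}L$ is the set of vectors of $L$ orthogonal to all $M_g^{(s)}x$, $g\in\mathfrak{J}_E$, $x\in L$; $P_{N_L}$ is the orthogonal projection onto it. $\operatorname{Lat}(\mathfrak{A}^{(s)})$ is an $r\times r$ Nevanlinna-Pick family for $\mathfrak{A}$ if for every finite $E\subset X$ separated by $\mathfrak{A}$ and every $F\in\mathcal{M}_r(\mathfrak{A})$, \[\operatorname{dist}(F,\mathcal{M}_r(\mathfrak{J}_E))=\sup_{L\in\operatorname{Lat}(\mathfrak{A}^{(s)})}\|(P_{N_L}\otimes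 I_r)M_F^{(s)}(P_{N_L}\otimes I_r)\|,\] where the distance is in the norm of $\mathcal{M}_r(\mathfrak{A})$; the case $s=1$ is the definition for $\operatorname{Lat}\mathfrak{A}$. It is a complete Nevanlinna-Pick family if this holds for all $r\ge1$. *)

theory Defs
  imports
    "HOL-Analysis.Analysis"
    "HOL-Library.Function_Algebras"
    "HOL-Library.Extended_Nat"
begin

section \<open>Complex vector spaces\<close>

class complex_vector = ab_group_add +
  fixes scaleC :: "complex \<Rightarrow> 'a \<Rightarrow> 'a"  (infixr "*\<^sub>C" 75)
  assumes scaleC_add_right: "c *\<^sub>C (x + y) = c *\<^sub>C x + c *\<^sub>C y"
    and scaleC_add_left: "(c + d) *\<^sub>C x = c *\<^sub>C x + d *\<^sub>C x"
    and scaleC_scaleC: "c *\<^sub>C d *\<^sub>C x = (c * d) *\<^sub>C x"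
    and scaleC_one: "1 *\<^sub>C x = x"

global_interpretation complex_vector: vector_space "scaleC :: complex \<Rightarrow> 'a \<Rightarrow> 'a::complex_vector"
  by unfold_locales
    (simp_all add: scaleC_add_right scaleC_add_left scaleC_scaleC scaleC_one)

instantiation complex :: complex_vector
begin
definition scaleC_complex_def: "c *\<^sub>C (z::complex) = c * z"
instance by standard (simp_all add: scaleC_complex_def algebra_simps)
end

instantiation "fun" :: (type, complex_vector) complex_vector
begin
definition scaleC_fun_def: "c *\<^sub>C f = (\<lambda>x. c *\<^sub>C f x)"
instance
  by standard
    (simp_all add: scaleC_fun_def fun_eq_iff scaleC_add_right scaleC_add_left
      scaleC_scaleC scaleC_one)
end


section \<open>Hilbert spaces with an explicit carrier\<close>

text \<open>
  The vector space operations are those of the ambient type; on function types they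
  are pointwise. The inner product is linear in the first argument, and its values
  outside the carrier are irrelevant.
\<close>

record 'v hspace =
  vecs :: "'v set"
  hinner :: "'v \<Rightarrow> 'v \<Rightarrow> complex"

definition hnorm :: "'v hspace \<Rightarrow> 'v \<Rightarrow> real" where
  "hnorm K x = sqrt (Re (hinner K x x))"

locale hilbert_space =
  fixes K :: "'v::complex_vector hspace"
  assumes subspace_vecs: "complex_vector.subspace (vecs K)"
    and inner_add_left:
      "\<lbrakk>x \<in> vecs K; y \<in> vecs K; z \<in> vecs K\<rbrakk>
        \<Longrightarrow> hinner K (x + y) z = hinner K x z + hinner K y z"
    and inner_scaleC_left:
      "\<lbrakk>x \<in> vecs K; y \<in> vecs K\<rbrakk> \<Longrightarrow> hinner K (c *\<^sub>C x) y = c * hinner K x y"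
    and inner_commute:
      "\<lbrakk>x \<in> vecs K; y \<in> vecs K\<rbrakk> \<Longrightarrow> hinner K x y = cnj (hinner K y x)"
    and inner_nonneg: "x \<in> vecs K \<Longrightarrow> 0 \<le> Re (hinner K x x)"
    and inner_definite: "\<lbrakk>x \<in> vecs K; hinner K x x = 0\<rbrakk> \<Longrightarrow> x = 0"
    and complete:
      "\<lbrakk>\<And>n. u n \<in> vecs K;
        \<And>e. e > 0 \<Longrightarrow> \<exists>N. \<forall>m\<ge>N. \<forall>n\<ge>N. hnorm K (u m - u n) < e\<rbrakk>
        \<Longrightarrow> \<exists>l\<in>vecs K. (\<lambda>n. hnorm K (u n - l)) \<longlonglongrightarrow> 0"

definition closed_subspace :: "'v::complex_vector hspace \<Rightarrow> 'v set \<Rightarrow> bool" where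
  "closed_subspace K L \<longleftrightarrow> complex_vector.subspace L \<and> L \<subseteq> vecs K \<and>
     (\<forall>u l. (\<forall>n. u n \<in> L) \<and> l \<in> vecs K \<and> (\<lambda>n. hnorm K (u n - l)) \<longlonglongrightarrow> 0 \<longrightarrow> l \<in> L)"

definition ominus :: "'v hspace \<Rightarrow> 'v set \<Rightarrow> 'v set \<Rightarrow> 'v set" where
  "ominus K L S = {x \<in> L. \<forall>y\<in>S. hinner K x y = 0}"

text \<open>
  The direct sum of \<open>s\<close> copies of \<open>K\<close>, as the square-summable sequences that vanish from
  index \<open>s\<close> on. The tensor product of \<open>K\<close> with the \<open>r\<close>-dimensional space is
  \<open>direct_sum K (enat r)\<close>.
\<close>

definition direct_sum :: "'v::complex_vector hspace \<Rightarrow> enat \<Rightarrow> (nat \<Rightarrow> 'v) hspace" where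
  "direct_sum K s =
    \<lparr>vecs = {x. (\<forall>i. enat i < s \<longrightarrow> x i \<in> vecs K) \<and> (\<forall>i. \<not> enat i < s \<longrightarrow> x i = 0) \<and>
               summable (\<lambda>i. (hnorm K (x i))\<^sup>2)},
     hinner = (\<lambda>x y. \<Sum>i. if enat i < s then hinner K (x i) (y i) else 0)\<rparr>"


section \<open>Bounded operators and the weak-* topology\<close>

text \<open>
  An operator on \<open>K\<close> is a function on the ambient type that is zero off the carrier, so
  that equality, sums and scalar multiples of operators are those of functions.
\<close>

definition bounded_ops :: "'v::complex_vector hspace \<Rightarrow> ('v \<Rightarrow> 'v) set" where
  "bounded_ops K = {T.
     (\<forall>x\<in>vecs K. T x \<in> vecs K) \<and> (\<forall>x. x \<notin> vecs K \<longrightarrow> T x = 0) \<and>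
     (\<forall>x\<in>vecs K. \<forall>y\<in>vecs K. T (x + y) = T x + T y) \<and>
     (\<forall>c. \<forall>x\<in>vecs K. T (c *\<^sub>C x) = c *\<^sub>C T x) \<and>
     (\<exists>C. \<forall>x\<in>vecs K. hnorm K (T x) \<le> C * hnorm K x)}"

definition opnorm :: "'v hspace \<Rightarrow> ('v \<Rightarrow> 'v) \<Rightarrow> real" where
  "opnorm K T = (SUP x\<in>{x \<in> vecs K. hnorm K x \<le> 1}. hnorm K (T x))"

definition orth_proj :: "'v::complex_vector hspace \<Rightarrow> 'v set \<Rightarrow> 'v \<Rightarrow> 'v" where
  "orth_proj K N x =
    (if x \<in> vecs K then THE p. p \<in> N \<and> (\<forall>n\<in>N. hinner K (x - p) n = 0) else 0)"

text \<open>
  The weak-* topology of the bounded operators, as the dual of the trace class: trace class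
  operators are the sums of rank one operators given by two square-summable sequences
  \<open>x\<close>, \<open>y\<close> of vectors, and the pairing of such a sum with \<open>T\<close> is the series below.
\<close>

definition square_summable :: "'v hspace \<Rightarrow> (nat \<Rightarrow> 'v) set" where
  "square_summable K = {x. (\<forall>n. x n \<in> vecs K) \<and> summable (\<lambda>n. (hnorm K (x n))\<^sup>2)}"

definition weak_star :: "'v::complex_vector hspace \<Rightarrow> ('v \<Rightarrow> 'v) topology" where
  "weak_star K = topology_generated_by
     {{T \<in> bounded_ops K. (\<Sum>n. hinner K (T (x n)) (y n)) \<in> U} | x y U.
        x \<in> square_summable K \<and> y \<in> square_summable K \<and> open U}"

definition weak_star_functional ::
    "'v::complex_vector hspace \<Rightarrow> ('v \<Rightarrow> 'v) set \<Rightarrow> (('v \<Rightarrow> 'v) \<Rightarrow> complex) \<Rightarrow> bool" where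
  "weak_star_functional K \<BB> \<phi> \<longleftrightarrow>
     (\<forall>S\<in>\<BB>. \<forall>T\<in>\<BB>. \<phi> (S + T) = \<phi> S + \<phi> T) \<and>
     (\<forall>c. \<forall>T\<in>\<BB>. \<phi> (c *\<^sub>C T) = c * \<phi> T) \<and>
     continuous_map (subtopology (weak_star K) \<BB>) euclidean \<phi>"

definition functional_norm ::
    "'v::complex_vector hspace \<Rightarrow> ('v \<Rightarrow> 'v) set \<Rightarrow> (('v \<Rightarrow> 'v) \<Rightarrow> complex) \<Rightarrow> real" where
  "functional_norm K \<BB> \<phi> = (SUP T\<in>{T \<in> \<BB>. opnorm K T \<le> 1}. cmod (\<phi> T))"

definition property_A1_1 :: "'v::complex_vector hspace \<Rightarrow> ('v \<Rightarrow> 'v) set \<Rightarrow> bool" where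
  "property_A1_1 K \<BB> \<longleftrightarrow>
     (\<forall>\<phi>. weak_star_functional K \<BB> \<phi> \<and> functional_norm K \<BB> \<phi> < 1 \<longrightarrow>
        (\<exists>x\<in>vecs K. \<exists>y\<in>vecs K.
           hnorm K x * hnorm K y < 1 \<and> (\<forall>B\<in>\<BB>. \<phi> B = hinner K (B x) y)))"

definition Lat :: "'v::complex_vector hspace \<Rightarrow> ('v \<Rightarrow> 'v) set \<Rightarrow> 'v set set" where
  "Lat K \<BB> = {L. closed_subspace K L \<and> (\<forall>T\<in>\<BB>. T ` L \<subseteq> L)}"

definition ampl ::
    "'v::complex_vector hspace \<Rightarrow> enat \<Rightarrow> ('v \<Rightarrow> 'v) \<Rightarrow> (nat \<Rightarrow> 'v) \<Rightarrow> (nat \<Rightarrow> 'v)" where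
  "ampl K s T x =
    (if x \<in> vecs (direct_sum K s) then (\<lambda>i. if enat i < s then T (x i) else 0) else 0)"

text \<open>
  An \<open>r\<close> by \<open>r\<close> matrix is a function of two indices, of which only the values at indices
  below \<open>r\<close> matter.
\<close>

definition mat_op ::
    "'v::complex_vector hspace \<Rightarrow> nat \<Rightarrow> (nat \<Rightarrow> nat \<Rightarrow> 'v \<Rightarrow> 'v) \<Rightarrow> (nat \<Rightarrow> 'v) \<Rightarrow> (nat \<Rightarrow> 'v)" where
  "mat_op K r T x =
    (if x \<in> vecs (direct_sum K (enat r)) then (\<lambda>i. if i < r then \<Sum>j<r. T i j (x j) else 0) else 0)"

definition mats :: "nat \<Rightarrow> 'a set \<Rightarrow> (nat \<Rightarrow> nat \<Rightarrow> 'a) set" where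
  "mats r S = {F. \<forall>i<r. \<forall>j<r. F i j \<in> S}"

definition mat_alg ::
    "'v::complex_vector hspace \<Rightarrow> nat \<Rightarrow> ('v \<Rightarrow> 'v) set \<Rightarrow> ((nat \<Rightarrow> 'v) \<Rightarrow> (nat \<Rightarrow> 'v)) set" where
  "mat_alg K r \<BB> = mat_op K r ` mats r \<BB>"


section \<open>Reproducing kernel Hilbert spaces and multipliers\<close>

text \<open>The underlying set is the type \<open>'x\<close>.\<close>

locale rkhs = hilbert_space H for H :: "('x \<Rightarrow> complex) hspace" +
  assumes kernel: "\<exists>k\<in>vecs H. k \<noteq> 0 \<and> (\<forall>h\<in>vecs H. h z = hinner H h k)"

definition multipliers :: "('x \<Rightarrow> complex) hspace \<Rightarrow> ('x \<Rightarrow> complex) set" where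
  "multipliers H = {f. \<forall>h\<in>vecs H. f * h \<in> vecs H}"

definition mult_op ::
    "('x \<Rightarrow> complex) hspace \<Rightarrow> ('x \<Rightarrow> complex) \<Rightarrow> ('x \<Rightarrow> complex) \<Rightarrow> ('x \<Rightarrow> complex)" where
  "mult_op H f h = (if h \<in> vecs H then f * h else 0)"

definition ampl_mult_op ::
    "('x \<Rightarrow> complex) hspace \<Rightarrow> enat \<Rightarrow> ('x \<Rightarrow> complex)
      \<Rightarrow> (nat \<Rightarrow> 'x \<Rightarrow> complex) \<Rightarrow> (nat \<Rightarrow> 'x \<Rightarrow> complex)" where
  "ampl_mult_op H s f = ampl H s (mult_op H f)"

definition dual_algebra_of_multipliers ::
    "('x \<Rightarrow> complex) hspace \<Rightarrow> ('x \<Rightarrow> complex) set \<Rightarrow> bool" where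
  "dual_algebra_of_multipliers H \<AA> \<longleftrightarrow>
     \<AA> \<subseteq> multipliers H \<and> complex_vector.subspace \<AA> \<and>
     (\<forall>f\<in>\<AA>. \<forall>g\<in>\<AA>. f * g \<in> \<AA>) \<and> 1 \<in> \<AA> \<and>
     closedin (weak_star H) (mult_op H ` \<AA>)"

definition separates :: "('x \<Rightarrow> complex) set \<Rightarrow> 'x set \<Rightarrow> bool" where
  "separates \<AA> E \<longleftrightarrow> (\<forall>z\<in>E. \<forall>w\<in>E. z \<noteq> w \<longrightarrow> (\<exists>f\<in>\<AA>. f z \<noteq> f w))"

definition vanishing_ideal :: "('x \<Rightarrow> complex) set \<Rightarrow> 'x set \<Rightarrow> ('x \<Rightarrow> complex) set" where
  "vanishing_ideal \<AA> E = {f \<in> \<AA>. \<forall>z\<in>E. f z = 0}"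

text \<open>The norm is that of the operator given by \<open>F\<close> on \<open>r\<close> copies of \<open>H\<close>.\<close>

definition mult_norm ::
    "('x \<Rightarrow> complex) hspace \<Rightarrow> nat \<Rightarrow> (nat \<Rightarrow> nat \<Rightarrow> 'x \<Rightarrow> complex) \<Rightarrow> real" where
  "mult_norm H r F = opnorm (direct_sum H (enat r)) (mat_op H r (\<lambda>i j. mult_op H (F i j)))"

definition mult_dist ::
    "('x \<Rightarrow> complex) hspace \<Rightarrow> nat \<Rightarrow> (nat \<Rightarrow> nat \<Rightarrow> 'x \<Rightarrow> complex)
      \<Rightarrow> (nat \<Rightarrow> nat \<Rightarrow> 'x \<Rightarrow> complex) set \<Rightarrow> real" where
  "mult_dist H r F \<G> = (INF G\<in>\<G>. mult_norm H r (F - G))"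


section \<open>Nevanlinna-Pick families\<close>

text \<open>
  The functions in \<open>\<AA>\<close> act on a space \<open>K\<close> through \<open>\<rho>\<close>; this is instantiated below with
  the multiplication operators on \<open>H\<close> and with their ampliations.
\<close>

definition N_space ::
    "'v::complex_vector hspace \<Rightarrow> (('x \<Rightarrow> complex) \<Rightarrow> 'v \<Rightarrow> 'v)
      \<Rightarrow> ('x \<Rightarrow> complex) set \<Rightarrow> 'v set \<Rightarrow> 'v set" where
  "N_space K \<rho> \<JJ> L = ominus K L {\<rho> g x | g x. g \<in> \<JJ> \<and> x \<in> L}"

definition NP_family_for ::
    "('x \<Rightarrow> complex) hspace \<Rightarrow> ('x \<Rightarrow> complex) set \<Rightarrow> nat
      \<Rightarrow> 'v::complex_vector hspace \<Rightarrow> (('x \<Rightarrow> complex) \<Rightarrow> 'v \<Rightarrow> 'v) \<Rightarrow> bool" where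
  "NP_family_for H \<AA> r K \<rho> \<longleftrightarrow>
     (\<forall>E F. finite E \<and> separates \<AA> E \<and> F \<in> mats r \<AA> \<longrightarrow>
        mult_dist H r F (mats r (vanishing_ideal \<AA> E)) =
        (SUP L\<in>Lat K (\<rho> ` \<AA>).
           let P = ampl K (enat r) (orth_proj K (N_space K \<rho> (vanishing_ideal \<AA> E) L))
           in opnorm (direct_sum K (enat r)) (P \<circ> mat_op K r (\<lambda>i j. \<rho> (F i j)) \<circ> P)))"

definition Lat_NP_family ::
    "('x \<Rightarrow> complex) hspace \<Rightarrow> ('x \<Rightarrow> complex) set \<Rightarrow> nat \<Rightarrow> bool" where
  "Lat_NP_family H \<AA> r \<longleftrightarrow> NP_family_for H \<AA> r H (mult_op H)"

definition Lat_ampl_NP_family ::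
    "('x \<Rightarrow> complex) hspace \<Rightarrow> ('x \<Rightarrow> complex) set \<Rightarrow> enat \<Rightarrow> nat \<Rightarrow> bool" where
  "Lat_ampl_NP_family H \<AA> s r \<longleftrightarrow> NP_family_for H \<AA> r (direct_sum H s) (ampl_mult_op H s)"

definition Lat_ampl_complete_NP_family ::
    "('x \<Rightarrow> complex) hspace \<Rightarrow> ('x \<Rightarrow> complex) set \<Rightarrow> enat \<Rightarrow> bool" where
  "Lat_ampl_complete_NP_family H \<AA> s \<longleftrightarrow> (\<forall>r\<ge>1. Lat_ampl_NP_family H \<AA> s r)"

end

theory Submission
  imports Defs
begin

text \<open>
  The two inequalities behind the distance formula are of different nature. Let \<open>J\<close> be the ideal of
  functions in the algebra that vanish on \<open>E\<close>, and let \<open>N = L \<ominus> J L\<close> for an invariant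
  subspace \<open>L\<close>. An element of \<open>J\<close> maps \<open>N\<close> into \<open>J L\<close>, so its compression to \<open>N\<close> is zero.
  Compressing \<open>F\<close> is therefore the same as compressing \<open>F - G\<close> for any matrix \<open>G\<close> over \<open>J\<close>, and no
  compression exceeds the distance (\<open>compression_le\<close>).

  For the other inequality suppose that vectors \<open>X\<close>, \<open>Y\<close> give a functional
  \<open>T \<mapsto> \<langle>T X, Y\<rangle>\<close> that annihilates the matrices over \<open>J\<close>. Let \<open>L\<close> be the invariant
  subspace generated by the components of \<open>X\<close>. Projecting the components of \<open>Y\<close> to \<open>L\<close> does
  not change the functional on the algebra, and puts them into \<open>N\<close> because they are orthogonal to
  \<open>J L\<close>. The compression to \<open>L\<close> of the adjoint of a multiplier maps \<open>N\<close> into \<open>N\<close>, so \<open>X\<close> may be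
  projected to \<open>N\<close> as well. The value of the functional at \<open>F\<close> is then that of the compression of
  \<open>F\<close>, and it is bounded by its norm times \<open>\<parallel>X\<parallel> \<parallel>Y\<parallel>\<close> (\<open>compression_ge\<close>). What remains is to find, for
  every \<open>c\<close> below the distance, such \<open>X\<close> and \<open>Y\<close> whose functional exceeds \<open>c \<parallel>X\<parallel> \<parallel>Y\<parallel>\<close> at \<open>F\<close>
  (\<open>NP_family_if_vector_functionals\<close>).

  They come from the duality between bounded operators and the weak-* continuous functionals
  \<open>T \<mapsto> \<Sum>n. \<langle>T (x n), y n\<rangle>\<close> with square-summable \<open>x\<close>, \<open>y\<close>. If every such functional that
  annihilates the matrices over \<open>J\<close> were bounded at \<open>F\<close> by \<open>c \<parallel>x\<parallel> \<parallel>y\<parallel>\<close>, then evaluation at \<open>F\<close>, restricted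
  to these annihilating functionals, would extend with the same bound to all functionals of this
  form by the Hahn-Banach theorem. The extension is evaluation at an operator \<open>G\<close> of norm at most \<open>c\<close>, and \<open>F - G\<close> is killed by all
  functionals that kill the matrices over \<open>J\<close> (\<open>dual_extension\<close>). Since the algebra is weak-*
  closed and point evaluations are weak-* continuous, \<open>F - G\<close> is a matrix over \<open>J\<close>, so the distance
  is at most \<open>c\<close> (\<open>multiplier_distance_duality\<close>).

  The functional so obtained is given by sequences \<open>x\<close>, \<open>y\<close> in \<open>H\<^sup>r\<close>. Property A1(1) replaces the
  sequences by single vectors. On the infinite ampliation they are such vectors already: a square-summable
  sequence in \<open>H\<^sup>r\<close> is, after transposition, a vector of \<open>r\<close> components in the infinite ampliation of \<open>H\<close>.
\<close>

section \<open>Projections and the Riesz representation\<close>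

context hilbert_space
begin

lemma zero_vecs [simp]: "0 \<in> vecs K"
  using subspace_vecs by (rule complex_vector.subspace_0)

lemma add_vecs [simp]: "x \<in> vecs K \<Longrightarrow> y \<in> vecs K \<Longrightarrow> x + y \<in> vecs K"
  using subspace_vecs by (rule complex_vector.subspace_add)

lemma scaleC_vecs [simp]: "x \<in> vecs K \<Longrightarrow> c *\<^sub>C x \<in> vecs K"
  using subspace_vecs by (rule complex_vector.subspace_scale)

lemma diff_vecs [simp]: "x \<in> vecs K \<Longrightarrow> y \<in> vecs K \<Longrightarrow> x - y \<in> vecs K"
  using subspace_vecs by (rule complex_vector.subspace_diff)

lemma uminus_vecs [simp]: "x \<in> vecs K \<Longrightarrow> - x \<in> vecs K"
  using subspace_vecs by (rule complex_vector.subspace_neg)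

lemma sum_vecs [simp]: "(\<And>i. i \<in> I \<Longrightarrow> f i \<in> vecs K) \<Longrightarrow> sum f I \<in> vecs K"
  using subspace_vecs by (rule complex_vector.subspace_sum)

lemma inner_add_right:
  assumes "x \<in> vecs K" "y \<in> vecs K" "z \<in> vecs K"
  shows "hinner K x (y + z) = hinner K x y + hinner K x z"
  using assms inner_commute[of x "y + z"] inner_commute[of x y] inner_commute[of x z]
  by (simp add: inner_add_left)

lemma inner_scaleC_right:
  assumes "x \<in> vecs K" "y \<in> vecs K"
  shows "hinner K x (c *\<^sub>C y) = cnj c * hinner K x y"
  using assms inner_commute[of x "c *\<^sub>C y"] inner_commute[of x y]
  by (simp add: inner_scaleC_left)

lemma inner_zero_left [simp]: "x \<in> vecs K \<Longrightarrow> hinner K 0 x = 0"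
  using inner_scaleC_left[of 0 x 0] by simp

lemma inner_zero_right [simp]: "x \<in> vecs K \<Longrightarrow> hinner K x 0 = 0"
  using inner_scaleC_right[of x 0 0] by simp

lemma inner_uminus_left:
  "x \<in> vecs K \<Longrightarrow> y \<in> vecs K \<Longrightarrow> hinner K (- x) y = - hinner K x y"
  using inner_scaleC_left[of x y "-1"] by (simp add: complex_vector.scale_minus_left)

lemma inner_uminus_right:
  "x \<in> vecs K \<Longrightarrow> y \<in> vecs K \<Longrightarrow> hinner K x (- y) = - hinner K x y"
  using inner_scaleC_right[of x y "-1"] by (simp add: complex_vector.scale_minus_left)

lemma inner_diff_left:
  "x \<in> vecs K \<Longrightarrow> y \<in> vecs K \<Longrightarrow> z \<in> vecs K \<Longrightarrow>
    hinner K (x - y) z = hinner K x z - hinner K y z"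
  using inner_add_left[of x "- y" z] by (simp add: inner_uminus_left)

lemma inner_diff_right:
  "x \<in> vecs K \<Longrightarrow> y \<in> vecs K \<Longrightarrow> z \<in> vecs K \<Longrightarrow>
    hinner K x (y - z) = hinner K x y - hinner K x z"
  using inner_add_right[of x y "- z"] by (simp add: inner_uminus_right)

lemma inner_sum_left:
  assumes "\<And>i. i \<in> I \<Longrightarrow> f i \<in> vecs K" "z \<in> vecs K"
  shows "hinner K (sum f I) z = (\<Sum>i\<in>I. hinner K (f i) z)"
  using assms by (induction I rule: infinite_finite_induct) (simp_all add: inner_add_left)

lemmas inner_simps = inner_add_left inner_add_right inner_diff_left inner_diff_right
  inner_scaleC_left inner_scaleC_right inner_uminus_left inner_uminus_right

lemma hnorm_nonneg [simp]: "x \<in> vecs K \<Longrightarrow> 0 \<le> hnorm K x"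
  by (simp add: hnorm_def inner_nonneg)

lemma hnorm_power2: "x \<in> vecs K \<Longrightarrow> (hnorm K x)\<^sup>2 = Re (hinner K x x)"
  by (simp add: hnorm_def inner_nonneg)

lemma inner_self:
  assumes "x \<in> vecs K" shows "hinner K x x = complex_of_real ((hnorm K x)\<^sup>2)"
proof -
  have "Im (hinner K x x) = 0"
    using inner_commute[OF assms assms] by (metis cnj.simps(2) neg_equal_zero)
  then show ?thesis using assms by (simp add: complex_eq_iff hnorm_power2)
qed

lemma hnorm_zero [simp]: "hnorm K 0 = 0"
  by (simp add: hnorm_def)

lemma hnorm_eq_0: "x \<in> vecs K \<Longrightarrow> hnorm K x = 0 \<longleftrightarrow> x = 0"
  using inner_definite[of x] by (auto simp: inner_self)

lemma hnorm_scaleC: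
  assumes "x \<in> vecs K" shows "hnorm K (c *\<^sub>C x) = cmod c * hnorm K x"
proof -
  have "hinner K (c *\<^sub>C x) (c *\<^sub>C x) = (c * cnj c) * hinner K x x"
    using assms by (simp add: inner_simps)
  also have "\<dots> = of_real ((cmod c * hnorm K x)\<^sup>2)"
    using assms by (simp only: inner_self complex_norm_square[symmetric] power_mult_distrib of_real_mult)
  finally have "(hnorm K (c *\<^sub>C x))\<^sup>2 = (cmod c * hnorm K x)\<^sup>2"
    using assms by (simp only: inner_self scaleC_vecs of_real_eq_iff)
  then show ?thesis using assms by (simp add: power2_eq_iff_nonneg)
qed

lemma hnorm_uminus: "x \<in> vecs K \<Longrightarrow> hnorm K (- x) = hnorm K x"
  using hnorm_scaleC[of x "-1"] by (simp add: complex_vector.scale_minus_left)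

lemma hnorm_minus_commute:
  "x \<in> vecs K \<Longrightarrow> y \<in> vecs K \<Longrightarrow> hnorm K (x - y) = hnorm K (y - x)"
  using hnorm_uminus[of "x - y"] by simp

lemma hnorm_add_power2:
  assumes "x \<in> vecs K" "y \<in> vecs K"
  shows "(hnorm K (x + y))\<^sup>2 = (hnorm K x)\<^sup>2 + 2 * Re (hinner K x y) + (hnorm K y)\<^sup>2"
  using assms inner_commute[of y x] by (simp add: hnorm_power2 inner_simps)

lemma hnorm_diff_power2:
  assumes "x \<in> vecs K" "y \<in> vecs K"
  shows "(hnorm K (x - y))\<^sup>2 = (hnorm K x)\<^sup>2 - 2 * Re (hinner K x y) + (hnorm K y)\<^sup>2"
  using hnorm_add_power2[of x "- y"] assms by (simp add: inner_uminus_right hnorm_uminus)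

text \<open>
  Subtracting the component along \<open>y\<close> lowers the squared norm by exactly the amount that
  appears in the Cauchy-Schwarz inequality; the same identity shows that a best
  approximation in a subspace leaves an orthogonal remainder.
\<close>

lemma hnorm_remove_component:
  assumes "x \<in> vecs K" "y \<in> vecs K" "y \<noteq> 0"
  shows "(hnorm K (x - (hinner K x y / of_real ((hnorm K y)\<^sup>2)) *\<^sub>C y))\<^sup>2 =
    (hnorm K x)\<^sup>2 - (cmod (hinner K x y))\<^sup>2 / (hnorm K y)\<^sup>2"
proof -
  define n where "n = (hnorm K y)\<^sup>2"
  have n: "n > 0" using assms hnorm_eq_0[of y] by (simp add: n_def)
  define w where "w = hinner K x y"
  have "Re (hinner K x ((w / of_real n) *\<^sub>C y)) = Re (cnj w * w / of_real n)"
    using assms by (simp add: inner_simps w_def[symmetric])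
  also have "\<dots> = (cmod w)\<^sup>2 / n"
    by (metis complex_norm_square mult.commute Re_complex_of_real of_real_divide)
  finally have 1: "Re (hinner K x ((w / of_real n) *\<^sub>C y)) = (cmod w)\<^sup>2 / n" .
  have 2: "(hnorm K ((w / of_real n) *\<^sub>C y))\<^sup>2 = (cmod w)\<^sup>2 / n"
    using assms n
    by (simp add: hnorm_scaleC power_mult_distrib norm_divide power_divide n_def[symmetric])
      (simp add: power2_eq_square)
  show ?thesis
    using assms hnorm_diff_power2[of x "(w / of_real n) *\<^sub>C y"] 1 2
    unfolding w_def n_def by simp
qed

lemma Cauchy_Schwarz:
  assumes "x \<in> vecs K" "y \<in> vecs K"
  shows "cmod (hinner K x y) \<le> hnorm K x * hnorm K y"
proof (cases "y = 0")
  case False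
  then have n: "(hnorm K y)\<^sup>2 > 0" using assms hnorm_eq_0[of y] by simp
  have "(cmod (hinner K x y))\<^sup>2 / (hnorm K y)\<^sup>2 \<le> (hnorm K x)\<^sup>2"
    using hnorm_remove_component[OF assms False] by (metis diff_ge_0_iff_ge zero_le_power2)
  then have "(cmod (hinner K x y))\<^sup>2 \<le> (hnorm K x * hnorm K y)\<^sup>2"
    using n by (simp add: divide_simps power_mult_distrib)
  then show ?thesis by (rule power2_le_imp_le) (use assms in simp)
qed (use assms in simp)

lemma hnorm_triangle:
  assumes "x \<in> vecs K" "y \<in> vecs K"
  shows "hnorm K (x + y) \<le> hnorm K x + hnorm K y"
proof -
  have "Re (hinner K x y) \<le> hnorm K x * hnorm K y"
    using Cauchy_Schwarz[OF assms] complex_Re_le_cmod order_trans by blast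
  then have "(hnorm K (x + y))\<^sup>2 \<le> (hnorm K x + hnorm K y)\<^sup>2"
    using assms by (simp add: hnorm_add_power2 power2_sum)
  then show ?thesis by (rule power2_le_imp_le) (use assms in simp)
qed

lemma hnorm_sum:
  assumes "\<And>i. i \<in> I \<Longrightarrow> f i \<in> vecs K"
  shows "hnorm K (sum f I) \<le> (\<Sum>i\<in>I. hnorm K (f i))"
  using assms
proof (induction I rule: infinite_finite_induct)
  case (insert a I)
  then show ?case using hnorm_triangle[of "f a" "sum f I"] by simp
qed simp_all

lemma hnorm_triangle_diff:
  assumes "x \<in> vecs K" "y \<in> vecs K" "z \<in> vecs K"
  shows "hnorm K (x - z) \<le> hnorm K (x - y) + hnorm K (y - z)"
  using hnorm_triangle[of "x - y" "y - z"] assms by simp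

lemma hnorm_add_power2_le:
  assumes "x \<in> vecs K" "y \<in> vecs K"
  shows "(hnorm K (x + y))\<^sup>2 \<le> 2 * (hnorm K x)\<^sup>2 + 2 * (hnorm K y)\<^sup>2"
proof -
  have "(hnorm K (x + y))\<^sup>2 \<le> (hnorm K x + hnorm K y)\<^sup>2"
    using assms hnorm_triangle by (intro power_mono) auto
  also have "\<dots> \<le> 2 * (hnorm K x)\<^sup>2 + 2 * (hnorm K y)\<^sup>2"
    using sum_squares_ge_zero[of "hnorm K x - hnorm K y" 0]
    by (simp add: power2_eq_square algebra_simps)
  finally show ?thesis .
qed

lemma tendsto_inner_left:
  assumes "\<And>n. u n \<in> vecs K" "l \<in> vecs K" "y \<in> vecs K" "(\<lambda>n. hnorm K (u n - l)) \<longlonglongrightarrow> 0"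
  shows "(\<lambda>n. hinner K (u n) y) \<longlonglongrightarrow> hinner K l y"
proof -
  have "(\<lambda>n. hinner K (u n) y - hinner K l y) \<longlonglongrightarrow> 0"
  proof (rule Lim_null_comparison[OF always_eventually])
    show "(\<lambda>n. hnorm K (u n - l) * hnorm K y) \<longlonglongrightarrow> 0"
      using tendsto_mult_left_zero[OF assms(4)] .
    show "\<forall>n. norm (hinner K (u n) y - hinner K l y) \<le> hnorm K (u n - l) * hnorm K y"
      using Cauchy_Schwarz[of "u _ - l" y] assms by (simp add: inner_simps)
  qed
  then show ?thesis by (simp add: LIM_zero_iff)
qed

lemma eq_if_inner_eq:
  assumes "x \<in> vecs K" "y \<in> vecs K" "\<And>z. z \<in> vecs K \<Longrightarrow> hinner K x z = hinner K y z"
  shows "x = y"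
proof -
  have "hinner K (x - y) (x - y) = 0" using assms by (simp add: inner_simps)
  then show ?thesis using inner_definite[of "x - y"] assms by simp
qed

text \<open>
  A minimizing sequence for the distance from \<open>x\<close> to \<open>L\<close> is Cauchy by the parallelogram law. At its
  limit the distance is attained, and a nonzero inner product of the remainder with some \<open>n\<close> in \<open>L\<close>
  could be used to shorten it further.
\<close>

lemma projection_exists:
  assumes L: "closed_subspace K L" and x: "x \<in> vecs K"
  shows "\<exists>p\<in>L. \<forall>n\<in>L. hinner K (x - p) n = 0"
proof -
  have sub: "complex_vector.subspace L" and LK: "L \<subseteq> vecs K"
    using L by (auto simp: closed_subspace_def)
  note [simp] = subsetD[OF LK]
  define D where "D = (\<lambda>l. (hnorm K (x - l))\<^sup>2) ` L"
  define d where "d = Inf D"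
  have ne: "D \<noteq> {}" using complex_vector.subspace_0[OF sub] by (auto simp: D_def)
  have bdd: "bdd_below D" by (rule bdd_belowI[of _ 0]) (auto simp: D_def)
  have lower: "d \<le> (hnorm K (x - l))\<^sup>2" if "l \<in> L" for l
    unfolding d_def using that bdd by (intro cInf_lower) (auto simp: D_def)
  have "\<exists>l\<in>L. (hnorm K (x - l))\<^sup>2 < d + inverse (real (Suc n))" for n
  proof -
    have "Inf D < d + inverse (real (Suc n))" by (simp add: d_def)
    then show ?thesis using cInf_lessD[OF ne] by (auto simp: D_def)
  qed
  then obtain u where uL: "u n \<in> L" and u: "(hnorm K (x - u n))\<^sup>2 < d + inverse (real (Suc n))" for n
    by metis
  have uK [simp]: "u n \<in> vecs K" for n using uL by simp
  \<comment> \<open>The parallelogram law and the midpoint of \<open>u m\<close> and \<open>u n\<close> bound their distance.\<close>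
  have par: "(hnorm K (u m - u n))\<^sup>2 < 2 * inverse (real (Suc m)) + 2 * inverse (real (Suc n))" for m n
  proof -
    define v where "v = (1/2) *\<^sub>C (u m + u n)"
    have v: "v \<in> L" unfolding v_def
      by (intro complex_vector.subspace_scale complex_vector.subspace_add sub uL)
    have "x = (1/2) *\<^sub>C (x + x)"
      unfolding scaleC_add_right scaleC_add_left[symmetric] by (simp add: scaleC_one)
    then have "x - v = (1/2) *\<^sub>C ((x + x) - (u m + u n))"
      unfolding v_def complex_vector.scale_right_diff_distrib by metis
    moreover have "(x + x) - (u m + u n) = (x - u m) + (x - u n)" by simp
    ultimately have e: "x - v = (1/2) *\<^sub>C ((x - u m) + (x - u n))" by simp
    have "4 * (hnorm K (x - v))\<^sup>2 = (hnorm K ((x - u m) + (x - u n)))\<^sup>2"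
      unfolding e using x by (subst hnorm_scaleC) (auto simp: power_mult_distrib power_divide)
    moreover have "(x - u m) - (x - u n) = u n - u m" by simp
    then have "(hnorm K (u m - u n))\<^sup>2 = (hnorm K ((x - u m) - (x - u n)))\<^sup>2"
      using hnorm_minus_commute[of "u m" "u n"] by simp
    moreover have "(hnorm K ((x - u m) - (x - u n)))\<^sup>2 + (hnorm K ((x - u m) + (x - u n)))\<^sup>2 =
        2 * (hnorm K (x - u m))\<^sup>2 + 2 * (hnorm K (x - u n))\<^sup>2"
      using x by (subst hnorm_diff_power2, simp, simp, subst hnorm_add_power2) simp_all
    ultimately show ?thesis using u[of m] u[of n] lower[OF v] by argo
  qed
  have "\<exists>N. \<forall>m\<ge>N. \<forall>n\<ge>N. hnorm K (u m - u n) < e" if "e > 0" for e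
  proof -
    have "e\<^sup>2 / 4 > 0" using that by simp
    then obtain N where N: "inverse (real (Suc N)) < e\<^sup>2 / 4" using reals_Archimedean by blast
    have *: "inverse (real (Suc n)) \<le> inverse (real (Suc N))" if "n \<ge> N" for n
      using that by (simp add: field_simps)
    show ?thesis
    proof (intro exI allI impI)
      fix m n assume "N \<le> m" "N \<le> n"
      then have "(hnorm K (u m - u n))\<^sup>2 < e\<^sup>2" using par[of m n] *[of m] *[of n] N by argo
      then show "hnorm K (u m - u n) < e" using that by (simp add: power_less_imp_less_base)
    qed
  qed
  then obtain l where l: "l \<in> vecs K" and lim: "(\<lambda>n. hnorm K (u n - l)) \<longlonglongrightarrow> 0"
    using complete[of u] by auto
  have lL: "l \<in> L" using L uL l lim unfolding closed_subspace_def by blast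
  have near: "(hnorm K (x - l))\<^sup>2 \<le> d"
  proof -
    have "(\<lambda>n. d + inverse (real (Suc n))) \<longlonglongrightarrow> d"
      using tendsto_add[OF tendsto_const LIMSEQ_inverse_real_of_nat] by simp
    moreover have "d \<ge> 0" using ne unfolding d_def by (intro cInf_greatest) (auto simp: D_def)
    ultimately have lim2: "(\<lambda>n. sqrt (d + inverse (real (Suc n))) + hnorm K (u n - l)) \<longlonglongrightarrow> sqrt d + 0"
      by (intro tendsto_add tendsto_real_sqrt lim)
    have "hnorm K (x - l) \<le> sqrt (d + inverse (real (Suc n))) + hnorm K (u n - l)" for n
    proof -
      have "hnorm K (x - u n) \<le> sqrt (d + inverse (real (Suc n)))"
        using u[of n] by (intro real_le_rsqrt) simp
      then show ?thesis using hnorm_triangle_diff[of x "u n" l] x l by simp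
    qed
    then have "hnorm K (x - l) \<le> sqrt d"
      using LIMSEQ_le_const[OF lim2, of "hnorm K (x - l)"] by auto
    then have "(hnorm K (x - l))\<^sup>2 \<le> (sqrt d)\<^sup>2" using x l by (intro power_mono) auto
    then show ?thesis using \<open>d \<ge> 0\<close> by simp
  qed
  have "hinner K (x - l) n = 0" if n: "n \<in> L" for n
  proof (cases "n = 0")
    case False
    define c where "c = hinner K (x - l) n / of_real ((hnorm K n)\<^sup>2)"
    have "l + c *\<^sub>C n \<in> L"
      by (intro complex_vector.subspace_scale complex_vector.subspace_add sub n lL)
    then have "d \<le> (hnorm K (x - l - c *\<^sub>C n))\<^sup>2" using lower by (simp add: diff_diff_add)
    then have "(cmod (hinner K (x - l) n))\<^sup>2 / (hnorm K n)\<^sup>2 \<le> 0"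
      using hnorm_remove_component[of "x - l" n] near x l n False unfolding c_def by simp
    moreover have "(hnorm K n)\<^sup>2 > 0" using n False hnorm_eq_0[of n] by simp
    ultimately show ?thesis by (simp add: divide_le_0_iff)
  qed (use x l in simp)
  then show ?thesis using lL by blast
qed

lemma orth_proj:
  assumes L: "closed_subspace K L" and x: "x \<in> vecs K"
  shows orth_proj_in: "orth_proj K L x \<in> L"
    and orth_proj_orth: "\<And>n. n \<in> L \<Longrightarrow> hinner K (x - orth_proj K L x) n = 0"
    and orth_proj_unique: "\<And>p. p \<in> L \<Longrightarrow> (\<And>n. n \<in> L \<Longrightarrow> hinner K (x - p) n = 0) \<Longrightarrow> orth_proj K L x = p"
proof -
  have sub: "complex_vector.subspace L" and LK: "L \<subseteq> vecs K"
    using L by (auto simp: closed_subspace_def)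
  note [simp] = subsetD[OF LK]
  have uniq: "p = q" if p: "p \<in> L" "\<forall>n\<in>L. hinner K (x - p) n = 0"
    and q: "q \<in> L" "\<forall>n\<in>L. hinner K (x - q) n = 0" for p q
  proof -
    have "p - q \<in> L" using p q sub complex_vector.subspace_diff by blast
    then have "hinner K (x - q) (p - q) - hinner K (x - p) (p - q) = 0" using p q by simp
    moreover have "hinner K (x - q) (p - q) - hinner K (x - p) (p - q) = hinner K (p - q) (p - q)"
      using x p q by (simp add: inner_simps)
    ultimately show ?thesis using inner_definite[of "p - q"] p q by simp
  qed
  have ex1: "\<exists>!p. p \<in> L \<and> (\<forall>n\<in>L. hinner K (x - p) n = 0)"
    using projection_exists[OF assms] uniq by blast
  have *: "orth_proj K L x \<in> L \<and> (\<forall>n\<in>L. hinner K (x - orth_proj K L x) n = 0)"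
    unfolding orth_proj_def using theI'[OF ex1] x by simp
  then show "orth_proj K L x \<in> L" "\<And>n. n \<in> L \<Longrightarrow> hinner K (x - orth_proj K L x) n = 0"
    by auto
  show "orth_proj K L x = p" if "p \<in> L" "\<And>n. n \<in> L \<Longrightarrow> hinner K (x - p) n = 0" for p
    using uniq * that by blast
qed

text \<open>
  The functional vanishes on a closed subspace. A vector \<open>e\<close> orthogonal to that subspace spans a
  complement of it, and a multiple of \<open>e\<close> represents the functional.
\<close>

lemma Riesz:
  assumes add: "\<And>x y. x \<in> vecs K \<Longrightarrow> y \<in> vecs K \<Longrightarrow> f (x + y) = f x + f y"
    and scale: "\<And>c x. x \<in> vecs K \<Longrightarrow> f (c *\<^sub>C x) = c * f x"
    and bound: "\<And>x. x \<in> vecs K \<Longrightarrow> cmod (f x) \<le> C * hnorm K x"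
  shows "\<exists>w\<in>vecs K. \<forall>x\<in>vecs K. f x = hinner K x w"
proof -
  define L where "L = {x \<in> vecs K. f x = 0}"
  have f0: "f 0 = 0" using scale[of 0 0] by simp
  have diff: "f (x - y) = f x - f y" if "x \<in> vecs K" "y \<in> vecs K" for x y
    using add[of "x - y" y] that by simp
  have "closed_subspace K L"
    unfolding closed_subspace_def
  proof (intro conjI allI impI)
    show "complex_vector.subspace L"
      by (rule complex_vector.subspaceI) (auto simp: L_def f0 add scale)
    fix u l assume *: "(\<forall>n. u n \<in> L) \<and> l \<in> vecs K \<and> (\<lambda>n. hnorm K (u n - l)) \<longlonglongrightarrow> 0"
    have "cmod (f l) \<le> \<bar>C\<bar> * hnorm K (u n - l)" for n
    proof -
      have "u n \<in> vecs K" "f (u n) = 0" "l \<in> vecs K" using * by (auto simp: L_def)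
      then have "cmod (f l) \<le> C * hnorm K (u n - l)"
        using bound[of "u n - l"] diff[of "u n" l] by simp
      also have "\<dots> \<le> \<bar>C\<bar> * hnorm K (u n - l)"
        using \<open>u n \<in> vecs K\<close> \<open>l \<in> vecs K\<close> by (intro mult_right_mono) auto
      finally show ?thesis .
    qed
    moreover have "(\<lambda>n. \<bar>C\<bar> * hnorm K (u n - l)) \<longlonglongrightarrow> 0"
      using * tendsto_mult_right_zero by blast
    ultimately have "cmod (f l) \<le> 0"
      by (intro LIMSEQ_le_const[of "\<lambda>n. \<bar>C\<bar> * hnorm K (u n - l)" 0 "cmod (f l)"]) auto
    then show "l \<in> L" using * by (simp add: L_def)
  qed (auto simp: L_def)
  note P = this
  show ?thesis
  proof (cases "\<forall>x\<in>vecs K. f x = 0")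
    case True then show ?thesis by (intro bexI[of _ 0]) auto
  next
    case False
    then obtain x0 where x0: "x0 \<in> vecs K" "f x0 \<noteq> 0" by blast
    obtain p where p: "p \<in> L" "\<forall>n\<in>L. hinner K (x0 - p) n = 0"
      using projection_exists[OF P x0(1)] by blast
    define e where "e = x0 - p"
    have e: "e \<in> vecs K" "f e \<noteq> 0" using x0 p by (auto simp: e_def L_def diff)
    have e0: "hnorm K e \<noteq> 0" using e f0 hnorm_eq_0 by auto
    define w where "w = (cnj (f e) / of_real ((hnorm K e)\<^sup>2)) *\<^sub>C e"
    have "f x = hinner K x w" if x: "x \<in> vecs K" for x
    proof -
      have "f e *\<^sub>C x - f x *\<^sub>C e \<in> L" using x e by (simp add: L_def diff scale)
      then have "hinner K e (f e *\<^sub>C x - f x *\<^sub>C e) = 0" using p by (simp add: e_def)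
      then have "hinner K (f e *\<^sub>C x - f x *\<^sub>C e) e = 0"
        using inner_commute[of "f e *\<^sub>C x - f x *\<^sub>C e" e] x e by simp
      then have "f e * hinner K x e = f x * of_real ((hnorm K e)\<^sup>2)"
        using x e by (simp add: inner_simps inner_self)
      then show ?thesis using x e e0 unfolding w_def by (simp add: inner_simps field_simps)
    qed
    moreover have "w \<in> vecs K" using e by (simp add: w_def)
    ultimately show ?thesis by blast
  qed
qed

end

section \<open>Bounded operators\<close>

context hilbert_space
begin

lemma bounded_opsI:
  assumes "\<And>x. x \<in> vecs K \<Longrightarrow> T x \<in> vecs K" "\<And>x. x \<notin> vecs K \<Longrightarrow> T x = 0"
    and "\<And>x y. x \<in> vecs K \<Longrightarrow> y \<in> vecs K \<Longrightarrow> T (x + y) = T x + T y"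
    and "\<And>c x. x \<in> vecs K \<Longrightarrow> T (c *\<^sub>C x) = c *\<^sub>C T x"
    and "\<And>x. x \<in> vecs K \<Longrightarrow> hnorm K (T x) \<le> C * hnorm K x"
  shows "T \<in> bounded_ops K"
  unfolding bounded_ops_def mem_Collect_eq
  by (intro conjI ballI allI impI exI[of _ C] assms)

lemma op_vecs [simp]: "T \<in> bounded_ops K \<Longrightarrow> x \<in> vecs K \<Longrightarrow> T x \<in> vecs K"
  unfolding bounded_ops_def by blast

lemma op_off: "T \<in> bounded_ops K \<Longrightarrow> x \<notin> vecs K \<Longrightarrow> T x = 0"
  unfolding bounded_ops_def by blast

lemma op_add:
  "T \<in> bounded_ops K \<Longrightarrow> x \<in> vecs K \<Longrightarrow> y \<in> vecs K \<Longrightarrow> T (x + y) = T x + T y"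
  unfolding bounded_ops_def by blast

lemma op_scaleC: "T \<in> bounded_ops K \<Longrightarrow> x \<in> vecs K \<Longrightarrow> T (c *\<^sub>C x) = c *\<^sub>C T x"
  unfolding bounded_ops_def by blast

lemma op_zero [simp]: "T \<in> bounded_ops K \<Longrightarrow> T 0 = 0"
  using op_scaleC[of T 0 0] by simp

lemma op_diff:
  assumes "T \<in> bounded_ops K" "x \<in> vecs K" "y \<in> vecs K"
  shows "T (x - y) = T x - T y"
proof -
  have "T x = T (x - y) + T y" using op_add[OF assms(1) diff_vecs[OF assms(2,3)] assms(3)] by simp
  then show ?thesis by simp
qed

lemma op_sum:
  assumes "T \<in> bounded_ops K" "\<And>i. i \<in> I \<Longrightarrow> f i \<in> vecs K"
  shows "T (sum f I) = (\<Sum>i\<in>I. T (f i))"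
  using assms(2)
  by (induction I rule: infinite_finite_induct) (simp_all add: assms(1) op_add)

lemma op_bound:
  assumes "T \<in> bounded_ops K"
  shows "\<exists>C\<ge>0. \<forall>x\<in>vecs K. hnorm K (T x) \<le> C * hnorm K x"
proof -
  obtain C where C: "\<forall>x\<in>vecs K. hnorm K (T x) \<le> C * hnorm K x"
    using assms unfolding bounded_ops_def by blast
  have "hnorm K (T x) \<le> \<bar>C\<bar> * hnorm K x" if "x \<in> vecs K" for x
  proof -
    have "C * hnorm K x \<le> \<bar>C\<bar> * hnorm K x" using that by (intro mult_right_mono) auto
    then show ?thesis using C that by fastforce
  qed
  then show ?thesis by (intro exI[of _ "\<bar>C\<bar>"]) auto
qed

lemma op_comp:
  assumes "S \<in> bounded_ops K" "T \<in> bounded_ops K" shows "S \<circ> T \<in> bounded_ops K"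
proof -
  obtain C where C: "C \<ge> 0" "\<forall>x\<in>vecs K. hnorm K (S x) \<le> C * hnorm K x"
    using op_bound[OF assms(1)] by blast
  obtain D where D: "\<forall>x\<in>vecs K. hnorm K (T x) \<le> D * hnorm K x"
    using op_bound[OF assms(2)] by blast
  show ?thesis
  proof (rule bounded_opsI)
    fix x assume x: "x \<in> vecs K"
    have "hnorm K (S (T x)) \<le> C * hnorm K (T x)" using C x assms by simp
    also have "\<dots> \<le> C * (D * hnorm K x)" using C D x by (intro mult_left_mono) auto
    finally show "hnorm K ((S \<circ> T) x) \<le> (C * D) * hnorm K x" by (simp add: mult.assoc)
  qed (use assms in \<open>auto simp: op_off op_add op_scaleC\<close>)
qed

lemma op_plus:
  assumes "S \<in> bounded_ops K" "T \<in> bounded_ops K" shows "S + T \<in> bounded_ops K"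
proof -
  obtain C where C: "\<forall>x\<in>vecs K. hnorm K (S x) \<le> C * hnorm K x"
    using op_bound[OF assms(1)] by blast
  obtain D where D: "\<forall>x\<in>vecs K. hnorm K (T x) \<le> D * hnorm K x"
    using op_bound[OF assms(2)] by blast
  show ?thesis
  proof (rule bounded_opsI)
    fix x assume x: "x \<in> vecs K"
    have "hnorm K (S x + T x) \<le> hnorm K (S x) + hnorm K (T x)"
      using x assms by (intro hnorm_triangle) auto
    also have "\<dots> \<le> C * hnorm K x + D * hnorm K x" using C D x by (intro add_mono) auto
    finally show "hnorm K ((S + T) x) \<le> (C + D) * hnorm K x" by (simp add: algebra_simps)
  qed (use assms in \<open>auto simp: op_off op_add op_scaleC scaleC_add_right\<close>)
qed

lemma op_scale:
  assumes "T \<in> bounded_ops K" shows "c *\<^sub>C T \<in> bounded_ops K"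
proof -
  obtain D where D: "\<forall>x\<in>vecs K. hnorm K (T x) \<le> D * hnorm K x"
    using op_bound[OF assms(1)] by blast
  show ?thesis
  proof (rule bounded_opsI)
    fix x assume x: "x \<in> vecs K"
    show "hnorm K ((c *\<^sub>C T) x) \<le> (cmod c * D) * hnorm K x"
      using x D assms by (simp add: scaleC_fun_def hnorm_scaleC mult.assoc mult_left_mono)
  qed (use assms in \<open>auto simp: scaleC_fun_def op_off op_add op_scaleC scaleC_add_right
      scaleC_scaleC mult.commute\<close>)
qed

lemma op_minus:
  assumes "S \<in> bounded_ops K" "T \<in> bounded_ops K" shows "S - T \<in> bounded_ops K"
proof -
  have "S - T = S + (-1) *\<^sub>C T"
    by (auto simp: scaleC_fun_def fun_eq_iff complex_vector.scale_minus_left scaleC_one)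
  then show ?thesis using op_plus[OF assms(1) op_scale[OF assms(2), of "-1"]] by metis
qed

lemma opnorm_le:
  assumes "\<And>x. x \<in> vecs K \<Longrightarrow> hnorm K (T x) \<le> C * hnorm K x" "C \<ge> 0"
  shows "opnorm K T \<le> C"
  unfolding opnorm_def
proof (rule cSUP_least)
  show "{x \<in> vecs K. hnorm K x \<le> 1} \<noteq> {}" by (auto intro!: exI[of _ 0])
  fix x assume x: "x \<in> {x \<in> vecs K. hnorm K x \<le> 1}"
  then have "hnorm K (T x) \<le> C * hnorm K x" using assms by simp
  also have "\<dots> \<le> C * 1" using x assms by (intro mult_left_mono) auto
  finally show "hnorm K (T x) \<le> C" by simp
qed

lemma hnorm_le_opnorm_unit:
  assumes T: "T \<in> bounded_ops K" and "x \<in> vecs K" "hnorm K x \<le> 1"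
  shows "hnorm K (T x) \<le> opnorm K T"
  unfolding opnorm_def
proof (rule cSUP_upper)
  obtain C where C: "C \<ge> 0" "\<forall>x\<in>vecs K. hnorm K (T x) \<le> C * hnorm K x"
    using op_bound[OF T] by blast
  show "bdd_above ((\<lambda>x. hnorm K (T x)) ` {x \<in> vecs K. hnorm K x \<le> 1})"
  proof (rule bdd_aboveI2)
    fix x assume x: "x \<in> {x \<in> vecs K. hnorm K x \<le> 1}"
    have "C * hnorm K x \<le> C * 1" using x C by (intro mult_left_mono) auto
    then show "hnorm K (T x) \<le> C" using C x by fastforce
  qed
qed (use assms in auto)

lemma opnorm_nonneg: "T \<in> bounded_ops K \<Longrightarrow> 0 \<le> opnorm K T"
  using hnorm_le_opnorm_unit[of T 0] by simp

lemma hnorm_le_opnorm: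
  assumes T: "T \<in> bounded_ops K" and x: "x \<in> vecs K"
  shows "hnorm K (T x) \<le> opnorm K T * hnorm K x"
proof (cases "x = 0")
  case False
  then have n: "hnorm K x > 0" using x hnorm_eq_0[OF x] hnorm_nonneg[OF x] by linarith
  define u where "u = of_real (inverse (hnorm K x)) *\<^sub>C x"
  have u: "u \<in> vecs K" "hnorm K u = 1" using x n by (simp_all add: u_def hnorm_scaleC norm_inverse)
  have "hnorm K (T u) = inverse (hnorm K x) * hnorm K (T x)"
    using x n T by (simp add: u_def op_scaleC hnorm_scaleC norm_inverse)
  then have "hnorm K (T x) = hnorm K (T u) * hnorm K x" using n by simp
  then show ?thesis using hnorm_le_opnorm_unit[OF T u(1)] u(2) n by (simp add: mult_right_mono)
qed (use T in simp)

lemma closed_subspace_vecs: "closed_subspace K L \<Longrightarrow> x \<in> L \<Longrightarrow> x \<in> vecs K"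
  by (auto simp: closed_subspace_def)

lemma inner_orth_proj:
  assumes L: "closed_subspace K L" and x: "x \<in> vecs K" and n: "n \<in> L"
  shows "hinner K (orth_proj K L x) n = hinner K x n"
    and "hinner K n (orth_proj K L x) = hinner K n x"
proof -
  have v: "orth_proj K L x \<in> vecs K" "n \<in> vecs K"
    using orth_proj_in[OF L x] n L closed_subspace_vecs by blast+
  show *: "hinner K (orth_proj K L x) n = hinner K x n"
    using orth_proj_orth[OF L x n] x v by (simp add: inner_simps)
  show "hinner K n (orth_proj K L x) = hinner K n x"
    using * inner_commute[of n "orth_proj K L x"] inner_commute[of n x] x v by simp
qed

lemma hnorm_orth_proj_le:
  assumes L: "closed_subspace K L" and x: "x \<in> vecs K"
  shows "hnorm K (orth_proj K L x) \<le> hnorm K x"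
proof -
  define p where "p = orth_proj K L x"
  have p: "p \<in> L" "p \<in> vecs K"
    using orth_proj_in[OF L x] L closed_subspace_vecs by (auto simp: p_def)
  have "Re (hinner K x p) = (hnorm K p)\<^sup>2"
    using inner_orth_proj(1)[OF L x p(1)] p by (simp add: p_def[symmetric] hnorm_power2)
  then have "(hnorm K p)\<^sup>2 \<le> (hnorm K x)\<^sup>2"
    using hnorm_diff_power2[of x p] zero_le_power2[of "hnorm K (x - p)"] x p by linarith
  then show ?thesis unfolding p_def[symmetric] by (rule power2_le_imp_le) (use x in simp)
qed

lemma orth_proj_bounded_op:
  assumes L: "closed_subspace K L" shows "orth_proj K L \<in> bounded_ops K"
proof -
  have sub: "complex_vector.subspace L" using L by (simp add: closed_subspace_def)
  have v: "orth_proj K L x \<in> vecs K" if "x \<in> vecs K" for x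
    using orth_proj_in[OF L that] L closed_subspace_vecs by blast
  show ?thesis
  proof (rule bounded_opsI)
    fix x y assume xy: "x \<in> vecs K" "y \<in> vecs K"
    show "orth_proj K L (x + y) = orth_proj K L x + orth_proj K L y"
    proof (rule orth_proj_unique[OF L])
      show "orth_proj K L x + orth_proj K L y \<in> L"
        by (intro complex_vector.subspace_add sub orth_proj_in[OF L] xy)
      fix n assume n: "n \<in> L"
      show "hinner K (x + y - (orth_proj K L x + orth_proj K L y)) n = 0"
        using xy v n closed_subspace_vecs[OF L n] by (simp add: inner_simps inner_orth_proj[OF L])
    qed (use xy in simp)
  next
    fix c x assume x: "x \<in> vecs K"
    show "orth_proj K L (c *\<^sub>C x) = c *\<^sub>C orth_proj K L x"
    proof (rule orth_proj_unique[OF L])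
      show "c *\<^sub>C orth_proj K L x \<in> L"
        by (intro complex_vector.subspace_scale sub orth_proj_in[OF L] x)
      fix n assume n: "n \<in> L"
      show "hinner K (c *\<^sub>C x - c *\<^sub>C orth_proj K L x) n = 0"
        using x v n closed_subspace_vecs[OF L n] by (simp add: inner_simps inner_orth_proj[OF L])
    qed (use x in simp)
  next
    show "hnorm K (orth_proj K L x) \<le> 1 * hnorm K x" if "x \<in> vecs K" for x
      using hnorm_orth_proj_le[OF L that] by simp
  next
    show "orth_proj K L x = 0" if "x \<notin> vecs K" for x using that by (simp add: orth_proj_def)
  qed (rule v)
qed

text \<open>
  This \<open>w\<close> is the value at \<open>y\<close> of the adjoint of \<open>T\<close>.
\<close>

lemma adjoint_vector:
  assumes T: "T \<in> bounded_ops K" and y: "y \<in> vecs K"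
  shows "\<exists>w\<in>vecs K. \<forall>x\<in>vecs K. hinner K (T x) y = hinner K x w"
proof -
  obtain C where C: "\<forall>x\<in>vecs K. hnorm K (T x) \<le> C * hnorm K x" using op_bound[OF T] by blast
  show ?thesis
  proof (rule Riesz[of "\<lambda>x. hinner K (T x) y" "C * hnorm K y"])
    fix x assume x: "x \<in> vecs K"
    have "cmod (hinner K (T x) y) \<le> hnorm K (T x) * hnorm K y"
      using x y T by (intro Cauchy_Schwarz) auto
    also have "\<dots> \<le> C * hnorm K x * hnorm K y" using C x y by (intro mult_right_mono) auto
    finally show "cmod (hinner K (T x) y) \<le> C * hnorm K y * hnorm K x" by (simp add: mult_ac)
  qed (use T y in \<open>simp_all add: op_add op_scaleC inner_simps\<close>)
qed

lemma op_of_sesquilinear_form: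
  assumes add_l: "\<And>x x' y. x \<in> vecs K \<Longrightarrow> x' \<in> vecs K \<Longrightarrow> y \<in> vecs K \<Longrightarrow> b (x + x') y = b x y + b x' y"
    and scale_l: "\<And>c x y. x \<in> vecs K \<Longrightarrow> y \<in> vecs K \<Longrightarrow> b (c *\<^sub>C x) y = c * b x y"
    and add_r: "\<And>x y y'. x \<in> vecs K \<Longrightarrow> y \<in> vecs K \<Longrightarrow> y' \<in> vecs K \<Longrightarrow> b x (y + y') = b x y + b x y'"
    and scale_r: "\<And>c x y. x \<in> vecs K \<Longrightarrow> y \<in> vecs K \<Longrightarrow> b x (c *\<^sub>C y) = cnj c * b x y"
    and bound: "\<And>x y. x \<in> vecs K \<Longrightarrow> y \<in> vecs K \<Longrightarrow> cmod (b x y) \<le> c * hnorm K x * hnorm K y"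
    and c: "c \<ge> 0"
  shows "\<exists>G\<in>bounded_ops K. (\<forall>x\<in>vecs K. \<forall>y\<in>vecs K. hinner K (G x) y = b x y) \<and>
    (\<forall>x\<in>vecs K. hnorm K (G x) \<le> c * hnorm K x)"
proof -
  have "\<exists>w\<in>vecs K. \<forall>y\<in>vecs K. hinner K w y = b x y" if x: "x \<in> vecs K" for x
  proof -
    have "\<exists>w\<in>vecs K. \<forall>y\<in>vecs K. cnj (b x y) = hinner K y w"
      by (rule Riesz[of "\<lambda>y. cnj (b x y)" "c * hnorm K x"]) (simp_all add: add_r scale_r bound x)
    then show ?thesis by (metis inner_commute complex_cnj_cnj)
  qed
  then have "\<exists>g. \<forall>x\<in>vecs K. g x \<in> vecs K \<and> (\<forall>y\<in>vecs K. hinner K (g x) y = b x y)"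
    by (intro bchoice) blast
  then obtain g where "\<forall>x\<in>vecs K. g x \<in> vecs K \<and> (\<forall>y\<in>vecs K. hinner K (g x) y = b x y)" ..
  then have g: "g x \<in> vecs K" "\<And>y. y \<in> vecs K \<Longrightarrow> hinner K (g x) y = b x y"
    if "x \<in> vecs K" for x using that by auto
  define G where "G x = (if x \<in> vecs K then g x else 0)" for x
  have bd: "hnorm K (g x) \<le> c * hnorm K x" if x: "x \<in> vecs K" for x
  proof (cases "hnorm K (g x) = 0")
    case False
    have "hnorm K (g x) * hnorm K (g x) = cmod (hinner K (g x) (g x))"
      using x g by (simp only: inner_self norm_of_real abs_power2 power2_eq_square[symmetric])
    also have "\<dots> \<le> c * hnorm K x * hnorm K (g x)" using g x bound by simp
    finally show ?thesis using False g(1)[OF x] hnorm_nonneg[OF g(1)[OF x]] by simp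
  qed (use c x in simp)
  have "G \<in> bounded_ops K"
  proof (rule bounded_opsI)
    fix x y assume xy: "x \<in> vecs K" "y \<in> vecs K"
    show "G (x + y) = G x + G y"
      by (rule eq_if_inner_eq) (use xy g in \<open>simp_all add: G_def inner_simps add_l\<close>)
  next
    fix a x assume x: "x \<in> vecs K"
    show "G (a *\<^sub>C x) = a *\<^sub>C G x"
      by (rule eq_if_inner_eq) (use x g in \<open>simp_all add: G_def inner_simps scale_l\<close>)
  qed (use g bd in \<open>simp_all add: G_def\<close>)
  then show ?thesis using g bd by (intro bexI[of _ G]) (simp_all add: G_def)
qed

end

section \<open>Direct sums\<close>

definition at_slot :: "nat \<Rightarrow> 'a::zero \<Rightarrow> nat \<Rightarrow> 'a" where
  "at_slot i v = (\<lambda>j. if j = i then v else 0)"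

text \<open>
  This identifies sequences of \<open>r\<close>-tuples with \<open>r\<close>-tuples of sequences: it is the unitary between
  \<open>s\<close> copies of \<open>K\<^sup>r\<close> and \<open>r\<close> copies of the \<open>s\<close>-fold ampliation of \<open>K\<close>.
\<close>

definition transpose_seq :: "(nat \<Rightarrow> nat \<Rightarrow> 'a) \<Rightarrow> nat \<Rightarrow> nat \<Rightarrow> 'a" where
  "transpose_seq x = (\<lambda>i n. x n i)"


lemma scaleC_apply: "(c *\<^sub>C f) x = c *\<^sub>C f x"
  by (simp add: scaleC_fun_def)

context hilbert_space
begin

lemma dsum_mem:
  "x \<in> vecs (direct_sum K s) \<longleftrightarrow>
    (\<forall>i. x i \<in> vecs K) \<and> (\<forall>i. \<not> enat i < s \<longrightarrow> x i = 0) \<and> summable (\<lambda>i. (hnorm K (x i))\<^sup>2)"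
  by (simp add: direct_sum_def) (metis zero_vecs)

lemma dsum_vecs [simp]: "x \<in> vecs (direct_sum K s) \<Longrightarrow> x i \<in> vecs K"
  and dsum_off: "x \<in> vecs (direct_sum K s) \<Longrightarrow> \<not> enat i < s \<Longrightarrow> x i = 0"
  and dsum_summable: "x \<in> vecs (direct_sum K s) \<Longrightarrow> summable (\<lambda>i. (hnorm K (x i))\<^sup>2)"
  by (auto simp: dsum_mem)

lemma dsum_summable_inner:
  assumes "x \<in> vecs (direct_sum K s)" "y \<in> vecs (direct_sum K s)"
  shows "summable (\<lambda>i. hinner K (x i) (y i))"
proof (rule summable_comparison_test)
  show "summable (\<lambda>i. (hnorm K (x i))\<^sup>2 + (hnorm K (y i))\<^sup>2)"
    using assms by (intro summable_add dsum_summable)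
  have "norm (hinner K (x n) (y n)) \<le> (hnorm K (x n))\<^sup>2 + (hnorm K (y n))\<^sup>2" for n
  proof -
    have "norm (hinner K (x n) (y n)) \<le> hnorm K (x n) * hnorm K (y n)"
      using assms by (intro Cauchy_Schwarz) auto
    also have "\<dots> \<le> (hnorm K (x n))\<^sup>2 + (hnorm K (y n))\<^sup>2"
      using sum_squares_bound[of "hnorm K (x n)" "hnorm K (y n)"]
        mult_nonneg_nonneg[of "hnorm K (x n)" "hnorm K (y n)"] assms by (simp del: mult_nonneg_nonneg)
    finally show ?thesis .
  qed
  then show "\<exists>N. \<forall>n\<ge>N. norm (hinner K (x n) (y n)) \<le> (hnorm K (x n))\<^sup>2 + (hnorm K (y n))\<^sup>2"
    by blast
qed

lemma dsum_inner:
  assumes "x \<in> vecs (direct_sum K s)" "y \<in> vecs (direct_sum K s)"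
  shows "hinner (direct_sum K s) x y = (\<Sum>i. hinner K (x i) (y i))"
  unfolding direct_sum_def using assms dsum_off[OF assms(1)]
  by (auto intro!: arg_cong[where f = suminf] simp: fun_eq_iff)

lemma dsum_inner_sums:
  assumes "x \<in> vecs (direct_sum K s)" "y \<in> vecs (direct_sum K s)"
  shows "(\<lambda>i. hinner K (x i) (y i)) sums hinner (direct_sum K s) x y"
  unfolding dsum_inner[OF assms] using dsum_summable_inner[OF assms] by (rule summable_sums)

lemma dsum_inner_self:
  assumes "x \<in> vecs (direct_sum K s)"
  shows "hinner (direct_sum K s) x x = of_real (\<Sum>i. (hnorm K (x i))\<^sup>2)"
proof -
  have "(\<lambda>i. complex_of_real ((hnorm K (x i))\<^sup>2)) sums of_real (\<Sum>i. (hnorm K (x i))\<^sup>2)"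
    using summable_sums[OF dsum_summable[OF assms]] by (rule sums_of_real)
  moreover have "(\<lambda>i. hinner K (x i) (x i)) = (\<lambda>i. complex_of_real ((hnorm K (x i))\<^sup>2))"
    using assms by (simp add: inner_self)
  ultimately show ?thesis using dsum_inner_sums[OF assms assms] sums_unique2 by metis
qed

lemma dsum_hnorm_power2:
  assumes "x \<in> vecs (direct_sum K s)"
  shows "(hnorm (direct_sum K s) x)\<^sup>2 = (\<Sum>i. (hnorm K (x i))\<^sup>2)"
  unfolding hnorm_def[of "direct_sum K s"] dsum_inner_self[OF assms]
  using suminf_nonneg[OF dsum_summable[OF assms]] by simp

lemma dsum_hnorm_nonneg:
  assumes "x \<in> vecs (direct_sum K s)" shows "0 \<le> hnorm (direct_sum K s) x"
  unfolding hnorm_def[of "direct_sum K s"] dsum_inner_self[OF assms]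
  using suminf_nonneg[OF dsum_summable[OF assms]] by simp

lemma dsum_hnorm_coord_le:
  assumes x: "x \<in> vecs (direct_sum K s)" shows "hnorm K (x i) \<le> hnorm (direct_sum K s) x"
proof (rule power2_le_imp_le)
  show "(hnorm K (x i))\<^sup>2 \<le> (hnorm (direct_sum K s) x)\<^sup>2"
    unfolding dsum_hnorm_power2[OF x]
    using sum_le_suminf[OF dsum_summable[OF x], of "{i}"] by simp
qed (rule dsum_hnorm_nonneg[OF x])

lemma dsum_partial_le:
  assumes x: "x \<in> vecs (direct_sum K s)"
  shows "(\<Sum>i<M. (hnorm K (x i))\<^sup>2) \<le> (hnorm (direct_sum K s) x)\<^sup>2"
  unfolding dsum_hnorm_power2[OF x] using sum_le_suminf[OF dsum_summable[OF x], of "{..<M}"] by simp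

lemma dsum_add:
  assumes "x \<in> vecs (direct_sum K s)" "y \<in> vecs (direct_sum K s)"
  shows "x + y \<in> vecs (direct_sum K s)"
  unfolding dsum_mem
proof (intro conjI allI impI)
  show "summable (\<lambda>i. (hnorm K ((x + y) i))\<^sup>2)"
  proof (rule summable_comparison_test)
    show "summable (\<lambda>i. 2 * (hnorm K (x i))\<^sup>2 + 2 * (hnorm K (y i))\<^sup>2)"
      using assms by (intro summable_add summable_mult dsum_summable)
    show "\<exists>N. \<forall>n\<ge>N. norm ((hnorm K ((x + y) n))\<^sup>2) \<le> 2 * (hnorm K (x n))\<^sup>2 + 2 * (hnorm K (y n))\<^sup>2"
      using hnorm_add_power2_le assms by simp
  qed
qed (use assms in \<open>auto simp: dsum_off\<close>)

lemma dsum_scaleC: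
  assumes "x \<in> vecs (direct_sum K s)"
  shows "c *\<^sub>C x \<in> vecs (direct_sum K s)"
  unfolding dsum_mem
proof (intro conjI allI impI)
  show "summable (\<lambda>i. (hnorm K ((c *\<^sub>C x) i))\<^sup>2)"
    using assms by (simp add: scaleC_fun_def hnorm_scaleC power_mult_distrib summable_mult dsum_summable)
qed (use assms in \<open>auto simp: dsum_off scaleC_fun_def\<close>)

lemma tendsto_hnorm_diff:
  assumes "\<And>n. u n \<in> vecs K" "l \<in> vecs K" "a \<in> vecs K" "(\<lambda>n. hnorm K (u n - l)) \<longlonglongrightarrow> 0"
  shows "(\<lambda>n. hnorm K (a - u n)) \<longlonglongrightarrow> hnorm K (a - l)"
proof -
  have "(\<lambda>n. hnorm K (a - u n) - hnorm K (a - l)) \<longlonglongrightarrow> 0"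
  proof (rule Lim_null_comparison[OF always_eventually assms(4)], rule allI)
    fix n
    have "hnorm K (a - u n) \<le> hnorm K (a - l) + hnorm K (u n - l)"
      using hnorm_triangle_diff[of a l "u n"] hnorm_minus_commute[of l "u n"] assms by simp
    moreover have "hnorm K (a - l) \<le> hnorm K (a - u n) + hnorm K (u n - l)"
      using hnorm_triangle_diff[of a "u n" l] assms by simp
    ultimately show "norm (hnorm K (a - u n) - hnorm K (a - l)) \<le> hnorm K (u n - l)" by simp
  qed
  then show ?thesis by (simp add: LIM_zero_iff)
qed

text \<open>
  Only completeness needs work. A Cauchy sequence converges in every coordinate. The bounds on
  finite partial sums of the squared norms of the coordinate differences survive the limit, so that the
  coordinatewise limit is square-summable and is the limit in norm.
\<close>

lemma hilbert_space_direct_sum: "hilbert_space (direct_sum K s)"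
proof
  let ?D = "direct_sum K s"
  show sub: "complex_vector.subspace (vecs ?D)"
  proof (rule complex_vector.subspaceI)
    show "0 \<in> vecs ?D" by (simp add: dsum_mem)
  qed (simp_all add: dsum_add dsum_scaleC)
  fix x y z :: "nat \<Rightarrow> 'v" and c :: complex
  show "hinner ?D (x + y) z = hinner ?D x z + hinner ?D y z"
    if "x \<in> vecs ?D" "y \<in> vecs ?D" "z \<in> vecs ?D"
    using that by (simp add: dsum_inner dsum_add inner_add_left suminf_add dsum_summable_inner)
  show "hinner ?D (c *\<^sub>C x) y = c * hinner ?D x y" if "x \<in> vecs ?D" "y \<in> vecs ?D"
    using that
    by (simp add: dsum_inner dsum_scaleC scaleC_apply inner_scaleC_left suminf_mult dsum_summable_inner)
  show "hinner ?D x y = cnj (hinner ?D y x)" if "x \<in> vecs ?D" "y \<in> vecs ?D"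
  proof -
    have "(\<lambda>i. cnj (hinner K (y i) (x i))) sums cnj (hinner ?D y x)"
      using dsum_inner_sums[OF that(2,1)] by (simp add: sums_cnj)
    moreover have "(\<lambda>i. cnj (hinner K (y i) (x i))) = (\<lambda>i. hinner K (x i) (y i))"
      by (rule ext, rule inner_commute[symmetric]) (use that in simp_all)
    ultimately show ?thesis using dsum_inner_sums[OF that] sums_unique2 by metis
  qed
  show "0 \<le> Re (hinner ?D x x)" if "x \<in> vecs ?D"
    unfolding dsum_inner_self[OF that] using suminf_nonneg[OF dsum_summable[OF that]] by simp
  show "x = 0" if "x \<in> vecs ?D" "hinner ?D x x = 0"
  proof
    fix i
    have "hnorm K (x i) \<le> 0" using dsum_hnorm_coord_le[OF that(1), of i] that(2) by (simp add: hnorm_def[of ?D])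
    then have "hnorm K (x i) = 0" using hnorm_nonneg[OF dsum_vecs[OF that(1), of i]] by linarith
    then show "x i = 0 i" using hnorm_eq_0[OF dsum_vecs[OF that(1), of i]] by simp
  qed
  have dsum_diff: "a - b \<in> vecs ?D" if "a \<in> vecs ?D" "b \<in> vecs ?D" for a b
    using complex_vector.subspace_diff[OF sub that] .
  fix u :: "nat \<Rightarrow> nat \<Rightarrow> 'v"
  assume u: "\<And>n. u n \<in> vecs ?D"
    and Cauchy: "\<And>e. e > 0 \<Longrightarrow> \<exists>N. \<forall>m\<ge>N. \<forall>n\<ge>N. hnorm ?D (u m - u n) < e"
  have "\<exists>l\<in>vecs K. (\<lambda>n. hnorm K (u n i - l)) \<longlonglongrightarrow> 0" for i
  proof (rule complete)
    show "u n i \<in> vecs K" for n by (rule dsum_vecs[OF u])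
    fix e :: real assume "e > 0"
    then obtain N where N: "\<forall>m\<ge>N. \<forall>n\<ge>N. hnorm ?D (u m - u n) < e" using Cauchy by blast
    have "hnorm K (u m i - u n i) \<le> hnorm ?D (u m - u n)" for m n
      using dsum_hnorm_coord_le[OF dsum_diff[OF u[of m] u[of n]], of i] by simp
    then show "\<exists>N. \<forall>m\<ge>N. \<forall>n\<ge>N. hnorm K (u m i - u n i) < e" using N by (meson le_less_trans)
  qed
  then obtain l where l: "\<And>i. l i \<in> vecs K" and lim: "\<And>i. (\<lambda>n. hnorm K (u n i - l i)) \<longlonglongrightarrow> 0"
    by metis
  \<comment> \<open>Letting \<open>m\<close> tend to infinity in the partial sums of \<open>u n - u m\<close> bounds those of \<open>u n - l\<close>.\<close>
  have partial: "(\<Sum>i<M. (hnorm K (u n i - l i))\<^sup>2) \<le> e\<^sup>2"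
    if N: "\<forall>m\<ge>N. \<forall>n\<ge>N. hnorm ?D (u m - u n) < e" and n: "n \<ge> N" for M n N e
  proof (rule LIMSEQ_le_const2)
    show "(\<lambda>m. \<Sum>i<M. (hnorm K (u n i - u m i))\<^sup>2) \<longlonglongrightarrow> (\<Sum>i<M. (hnorm K (u n i - l i))\<^sup>2)"
      by (intro tendsto_sum tendsto_power tendsto_hnorm_diff lim l dsum_vecs[OF u])
    have "(\<Sum>i<M. (hnorm K (u n i - u m i))\<^sup>2) \<le> e\<^sup>2" if "m \<ge> N" for m
    proof -
      have "(\<Sum>i<M. (hnorm K (u n i - u m i))\<^sup>2) \<le> (hnorm ?D (u n - u m))\<^sup>2"
        using dsum_partial_le[OF dsum_diff[OF u[of n] u[of m]]] by simp
      also have "\<dots> \<le> e\<^sup>2"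
        using N n that dsum_hnorm_nonneg[OF dsum_diff[OF u[of n] u[of m]]] by (intro power_mono) (auto intro: less_imp_le)
      finally show ?thesis .
    qed
    then show "\<exists>N. \<forall>m\<ge>N. (\<Sum>i<M. (hnorm K (u n i - u m i))\<^sup>2) \<le> e\<^sup>2" by blast
  qed
  have off: "l i = 0" if "\<not> enat i < s" for i
  proof -
    have "(\<lambda>n. hnorm K (l i)) \<longlonglongrightarrow> 0"
      using lim[of i] l by (simp add: dsum_off[OF u that] hnorm_uminus)
    then show ?thesis using hnorm_eq_0[OF l, of i] by (simp add: LIMSEQ_const_iff)
  qed
  have tail: "u n - l \<in> vecs ?D \<and> hnorm ?D (u n - l) \<le> e"
    if N: "\<forall>m\<ge>N. \<forall>n\<ge>N. hnorm ?D (u m - u n) < e" and n: "n \<ge> N" and e: "e > 0" for n N e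
  proof -
    have s: "summable (\<lambda>i. (hnorm K (u n i - l i))\<^sup>2)"
      by (rule summableI_nonneg_bounded[where x = "e\<^sup>2"]) (use partial[OF N n] in auto)
    then have mem: "u n - l \<in> vecs ?D"
      using dsum_vecs[OF u] l off by (simp add: dsum_mem dsum_off[OF u])
    have "(hnorm ?D (u n - l))\<^sup>2 \<le> e\<^sup>2"
      unfolding dsum_hnorm_power2[OF mem] using suminf_le_const[OF s] partial[OF N n] by simp
    then have "hnorm ?D (u n - l) \<le> e" by (rule power2_le_imp_le) (use e in simp)
    then show ?thesis using mem by blast
  qed
  show "\<exists>l\<in>vecs ?D. (\<lambda>n. hnorm ?D (u n - l)) \<longlonglongrightarrow> 0"
  proof
    obtain N where N: "\<forall>m\<ge>N. \<forall>n\<ge>N. hnorm ?D (u m - u n) < 1" using Cauchy[of 1] by auto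
    have "u N - (u N - l) \<in> vecs ?D" by (rule dsum_diff[OF u]) (use tail[OF N, of N] in simp)
    then show lD: "l \<in> vecs ?D" by simp
    show "(\<lambda>n. hnorm ?D (u n - l)) \<longlonglongrightarrow> 0"
    proof (rule LIMSEQ_I)
      fix r :: real assume r: "r > 0"
      then obtain N where N: "\<forall>m\<ge>N. \<forall>n\<ge>N. hnorm ?D (u m - u n) < r / 2"
        using Cauchy[of "r/2"] by auto
      have "norm (hnorm ?D (u n - l) - 0) < r" if "n \<ge> N" for n
        using tail[OF N that] r dsum_hnorm_nonneg[of "u n - l" s] by auto
      then show "\<exists>N. \<forall>n\<ge>N. norm (hnorm ?D (u n - l) - 0) < r" by blast
    qed
  qed
qed

lemma fin_dsum_mem:
  "x \<in> vecs (direct_sum K (enat r)) \<longleftrightarrow> (\<forall>i. x i \<in> vecs K) \<and> (\<forall>i\<ge>r. x i = 0)"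
proof -
  have "summable (\<lambda>i. (hnorm K (x i))\<^sup>2)" if "\<forall>i\<ge>r. x i = 0"
    using that by (intro summable_finite[of "{..<r}"]) auto
  then show ?thesis by (auto simp: dsum_mem not_less)
qed

lemma fin_dsum_inner:
  assumes "x \<in> vecs (direct_sum K (enat r))" "y \<in> vecs (direct_sum K (enat r))"
  shows "hinner (direct_sum K (enat r)) x y = (\<Sum>i<r. hinner K (x i) (y i))"
  unfolding dsum_inner[OF assms] using assms by (intro suminf_finite) (auto simp: fin_dsum_mem)

lemma fin_dsum_hnorm_power2:
  assumes "x \<in> vecs (direct_sum K (enat r))"
  shows "(hnorm (direct_sum K (enat r)) x)\<^sup>2 = (\<Sum>i<r. (hnorm K (x i))\<^sup>2)"
  unfolding dsum_hnorm_power2[OF assms] using assms by (intro suminf_finite) (auto simp: fin_dsum_mem)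

lemma at_slot_mem: "enat i < s \<Longrightarrow> v \<in> vecs K \<Longrightarrow> at_slot i v \<in> vecs (direct_sum K s)"
  unfolding dsum_mem
  by (auto simp: at_slot_def intro!: summable_finite[of "{i}"] split: if_splits)

lemma inner_at_slot:
  assumes "enat i < s" "v \<in> vecs K" "y \<in> vecs (direct_sum K s)"
  shows "hinner (direct_sum K s) (at_slot i v) y = hinner K v (y i)"
proof -
  have "(\<Sum>j. hinner K (at_slot i v j) (y j)) = (\<Sum>j\<in>{i}. hinner K (at_slot i v j) (y j))"
    using assms by (intro suminf_finite) (auto simp: at_slot_def)
  then show ?thesis using assms by (simp add: dsum_inner at_slot_mem) (simp add: at_slot_def)
qed

lemma hnorm_at_slot:
  assumes "enat i < s" "v \<in> vecs K"
  shows "hnorm (direct_sum K s) (at_slot i v) = hnorm K v"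
  using inner_at_slot[OF assms at_slot_mem[OF assms]] by (simp add: hnorm_def at_slot_def)

lemma ampl_apply:
  "x \<in> vecs (direct_sum K s) \<Longrightarrow> T 0 = 0 \<Longrightarrow> ampl K s T x = (\<lambda>i. T (x i))"
  by (auto simp: ampl_def dsum_off fun_eq_iff)

lemma dsum_dominated:
  assumes x: "x \<in> vecs (direct_sum K s)" and y: "\<And>i. y i \<in> vecs K" "\<And>i. \<not> enat i < s \<Longrightarrow> y i = 0"
    and le: "\<And>i. hnorm K (y i) \<le> C * hnorm K (x i)" and C: "C \<ge> 0"
  shows "y \<in> vecs (direct_sum K s)" "hnorm (direct_sum K s) y \<le> C * hnorm (direct_sum K s) x"
proof -
  have le2: "(hnorm K (y i))\<^sup>2 \<le> C\<^sup>2 * (hnorm K (x i))\<^sup>2" for i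
    unfolding power_mult_distrib[symmetric] using y le by (intro power_mono) auto
  have s: "summable (\<lambda>i. C\<^sup>2 * (hnorm K (x i))\<^sup>2)" using dsum_summable[OF x] by (rule summable_mult)
  have s2: "summable (\<lambda>i. (hnorm K (y i))\<^sup>2)"
    by (rule summable_comparison_test[OF _ s]) (use le2 in auto)
  then show mem: "y \<in> vecs (direct_sum K s)" using y by (simp add: dsum_mem)
  have "(\<Sum>i. (hnorm K (y i))\<^sup>2) \<le> (\<Sum>i. C\<^sup>2 * (hnorm K (x i))\<^sup>2)" by (rule suminf_le[OF le2 s2 s])
  also have "\<dots> = C\<^sup>2 * (\<Sum>i. (hnorm K (x i))\<^sup>2)" by (rule suminf_mult[OF dsum_summable[OF x]])
  finally have "(hnorm (direct_sum K s) y)\<^sup>2 \<le> (C * hnorm (direct_sum K s) x)\<^sup>2"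
    by (simp add: dsum_hnorm_power2[OF mem] dsum_hnorm_power2[OF x] power_mult_distrib)
  then show "hnorm (direct_sum K s) y \<le> C * hnorm (direct_sum K s) x"
    by (rule power2_le_imp_le) (use C dsum_hnorm_nonneg[OF x] in simp)
qed

lemma ampl_mem:
  assumes T: "T \<in> bounded_ops K" and x: "x \<in> vecs (direct_sum K s)"
  shows "(\<lambda>i. T (x i)) \<in> vecs (direct_sum K s)"
proof -
  obtain C where C: "C \<ge> 0" "\<forall>x\<in>vecs K. hnorm K (T x) \<le> C * hnorm K x" using op_bound[OF T] by blast
  show ?thesis
    by (rule dsum_dominated(1)[OF x, of _ C]) (use C x T in \<open>auto simp: dsum_off\<close>)
qed

lemma ampl_bounded_op:
  assumes T: "T \<in> bounded_ops K" shows "ampl K s T \<in> bounded_ops (direct_sum K s)"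
proof -
  obtain C where C: "C \<ge> 0" "\<forall>x\<in>vecs K. hnorm K (T x) \<le> C * hnorm K x" using op_bound[OF T] by blast
  interpret D: hilbert_space "direct_sum K s" by (rule hilbert_space_direct_sum)
  have A: "ampl K s T x = (\<lambda>i. T (x i))" if "x \<in> vecs (direct_sum K s)" for x
    using ampl_apply[OF that] T by simp
  show ?thesis
  proof (rule D.bounded_opsI)
    fix x assume x: "x \<in> vecs (direct_sum K s)"
    show "hnorm (direct_sum K s) (ampl K s T x) \<le> C * hnorm (direct_sum K s) x"
      unfolding A[OF x] by (rule dsum_dominated(2)[OF x]) (use C x T in \<open>auto simp: dsum_off\<close>)
  next
    show "ampl K s T x \<in> vecs (direct_sum K s)" if "x \<in> vecs (direct_sum K s)" for x
      unfolding A[OF that] by (rule ampl_mem[OF T that])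
    show "ampl K s T (c *\<^sub>C x) = c *\<^sub>C ampl K s T x" if "x \<in> vecs (direct_sum K s)" for c x
      unfolding A[OF that] A[OF D.scaleC_vecs[OF that]]
      using T that by (simp add: scaleC_fun_def op_scaleC)
  qed (use T in \<open>auto simp: A op_add ampl_def[of K s T]\<close>)
qed

lemma mat_op_apply:
  "x \<in> vecs (direct_sum K (enat r)) \<Longrightarrow>
    mat_op K r T x = (\<lambda>i. if i < r then \<Sum>j<r. T i j (x j) else 0)"
  by (simp add: mat_op_def)

lemma mat_op_mem:
  assumes "\<And>i j. i < r \<Longrightarrow> j < r \<Longrightarrow> T i j \<in> bounded_ops K" "x \<in> vecs (direct_sum K (enat r))"
  shows "mat_op K r T x \<in> vecs (direct_sum K (enat r))"
proof -
  have "(\<Sum>j<r. T i j (x j)) \<in> vecs K" if "i < r" for i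
    by (rule sum_vecs, rule op_vecs) (use assms dsum_vecs[OF assms(2)] that in auto)
  then show ?thesis by (simp add: mat_op_apply[OF assms(2)] fin_dsum_mem)
qed

lemma mat_op_bounded_op:
  assumes T: "\<And>i j. i < r \<Longrightarrow> j < r \<Longrightarrow> T i j \<in> bounded_ops K"
  shows "mat_op K r T \<in> bounded_ops (direct_sum K (enat r))"
proof -
  let ?D = "direct_sum K (enat r)"
  interpret D: hilbert_space ?D by (rule hilbert_space_direct_sum)
  have "\<exists>C. \<forall>i<r. \<forall>j<r. C i j \<ge> 0 \<and> (\<forall>x\<in>vecs K. hnorm K (T i j x) \<le> C i j * hnorm K x)"
    using op_bound[OF T] by metis
  then obtain C where C: "\<And>i j. i < r \<Longrightarrow> j < r \<Longrightarrow> C i j \<ge> (0::real)"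
    "\<And>i j x. i < r \<Longrightarrow> j < r \<Longrightarrow> x \<in> vecs K \<Longrightarrow> hnorm K (T i j x) \<le> C i j * hnorm K x" by metis
  define c where "c i = (\<Sum>j<r. C i j)" for i
  show ?thesis
  proof (rule D.bounded_opsI)
    fix x assume x: "x \<in> vecs ?D"
    have c: "hnorm K (mat_op K r T x i) \<le> c i * hnorm ?D x" if i: "i < r" for i
    proof -
      have "hnorm K (mat_op K r T x i) = hnorm K (\<Sum>j<r. T i j (x j))" using x i by (simp add: mat_op_apply)
      also have "\<dots> \<le> (\<Sum>j<r. hnorm K (T i j (x j)))" using x i T by (intro hnorm_sum) auto
      also have "\<dots> \<le> (\<Sum>j<r. C i j * hnorm ?D x)"
      proof (rule sum_mono)
        fix j assume "j \<in> {..<r}"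
        then have j: "j < r" by simp
        have "hnorm K (T i j (x j)) \<le> C i j * hnorm K (x j)" using C(2)[OF i j] x by simp
        also have "\<dots> \<le> C i j * hnorm ?D x" using C(1)[OF i j] dsum_hnorm_coord_le[OF x] by (intro mult_left_mono)
        finally show "hnorm K (T i j (x j)) \<le> C i j * hnorm ?D x" .
      qed
      finally show ?thesis by (simp add: c_def sum_distrib_right)
    qed
    have mem: "mat_op K r T x \<in> vecs ?D" using mat_op_mem T x by blast
    have "(hnorm ?D (mat_op K r T x))\<^sup>2 \<le> (\<Sum>i<r. (c i * hnorm ?D x)\<^sup>2)"
      unfolding fin_dsum_hnorm_power2[OF mem]
    proof (rule sum_mono)
      fix i assume "i \<in> {..<r}"
      then show "(hnorm K (mat_op K r T x i))\<^sup>2 \<le> (c i * hnorm ?D x)\<^sup>2"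
        using c[of i] mem by (intro power_mono) auto
    qed
    also have "\<dots> = (sqrt (\<Sum>i<r. (c i)\<^sup>2) * hnorm ?D x)\<^sup>2"
      by (simp add: power_mult_distrib sum_distrib_right sum_nonneg)
    finally show "hnorm ?D (mat_op K r T x) \<le> sqrt (\<Sum>i<r. (c i)\<^sup>2) * hnorm ?D x"
      by (rule power2_le_imp_le) (use x in \<open>simp add: sum_nonneg\<close>)
  next
    fix x y assume xy: "x \<in> vecs ?D" "y \<in> vecs ?D"
    show "mat_op K r T (x + y) = mat_op K r T x + mat_op K r T y"
      using xy T by (auto simp: mat_op_apply fun_eq_iff op_add sum.distrib)
  next
    fix c x assume x: "x \<in> vecs ?D"
    have "mat_op K r T (c *\<^sub>C x) i = (c *\<^sub>C mat_op K r T x) i" for i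
      unfolding mat_op_apply[OF D.scaleC_vecs[OF x]] scaleC_apply mat_op_apply[OF x]
      using x T by (auto simp: op_scaleC complex_vector.scale_sum_right)
    then show "mat_op K r T (c *\<^sub>C x) = c *\<^sub>C mat_op K r T x" by blast
  next
    show "mat_op K r T x \<in> vecs ?D" if "x \<in> vecs ?D" for x by (rule mat_op_mem[OF T that])
    show "mat_op K r T x = 0" if "x \<notin> vecs ?D" for x using that by (simp add: mat_op_def)
  qed
qed

lemma transpose_mem:
  "x \<in> vecs (direct_sum (direct_sum K (enat r)) s) \<longleftrightarrow>
    transpose_seq x \<in> vecs (direct_sum (direct_sum K s) (enat r))" (is "?L \<longleftrightarrow> ?R")
proof -
  interpret S: hilbert_space "direct_sum K s" by (rule hilbert_space_direct_sum)
  interpret R: hilbert_space "direct_sum K (enat r)" by (rule hilbert_space_direct_sum)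
  show ?thesis
  proof
    assume x: ?L
    note xn = R.dsum_vecs[OF x]
    have "summable (\<lambda>n. (hnorm K (x n i))\<^sup>2)" for i
    proof (rule summable_comparison_test[OF _ R.dsum_summable[OF x]])
      have "(hnorm K (x n i))\<^sup>2 \<le> (hnorm (direct_sum K (enat r)) (x n))\<^sup>2" for n
        using dsum_hnorm_coord_le[OF xn] dsum_vecs[OF xn] by (intro power_mono) auto
      then show "\<exists>N. \<forall>n\<ge>N. norm ((hnorm K (x n i))\<^sup>2) \<le> (hnorm (direct_sum K (enat r)) (x n))\<^sup>2"
        by simp
    qed
    moreover have "x n i = 0" if "\<not> enat n < s" for n i using R.dsum_off[OF x that] by simp
    ultimately show ?R using xn
      by (auto simp: S.fin_dsum_mem dsum_mem[of _ s] transpose_seq_def fin_dsum_mem fun_eq_iff)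
  next
    assume x: ?R
    have xi: "(\<lambda>n. x n i) \<in> vecs (direct_sum K s)" for i
      using S.dsum_vecs[OF x, of i] by (simp add: transpose_seq_def)
    have z: "x n i = 0" if "i \<ge> r" for n i
      using x that by (auto simp: S.fin_dsum_mem transpose_seq_def fun_eq_iff)
    have xn: "x n \<in> vecs (direct_sum K (enat r))" for n
      using dsum_vecs[OF xi] z by (simp add: fin_dsum_mem)
    have "x n = 0" if "\<not> enat n < s" for n using dsum_off[OF xi that] by (auto simp: fun_eq_iff)
    moreover have "summable (\<lambda>n. (hnorm (direct_sum K (enat r)) (x n))\<^sup>2)"
      unfolding fin_dsum_hnorm_power2[OF xn] using dsum_summable[OF xi] by (intro summable_sum)
    ultimately show ?L using xn by (simp add: R.dsum_mem)
  qed
qed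

lemma transpose_inner:
  assumes x: "x \<in> vecs (direct_sum (direct_sum K (enat r)) s)"
    and y: "y \<in> vecs (direct_sum (direct_sum K (enat r)) s)"
  shows "hinner (direct_sum (direct_sum K s) (enat r)) (transpose_seq x) (transpose_seq y) =
    hinner (direct_sum (direct_sum K (enat r)) s) x y"
proof -
  interpret S: hilbert_space "direct_sum K s" by (rule hilbert_space_direct_sum)
  interpret R: hilbert_space "direct_sum K (enat r)" by (rule hilbert_space_direct_sum)
  note tx = x[unfolded transpose_mem] and ty = y[unfolded transpose_mem]
  have "hinner (direct_sum (direct_sum K s) (enat r)) (transpose_seq x) (transpose_seq y) =
      (\<Sum>i<r. \<Sum>n. hinner K (x n i) (y n i))"
    unfolding S.fin_dsum_inner[OF tx ty] using dsum_inner[OF S.dsum_vecs[OF tx] S.dsum_vecs[OF ty]]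
    by (simp add: transpose_seq_def)
  also have "\<dots> = (\<Sum>n. \<Sum>i<r. hinner K (x n i) (y n i))"
    using dsum_summable_inner[OF S.dsum_vecs[OF tx] S.dsum_vecs[OF ty]]
    by (intro suminf_sum[symmetric]) (simp add: transpose_seq_def)
  also have "\<dots> = hinner (direct_sum (direct_sum K (enat r)) s) x y"
    unfolding R.dsum_inner[OF x y] using fin_dsum_inner[OF R.dsum_vecs[OF x] R.dsum_vecs[OF y]] by simp
  finally show ?thesis .
qed

lemma transpose_hnorm:
  assumes x: "x \<in> vecs (direct_sum (direct_sum K (enat r)) s)"
  shows "hnorm (direct_sum (direct_sum K s) (enat r)) (transpose_seq x) =
    hnorm (direct_sum (direct_sum K (enat r)) s) x"
  unfolding hnorm_def[of "direct_sum _ _"] transpose_inner[OF x x] ..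

end

section \<open>The Hahn-Banach theorem for sublinear functionals\<close>

text \<open>
  One inequality suffices for positive homogeneity, since the other follows by using it for the
  inverse scalar. The form chosen passes to infima of families without further argument.
\<close>

definition sublinear_on :: "'a::complex_vector set \<Rightarrow> ('a \<Rightarrow> real) \<Rightarrow> bool" where
  "sublinear_on V p \<longleftrightarrow> (\<forall>x\<in>V. \<forall>y\<in>V. p (x + y) \<le> p x + p y) \<and>
    (\<forall>x\<in>V. \<forall>t>0. t * p x \<le> p (of_real t *\<^sub>C x))"

lemma sublinear_onD:
  assumes "sublinear_on V p" "x \<in> V"
  shows "y \<in> V \<Longrightarrow> p (x + y) \<le> p x + p y" and "t > 0 \<Longrightarrow> t * p x \<le> p (of_real t *\<^sub>C x)"
  using assms by (auto simp: sublinear_on_def)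

lemma sublinear_on_scale:
  assumes V: "complex_vector.subspace V" and p: "sublinear_on V p" and x: "x \<in> V" and t: "t > 0"
  shows "p (of_real t *\<^sub>C x) = t * p x"
proof -
  have "inverse t * p (of_real t *\<^sub>C x) \<le> p (of_real (inverse t) *\<^sub>C of_real t *\<^sub>C x)"
    using sublinear_onD(2)[OF p complex_vector.subspace_scale[OF V x, of "of_real t"], of "inverse t"] t
    by simp
  also have "\<dots> = p x" using t by (simp add: scaleC_scaleC scaleC_one flip: of_real_mult)
  finally have "p (of_real t *\<^sub>C x) \<le> t * p x" using t by (simp add: field_simps)
  then show ?thesis using sublinear_onD(2)[OF p x t] by simp
qed

lemma sublinear_on_zero:
  assumes "complex_vector.subspace V" "sublinear_on V p" shows "p 0 = 0"
  using sublinear_on_scale[OF assms complex_vector.subspace_0[OF assms(1)], of 2] by simp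

lemma sublinear_on_lower:
  assumes V: "complex_vector.subspace V" and p: "sublinear_on V p" and x: "x \<in> V"
  shows "- p (- x) \<le> p x"
  using sublinear_onD(1)[OF p x complex_vector.subspace_neg[OF V x]] sublinear_on_zero[OF V p] by simp

text \<open>
  Subadditivity survives the infimum because any two members of a chain are dominated from below by
  one of them. The infimum is finite since \<open>q\<close> is bounded below by \<open>- p (- x)\<close>.
\<close>

lemma sublinear_on_INF_chain:
  assumes V: "complex_vector.subspace V" and C: "C \<noteq> {}"
    and sub: "\<And>q. q \<in> C \<Longrightarrow> sublinear_on V q"
    and le: "\<And>q x. q \<in> C \<Longrightarrow> x \<in> V \<Longrightarrow> q x \<le> p x"
    and chain: "\<And>q q'. q \<in> C \<Longrightarrow> q' \<in> C \<Longrightarrow> (\<forall>x\<in>V. q x \<le> q' x) \<or> (\<forall>x\<in>V. q' x \<le> q x)"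
  shows "sublinear_on V (\<lambda>x. INF q\<in>C. q x)"
    and "\<And>q x. q \<in> C \<Longrightarrow> x \<in> V \<Longrightarrow> (INF q\<in>C. q x) \<le> q x"
proof -
  have bdd: "bdd_below ((\<lambda>q. q x) ` C)" if "x \<in> V" for x
  proof (rule bdd_belowI2)
    fix q assume q: "q \<in> C"
    show "- p (- x) \<le> q x"
      using sublinear_on_lower[OF V sub[OF q] that] le[OF q complex_vector.subspace_neg[OF V that]] by simp
  qed
  show lower: "(INF q\<in>C. q x) \<le> q x" if "q \<in> C" "x \<in> V" for q x
    using bdd that by (intro cINF_lower) auto
  show "sublinear_on V (\<lambda>x. INF q\<in>C. q x)"
    unfolding sublinear_on_def
  proof (intro conjI ballI allI impI)
    fix x y assume xy: "x \<in> V" "y \<in> V"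
    have "(INF q\<in>C. q (x + y)) \<le> q x + q' y" if q: "q \<in> C" "q' \<in> C" for q q'
    proof -
      obtain m where m: "m \<in> C" "m x \<le> q x" "m y \<le> q' y" using chain[OF q] q xy by blast
      have "(INF q\<in>C. q (x + y)) \<le> m (x + y)"
        using lower[OF m(1)] xy complex_vector.subspace_add[OF V] by blast
      also have "\<dots> \<le> m x + m y" using sublinear_onD(1)[OF sub[OF m(1)]] xy by blast
      finally show ?thesis using m by linarith
    qed
    then have "(INF q\<in>C. q (x + y)) - q' y \<le> (INF q\<in>C. q x)" if "q' \<in> C" for q'
      using that C by (intro cINF_greatest) (auto simp: algebra_simps)
    then have "(INF q\<in>C. q (x + y)) - (INF q\<in>C. q x) \<le> (INF q\<in>C. q y)"
      using C by (intro cINF_greatest) (auto simp: algebra_simps)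
    then show "(INF q\<in>C. q (x + y)) \<le> (INF q\<in>C. q x) + (INF q\<in>C. q y)" by simp
  next
    fix x and t :: real assume x: "x \<in> V" and t: "t > 0"
    show "t * (INF q\<in>C. q x) \<le> (INF q\<in>C. q (of_real t *\<^sub>C x))"
    proof (rule cINF_greatest[OF C])
      fix q assume q: "q \<in> C"
      have "t * (INF q\<in>C. q x) \<le> t * q x" using lower[OF q x] t by simp
      also have "\<dots> \<le> q (of_real t *\<^sub>C x)" using sublinear_onD(2)[OF sub[OF q] x t] .
      finally show "t * (INF q\<in>C. q x) \<le> q (of_real t *\<^sub>C x)" .
    qed
  qed
qed

text \<open>
  The function \<open>q x = inf {m (x + t y) - t m y | t \<ge> 0}\<close> is again sublinear and lies below \<open>m\<close>.
  By minimality it equals \<open>m\<close>, and \<open>t = 1\<close> gives \<open>m x + m y \<le> m (x + y)\<close>.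
\<close>

lemma minimal_sublinear_additive:
  assumes V: "complex_vector.subspace V" and m: "sublinear_on V m"
    and min: "\<And>q x. sublinear_on V q \<Longrightarrow> (\<And>x. x \<in> V \<Longrightarrow> q x \<le> m x) \<Longrightarrow> x \<in> V \<Longrightarrow> q x = m x"
    and x: "x \<in> V" and y: "y \<in> V"
  shows "m (x + y) = m x + m y"
proof -
  note add = complex_vector.subspace_add[OF V] and scale = complex_vector.subspace_scale[OF V]
  define f where "f x t = m (x + of_real t *\<^sub>C y) - t * m y" for x t
  define q where "q x = (INF t\<in>{0..}. f x t)" for x
  have ty: "m (of_real t *\<^sub>C y) = t * m y" if "t \<ge> 0" for t
    using that sublinear_on_scale[OF V m y, of t] sublinear_on_zero[OF V m]
    by (cases "t = 0") auto
  have lower: "q z \<le> f z t" if z: "z \<in> V" and "t \<ge> 0" for z t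
    unfolding q_def
  proof (rule cINF_lower)
    show "bdd_below (f z ` {0..})"
    proof (rule bdd_belowI2)
      fix t :: real assume t: "t \<in> {0..}"
      have "m (- z + (z + of_real t *\<^sub>C y)) \<le> m (- z) + m (z + of_real t *\<^sub>C y)"
        by (intro sublinear_onD(1)[OF m] complex_vector.subspace_neg[OF V] add scale z y)
      then show "- m (- z) \<le> f z t" using t ty[of t] by (simp add: f_def)
    qed
  qed (use that in simp)
  have "sublinear_on V q"
    unfolding sublinear_on_def
  proof (intro conjI ballI allI impI)
    fix a b assume ab: "a \<in> V" "b \<in> V"
    have *: "q (a + b) \<le> f a s + f b t" if st: "s \<ge> 0" "t \<ge> 0" for s t
    proof -
      have "q (a + b) \<le> f (a + b) (s + t)" using lower add ab st by simp
      also have "\<dots> = m ((a + of_real s *\<^sub>C y) + (b + of_real t *\<^sub>C y)) - (s + t) * m y"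
        by (simp add: f_def scaleC_add_left algebra_simps)
      also have "\<dots> \<le> f a s + f b t"
        using sublinear_onD(1)[OF m add[OF ab(1) scale[OF y, of "of_real s"]] add[OF ab(2) scale[OF y, of "of_real t"]]]
        by (simp add: f_def algebra_simps)
      finally show ?thesis .
    qed
    have "q (a + b) - f b t \<le> q a" if "t \<ge> 0" for t
      unfolding q_def[of a] using *[OF _ that] by (intro cINF_greatest) (auto simp: algebra_simps)
    then have "q (a + b) - q a \<le> q b"
      unfolding q_def[of b] by (intro cINF_greatest) (auto simp: algebra_simps)
    then show "q (a + b) \<le> q a + q b" by simp
  next
    fix a and t :: real assume a: "a \<in> V" and t: "t > 0"
    show "t * q a \<le> q (of_real t *\<^sub>C a)"
      unfolding q_def[of "of_real t *\<^sub>C a"]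
    proof (rule cINF_greatest)
      fix s :: real assume s: "s \<in> {0..}"
      have "t * q a \<le> t * f a (s / t)" using lower[OF a, of "s / t"] s t by simp
      also have "\<dots> = m (of_real t *\<^sub>C (a + of_real (s / t) *\<^sub>C y)) - s * m y"
        using t by (simp add: f_def sublinear_on_scale[OF V m add[OF a scale[OF y]] t] right_diff_distrib del: of_real_divide)
      also have "\<dots> = f (of_real t *\<^sub>C a) s"
        using t by (simp add: f_def scaleC_add_right scaleC_scaleC)
      finally show "t * q a \<le> f (of_real t *\<^sub>C a) s" .
    qed simp
  qed
  moreover have "q z \<le> m z" if "z \<in> V" for z using lower[OF that, of 0] by (simp add: f_def)
  ultimately have "m x \<le> f x 1" using min[of q x] lower[OF x, of 1] x by simp
  then show ?thesis using sublinear_onD(1)[OF m x y] by (simp add: f_def scaleC_one)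
qed

text \<open>
  By Zorn's lemma there is a minimal sublinear functional below \<open>p\<close>; it is additive, hence linear.
  The usual form, extension from a subspace, is recovered by a choice of \<open>p\<close>. All
  functionals in the argument are set to zero off \<open>V\<close>, which makes the pointwise order antisymmetric.
\<close>

theorem Hahn_Banach_sublinear:
  assumes V: "complex_vector.subspace V" and p: "sublinear_on V p"
  shows "\<exists>q. (\<forall>x\<in>V. q x \<le> p x) \<and> (\<forall>x\<in>V. \<forall>y\<in>V. q (x + y) = q x + q y) \<and>
    (\<forall>x\<in>V. \<forall>t. q (of_real t *\<^sub>C x) = t * q x)"
proof -
  define A where "A = {q. sublinear_on V q \<and> (\<forall>x\<in>V. q x \<le> p x) \<and> (\<forall>x. x \<notin> V \<longrightarrow> q x = 0)}"
  define P where "P q q' \<longleftrightarrow> q' \<le> q" for q q' :: "'a \<Rightarrow> real"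
  have "\<exists>m\<in>A. \<forall>a\<in>A. P m a \<longrightarrow> a = m"
  proof (rule predicate_Zorn)
    show "partial_order_on A (relation_of P A)"
      by (rule partial_order_on_relation_ofI) (auto simp: P_def)
    fix C assume C: "C \<in> Chains (relation_of P A)"
    then have CA: "C \<subseteq> A" and chain: "\<And>q q'. q \<in> C \<Longrightarrow> q' \<in> C \<Longrightarrow> q \<le> q' \<or> q' \<le> q"
      by (auto simp: Chains_def relation_of_def P_def)
    show "\<exists>u\<in>A. \<forall>a\<in>C. P a u"
    proof (cases "C = {}")
      case True
      have "sublinear_on V (\<lambda>x. if x \<in> V then p x else 0)"
        using p complex_vector.subspace_add[OF V] complex_vector.subspace_scale[OF V]
        by (auto simp: sublinear_on_def)
      then have "(\<lambda>x. if x \<in> V then p x else 0) \<in> A" by (simp add: A_def)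
      then show ?thesis using True by blast
    next
      case False
      note inf = sublinear_on_INF_chain[OF V False, of p]
      have sub: "sublinear_on V (\<lambda>x. INF q\<in>C. q x)"
        and lower: "\<And>q x. q \<in> C \<Longrightarrow> x \<in> V \<Longrightarrow> (INF q\<in>C. q x) \<le> q x"
        using inf CA chain unfolding A_def le_fun_def by blast+
      have off: "q x = 0" if "q \<in> C" "x \<notin> V" for q x using CA that by (auto simp: A_def)
      then have off': "(INF q\<in>C. q x) = 0" if "x \<notin> V" for x
        using False that INF_cong[of C C "\<lambda>q. q x" "\<lambda>q. 0"] by simp
      obtain q0 where q0: "q0 \<in> C" using False by blast
      have "(INF q\<in>C. q x) \<le> p x" if "x \<in> V" for x
        using lower[OF q0 that] CA q0 that by (fastforce simp: A_def)
      then have "(\<lambda>x. INF q\<in>C. q x) \<in> A" using sub off' by (simp add: A_def)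
      moreover have "(\<lambda>x. INF q\<in>C. q x) \<le> q" if "q \<in> C" for q
        unfolding le_fun_def using lower[OF that] off[OF that] off' by (metis order_refl)
      ultimately show ?thesis unfolding P_def by blast
    qed
  qed
  then obtain m where mA: "m \<in> A" and min: "\<And>a. a \<in> A \<Longrightarrow> a \<le> m \<Longrightarrow> a = m"
    by (auto simp: P_def)
  have m: "sublinear_on V m" and mp: "\<And>x. x \<in> V \<Longrightarrow> m x \<le> p x" using mA by (auto simp: A_def)
  have additive: "m (x + y) = m x + m y" if "x \<in> V" "y \<in> V" for x y
  proof (rule minimal_sublinear_additive[OF V m _ that])
    fix q x assume q: "sublinear_on V q" and qm: "\<And>x. x \<in> V \<Longrightarrow> q x \<le> m x" and x: "x \<in> V"
    define q' where "q' x = (if x \<in> V then q x else 0)" for x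
    have "sublinear_on V q'"
      using q complex_vector.subspace_add[OF V] complex_vector.subspace_scale[OF V]
      by (auto simp: sublinear_on_def q'_def)
    moreover have "q x \<le> p x" if "x \<in> V" for x using qm[OF that] mp[OF that] by linarith
    ultimately have "q' \<in> A" by (simp add: A_def q'_def)
    moreover have "q' \<le> m" using qm mA by (auto simp: le_fun_def q'_def A_def)
    ultimately have "q' = m" by (rule min)
    then show "q x = m x" using x q'_def[of x] by simp
  qed
  have "m (of_real t *\<^sub>C x) = t * m x" if x: "x \<in> V" for x t
  proof (cases t "0::real" rule: linorder_cases)
    case less
    have "m (of_real t *\<^sub>C x + of_real (- t) *\<^sub>C x) = m (of_real t *\<^sub>C x) + m (of_real (- t) *\<^sub>C x)"
      by (intro additive complex_vector.subspace_scale[OF V] x)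
    moreover have "m (of_real (- t) *\<^sub>C x) = - t * m x"
      using sublinear_on_scale[OF V m x, of "- t"] less by simp
    ultimately show ?thesis
      using sublinear_on_zero[OF V m] by (simp add: complex_vector.scale_minus_left)
  qed (use sublinear_on_scale[OF V m x] sublinear_on_zero[OF V m] in auto)
  then show ?thesis using mp additive by blast
qed

text \<open>
  A complex linear functional is determined by its real part \<open>q\<close>, as \<open>q x - \<i> q (\<i> x)\<close>.
\<close>

theorem Hahn_Banach_sublinear_complex:
  assumes V: "complex_vector.subspace V" and p: "sublinear_on V p"
  shows "\<exists>g. (\<forall>x\<in>V. Re (g x) \<le> p x) \<and> (\<forall>x\<in>V. \<forall>y\<in>V. g (x + y) = g x + g y) \<and>
    (\<forall>x\<in>V. \<forall>c. g (c *\<^sub>C x) = c * g x)"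
proof -
  note add = complex_vector.subspace_add[OF V] and scale = complex_vector.subspace_scale[OF V]
  obtain q where le: "\<forall>x\<in>V. q x \<le> p x" and q_add: "\<forall>x\<in>V. \<forall>y\<in>V. q (x + y) = q x + q y"
    and q_scale: "\<forall>x\<in>V. \<forall>t. q (of_real t *\<^sub>C x) = t * q x"
    using Hahn_Banach_sublinear[OF assms] by blast
  define g where "g x = Complex (q x) (- q (\<i> *\<^sub>C x))" for x
  have "g (c *\<^sub>C x) = c * g x" if x: "x \<in> V" for c x
  proof -
    have 1: "q (c *\<^sub>C x) = Re c * q x + Im c * q (\<i> *\<^sub>C x)"
    proof -
      have "c *\<^sub>C x = of_real (Re c) *\<^sub>C x + of_real (Im c) *\<^sub>C \<i> *\<^sub>C x"
        by (simp add: scaleC_scaleC flip: scaleC_add_left) (simp add: complex_eq_iff)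
      then show ?thesis using x q_add q_scale scale by metis
    qed
    have 2: "q (\<i> *\<^sub>C c *\<^sub>C x) = - Im c * q x + Re c * q (\<i> *\<^sub>C x)"
    proof -
      have "\<i> * c = of_real (- Im c) + of_real (Re c) * \<i>" by (simp add: complex_eq_iff)
      then have "\<i> *\<^sub>C c *\<^sub>C x = of_real (- Im c) *\<^sub>C x + of_real (Re c) *\<^sub>C \<i> *\<^sub>C x"
        by (simp only: scaleC_scaleC flip: scaleC_add_left)
      then show ?thesis using x q_add q_scale scale by metis
    qed
    show ?thesis unfolding g_def 1 2 by (simp add: complex_eq_iff algebra_simps)
  qed
  moreover have "g (x + y) = g x + g y" if "x \<in> V" "y \<in> V" for x y
    using that q_add scale by (simp add: g_def scaleC_add_right complex_eq_iff)
  moreover have "Re (g x) \<le> p x" if "x \<in> V" for x using le that by (simp add: g_def)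
  ultimately show ?thesis by blast
qed

section \<open>Weak-* continuous functionals given by sequences\<close>

text \<open>
  This is the trace pairing of \<open>T\<close> with the trace class operator given by \<open>x\<close> and \<open>y\<close>. It is zero at
  functions that are not bounded operators, so that two functionals which agree on the bounded
  operators are equal.
\<close>

definition pairing :: "'v::complex_vector hspace \<Rightarrow> (nat \<Rightarrow> 'v) \<Rightarrow> (nat \<Rightarrow> 'v) \<Rightarrow> ('v \<Rightarrow> 'v) \<Rightarrow> complex" where
  "pairing K x y T = (if T \<in> bounded_ops K then hinner (direct_sum K \<infinity>) (\<lambda>n. T (x n)) y else 0)"

definition normal_functionals :: "'v::complex_vector hspace \<Rightarrow> (('v \<Rightarrow> 'v) \<Rightarrow> complex) set" where
  "normal_functionals K =
    {pairing K x y | x y. x \<in> vecs (direct_sum K \<infinity>) \<and> y \<in> vecs (direct_sum K \<infinity>)}"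

text \<open>
  Placing two sequences at the even and odd positions adds the functionals they represent as well as
  their squared norms. This is why the functionals form a vector space.
\<close>

definition interleave :: "(nat \<Rightarrow> 'a) \<Rightarrow> (nat \<Rightarrow> 'a) \<Rightarrow> nat \<Rightarrow> 'a" where
  "interleave x y = (\<lambda>n. if even n then x (n div 2) else y ((n - 1) div 2))"

definition drop_seq :: "nat \<Rightarrow> (nat \<Rightarrow> 'a::zero) \<Rightarrow> nat \<Rightarrow> 'a" where
  "drop_seq m x = (\<lambda>n. if n < m then 0 else x n)"

lemma sum_fun_apply: "(\<Sum>i\<in>I. f i) x = (\<Sum>i\<in>I. f i x)" for f :: "'i \<Rightarrow> 'a \<Rightarrow> 'b::comm_monoid_add"
  by (induction I rule: infinite_finite_induct) simp_all

lemma sums_if_complex: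
  fixes f g :: "nat \<Rightarrow> complex"
  assumes "g sums x" "f sums y"
  shows "(\<lambda>n. if even n then f (n div 2) else g ((n - 1) div 2)) sums (x + y)"
  using assms sums_if[of "\<lambda>n. Re (g n)" "Re x" "\<lambda>n. Re (f n)" "Re y"]
    sums_if[of "\<lambda>n. Im (g n)" "Im x" "\<lambda>n. Im (f n)" "Im y"]
  by (simp add: sums_complex_iff if_distrib[of Re] if_distrib[of Im])

context hilbert_space
begin

interpretation seq: hilbert_space "direct_sum K \<infinity>"
  by (rule hilbert_space_direct_sum)

abbreviation "seqs \<equiv> vecs (direct_sum K \<infinity>)"
abbreviation "seq_norm \<equiv> hnorm (direct_sum K \<infinity>)"

lemma seqs_eq: "seqs = square_summable K"
  by (auto simp: dsum_mem square_summable_def)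

lemma op_seqs: "T \<in> bounded_ops K \<Longrightarrow> x \<in> seqs \<Longrightarrow> (\<lambda>n. T (x n)) \<in> seqs"
  by (rule ampl_mem)

lemma pairing_sums:
  assumes "T \<in> bounded_ops K" "x \<in> seqs" "y \<in> seqs"
  shows "(\<lambda>n. hinner K (T (x n)) (y n)) sums pairing K x y T"
  using dsum_inner_sums[OF op_seqs[OF assms(1,2)] assms(3)] assms(1) by (simp add: pairing_def)

lemma pairing_off: "T \<notin> bounded_ops K \<Longrightarrow> pairing K x y T = 0"
  by (simp add: pairing_def)

lemma pairing_bound:
  assumes "T \<in> bounded_ops K" "x \<in> seqs" "y \<in> seqs"
    and "\<And>v. v \<in> vecs K \<Longrightarrow> hnorm K (T v) \<le> C * hnorm K v" "C \<ge> 0"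
  shows "cmod (pairing K x y T) \<le> C * seq_norm x * seq_norm y"
proof -
  have "cmod (pairing K x y T) \<le> seq_norm (\<lambda>n. T (x n)) * seq_norm y"
    using seq.Cauchy_Schwarz[OF op_seqs[OF assms(1,2)] assms(3)] assms(1) by (simp add: pairing_def)
  also have "seq_norm (\<lambda>n. T (x n)) \<le> C * seq_norm x"
    by (rule dsum_dominated(2)[OF assms(2)]) (use assms in auto)
  finally show ?thesis using assms(3) by (simp add: mult_right_mono)
qed

lemma pairing_op_add:
  assumes "S \<in> bounded_ops K" "T \<in> bounded_ops K" "x \<in> seqs" "y \<in> seqs"
  shows "pairing K x y (S + T) = pairing K x y S + pairing K x y T"
proof -
  have "(\<lambda>n. hinner K ((S + T) (x n)) (y n)) sums (pairing K x y S + pairing K x y T)"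
    using sums_add[OF pairing_sums[OF assms(1,3,4)] pairing_sums[OF assms(2,3,4)]] assms
    by (simp add: inner_add_left)
  then show ?thesis using pairing_sums[OF op_plus[OF assms(1,2)] assms(3,4)] sums_unique2 by blast
qed

lemma pairing_op_scaleC:
  assumes "T \<in> bounded_ops K" "x \<in> seqs" "y \<in> seqs"
  shows "pairing K x y (c *\<^sub>C T) = c * pairing K x y T"
proof -
  have "(\<lambda>n. hinner K ((c *\<^sub>C T) (x n)) (y n)) sums (c * pairing K x y T)"
    using sums_mult[OF pairing_sums[OF assms], of c] assms by (simp add: scaleC_apply inner_scaleC_left)
  then show ?thesis using pairing_sums[OF op_scale[OF assms(1)] assms(2,3)] sums_unique2 by blast
qed

lemma pairing_op_diff:
  assumes "S \<in> bounded_ops K" "T \<in> bounded_ops K" "x \<in> seqs" "y \<in> seqs"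
  shows "pairing K x y (S - T) = pairing K x y S - pairing K x y T"
proof -
  have "S = (S - T) + T" by simp
  then show ?thesis using pairing_op_add[OF op_minus[OF assms(1,2)] assms(2-4)] by simp
qed

lemma pairing_add_left:
  assumes "x \<in> seqs" "x' \<in> seqs" "y \<in> seqs"
  shows "pairing K (x + x') y = pairing K x y + pairing K x' y"
proof
  fix T show "pairing K (x + x') y T = (pairing K x y + pairing K x' y) T"
  proof (cases "T \<in> bounded_ops K")
    case True
    have "(\<lambda>n. hinner K (T ((x + x') n)) (y n)) sums (pairing K x y T + pairing K x' y T)"
      using sums_add[OF pairing_sums[OF True assms(1,3)] pairing_sums[OF True assms(2,3)]] assms True
      by (simp add: inner_add_left op_add)
    then show ?thesis using pairing_sums[OF True dsum_add[OF assms(1,2)] assms(3)] sums_unique2 by fastforce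
  qed (simp add: pairing_off)
qed

lemma pairing_add_right:
  assumes "x \<in> seqs" "y \<in> seqs" "y' \<in> seqs"
  shows "pairing K x (y + y') = pairing K x y + pairing K x y'"
proof
  fix T show "pairing K x (y + y') T = (pairing K x y + pairing K x y') T"
    using assms op_seqs[of T x] by (cases "T \<in> bounded_ops K") (auto simp: pairing_def seq.inner_add_right)
qed

lemma pairing_scaleC_left:
  assumes "x \<in> seqs" "y \<in> seqs" shows "pairing K (c *\<^sub>C x) y = c *\<^sub>C pairing K x y"
proof
  fix T show "pairing K (c *\<^sub>C x) y T = (c *\<^sub>C pairing K x y) T"
  proof (cases "T \<in> bounded_ops K")
    case True
    have "(\<lambda>n. T ((c *\<^sub>C x) n)) = c *\<^sub>C (\<lambda>n. T (x n))"
      using True assms by (auto simp: scaleC_apply op_scaleC)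
    then show ?thesis using True assms op_seqs[OF True assms(1)]
      by (simp add: pairing_def scaleC_apply scaleC_complex_def seq.inner_scaleC_left)
  qed (simp add: pairing_off scaleC_apply)
qed

lemma pairing_scaleC_right:
  assumes "x \<in> seqs" "y \<in> seqs" shows "pairing K x (c *\<^sub>C y) = cnj c *\<^sub>C pairing K x y"
proof
  fix T show "pairing K x (c *\<^sub>C y) T = (cnj c *\<^sub>C pairing K x y) T"
    using assms op_seqs[of T x]
    by (cases "T \<in> bounded_ops K")
      (auto simp: pairing_def seq.inner_scaleC_right scaleC_apply scaleC_complex_def)
qed

lemma interleave_power2_sums:
  assumes "x \<in> seqs" "x' \<in> seqs"
  shows "(\<lambda>n. (hnorm K (interleave x x' n))\<^sup>2) sums ((seq_norm x)\<^sup>2 + (seq_norm x')\<^sup>2)"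
proof -
  have "(\<lambda>n. if even n then (hnorm K (x (n div 2)))\<^sup>2 else (hnorm K (x' ((n - 1) div 2)))\<^sup>2)
      sums ((seq_norm x)\<^sup>2 + (seq_norm x')\<^sup>2)"
    unfolding dsum_hnorm_power2[OF assms(1)] dsum_hnorm_power2[OF assms(2)]
    by (subst add.commute) (intro sums_if summable_sums dsum_summable[OF assms(1)] dsum_summable[OF assms(2)])
  moreover have "(\<lambda>n. if even n then (hnorm K (x (n div 2)))\<^sup>2 else (hnorm K (x' ((n - 1) div 2)))\<^sup>2) =
      (\<lambda>n. (hnorm K (interleave x x' n))\<^sup>2)"
    by (auto simp: interleave_def)
  ultimately show ?thesis by simp
qed

lemma interleave_seqs:
  assumes "x \<in> seqs" "x' \<in> seqs" shows "interleave x x' \<in> seqs"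
  unfolding dsum_mem using sums_summable[OF interleave_power2_sums[OF assms]] assms
  by (auto simp: interleave_def)

lemma interleave_norm:
  assumes "x \<in> seqs" "x' \<in> seqs"
  shows "(seq_norm (interleave x x'))\<^sup>2 = (seq_norm x)\<^sup>2 + (seq_norm x')\<^sup>2"
  unfolding dsum_hnorm_power2[OF interleave_seqs[OF assms]]
  using sums_unique[OF interleave_power2_sums[OF assms]] by simp

lemma pairing_interleave:
  assumes "x \<in> seqs" "x' \<in> seqs" "y \<in> seqs" "y' \<in> seqs"
  shows "pairing K (interleave x x') (interleave y y') = pairing K x y + pairing K x' y'"
proof
  fix T show "pairing K (interleave x x') (interleave y y') T = (pairing K x y + pairing K x' y') T"
  proof (cases "T \<in> bounded_ops K")
    case True
    have "(\<lambda>n. if even n then hinner K (T (x (n div 2))) (y (n div 2))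
        else hinner K (T (x' ((n - 1) div 2))) (y' ((n - 1) div 2))) sums
        (pairing K x' y' T + pairing K x y T)"
      using pairing_sums[OF True] assms
      by (intro sums_if_complex) auto
    moreover have "(\<lambda>n. if even n then hinner K (T (x (n div 2))) (y (n div 2))
        else hinner K (T (x' ((n - 1) div 2))) (y' ((n - 1) div 2))) =
        (\<lambda>n. hinner K (T (interleave x x' n)) (interleave y y' n))"
      by (auto simp: interleave_def)
    ultimately have "(\<lambda>n. hinner K (T (interleave x x' n)) (interleave y y' n)) sums
        (pairing K x y T + pairing K x' y' T)" by (simp add: add.commute)
    then show ?thesis
      using pairing_sums[OF True interleave_seqs[OF assms(1,2)] interleave_seqs[OF assms(3,4)]]
        sums_unique2 by fastforce
  qed (simp add: pairing_off)
qed

lemma subspace_normal_functionals: "complex_vector.subspace (normal_functionals K)"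
proof (rule complex_vector.subspaceI)
  have "pairing K 0 0 = 0"
    using pairing_scaleC_left[of 0 0 0] by simp
  then show "0 \<in> normal_functionals K" unfolding normal_functionals_def using seq.zero_vecs by force
  fix \<phi> \<psi> assume "\<phi> \<in> normal_functionals K" "\<psi> \<in> normal_functionals K"
  then show "\<phi> + \<psi> \<in> normal_functionals K"
    unfolding normal_functionals_def using pairing_interleave interleave_seqs
    by (smt (verit, best) mem_Collect_eq)
next
  fix c \<phi> assume "\<phi> \<in> normal_functionals K"
  then show "c *\<^sub>C \<phi> \<in> normal_functionals K"
    unfolding normal_functionals_def using pairing_scaleC_left[symmetric] seq.scaleC_vecs by blast
qed

lemma drop_seq_seqs:
  assumes "x \<in> seqs" shows "drop_seq m x \<in> seqs"
  by (rule dsum_dominated(1)[OF assms, of _ 1]) (use assms in \<open>auto simp: drop_seq_def\<close>)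

lemma drop_seq_norm:
  assumes "x \<in> seqs"
  shows "(seq_norm (drop_seq m x))\<^sup>2 = (seq_norm x)\<^sup>2 - (\<Sum>n<m. (hnorm K (x n))\<^sup>2)"
proof -
  have "(\<lambda>n. (hnorm K (x n))\<^sup>2 - (if n \<in> {..<m} then (hnorm K (x n))\<^sup>2 else 0)) sums
      ((\<Sum>n. (hnorm K (x n))\<^sup>2) - (\<Sum>n\<in>{..<m}. (hnorm K (x n))\<^sup>2))"
    by (intro sums_diff summable_sums dsum_summable[OF assms] sums_If_finite_set) simp
  moreover have "(\<lambda>n. (hnorm K (x n))\<^sup>2 - (if n \<in> {..<m} then (hnorm K (x n))\<^sup>2 else 0)) =
      (\<lambda>n. (hnorm K (drop_seq m x n))\<^sup>2)"
    by (auto simp: drop_seq_def)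
  ultimately have "(\<lambda>n. (hnorm K (drop_seq m x n))\<^sup>2) sums
      ((\<Sum>n. (hnorm K (x n))\<^sup>2) - (\<Sum>n<m. (hnorm K (x n))\<^sup>2))" by simp
  from sums_unique[OF this] show ?thesis
    unfolding dsum_hnorm_power2[OF assms] dsum_hnorm_power2[OF drop_seq_seqs[OF assms]] by simp
qed

lemma drop_seq_norm_tendsto:
  assumes "x \<in> seqs" shows "(\<lambda>m. (seq_norm (drop_seq m x))\<^sup>2) \<longlonglongrightarrow> 0"
proof -
  have "(\<lambda>m. \<Sum>n<m. (hnorm K (x n))\<^sup>2) \<longlonglongrightarrow> (seq_norm x)\<^sup>2"
    using summable_sums[OF dsum_summable[OF assms]] unfolding dsum_hnorm_power2[OF assms] sums_def .
  from tendsto_diff[OF tendsto_const this, of "(seq_norm x)\<^sup>2"] show ?thesis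
    unfolding drop_seq_norm[OF assms] by simp
qed

lemma pairing_at_slot:
  assumes "T \<in> bounded_ops K" "h \<in> vecs K" "k \<in> vecs K"
  shows "pairing K (at_slot 0 h) (at_slot 0 k) T = hinner K (T h) k"
proof -
  have "(\<lambda>n. T (at_slot 0 h n)) = at_slot 0 (T h)" using assms by (auto simp: at_slot_def)
  then show ?thesis using assms inner_at_slot[of 0 \<infinity> "T h" "at_slot 0 k"] at_slot_mem[of 0 \<infinity> k]
    by (simp add: pairing_def) (simp add: at_slot_def)
qed

text \<open>
  A functional is a finite sum of rank one functionals up to the contribution of the tails, whose
  norms tend to zero.
\<close>

lemma pairing_split:
  assumes x: "x \<in> seqs" and y: "y \<in> seqs"
  shows "pairing K x y =
    (\<Sum>n<m. pairing K (at_slot 0 (x n)) (at_slot 0 (y n))) + pairing K (drop_seq m x) (drop_seq m y)"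
proof
  fix T
  show "pairing K x y T = ((\<Sum>n<m. pairing K (at_slot 0 (x n)) (at_slot 0 (y n))) +
    pairing K (drop_seq m x) (drop_seq m y)) T"
  proof (cases "T \<in> bounded_ops K")
    case True
    define f where "f n = hinner K (T (x n)) (y n)" for n
    have "(\<lambda>n. f n - (if n \<in> {..<m} then f n else 0)) sums (pairing K x y T - (\<Sum>n\<in>{..<m}. f n))"
      unfolding f_def by (intro sums_diff pairing_sums True x y sums_If_finite_set) simp
    moreover have "(\<lambda>n. f n - (if n \<in> {..<m} then f n else 0)) =
        (\<lambda>n. hinner K (T (drop_seq m x n)) (drop_seq m y n))"
      using True by (auto simp: f_def drop_seq_def)
    ultimately have "pairing K (drop_seq m x) (drop_seq m y) T = pairing K x y T - (\<Sum>n<m. f n)"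
      using pairing_sums[OF True drop_seq_seqs[OF x] drop_seq_seqs[OF y]] sums_unique2 by metis
    then show ?thesis
      using x y True by (simp add: sum_fun_apply pairing_at_slot f_def)
  qed (simp add: pairing_off sum_fun_apply)
qed

lemma at_slot_add: "at_slot i (h + h' :: 'v) = at_slot i h + at_slot i h'"
  by (auto simp: at_slot_def)

lemma at_slot_scaleC: "at_slot i (c *\<^sub>C h :: 'v) = c *\<^sub>C at_slot i h"
  by (auto simp: at_slot_def scaleC_apply)

end

lemma le_Inf_add:
  fixes A B :: "real set"
  assumes "A \<noteq> {}" "B \<noteq> {}" "\<And>a b. a \<in> A \<Longrightarrow> b \<in> B \<Longrightarrow> m \<le> a + b"
  shows "m \<le> Inf A + Inf B"
proof -
  have "m - b \<le> Inf A" if "b \<in> B" for b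
    using assms(1) assms(3)[OF _ that] by (intro cInf_greatest) (auto simp: algebra_simps)
  then have "m - Inf A \<le> Inf B"
    using assms(2) by (intro cInf_greatest) (auto simp: algebra_simps)
  then show ?thesis by simp
qed

section \<open>Duality between operators and normal functionals\<close>

definition annihilator :: "'v::complex_vector hspace \<Rightarrow> ('v \<Rightarrow> 'v) set \<Rightarrow> (('v \<Rightarrow> 'v) \<Rightarrow> complex) set" where
  "annihilator K S = {\<sigma> \<in> normal_functionals K. \<forall>T\<in>S. \<sigma> T = 0}"

context hilbert_space
begin

interpretation seq: hilbert_space "direct_sum K \<infinity>"
  by (rule hilbert_space_direct_sum)

lemma pairing_normal: "x \<in> seqs \<Longrightarrow> y \<in> seqs \<Longrightarrow> pairing K x y \<in> normal_functionals K"
  by (auto simp: normal_functionals_def)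

lemma subspace_annihilator: "complex_vector.subspace (annihilator K S)"
proof (rule complex_vector.subspaceI)
qed (use subspace_normal_functionals in \<open>auto simp: annihilator_def scaleC_apply scaleC_complex_def
      complex_vector.subspace_0 complex_vector.subspace_add complex_vector.subspace_scale\<close>)

text \<open>
  Evaluation at \<open>F\<close> on the annihilator of \<open>S\<close> extends to a functional \<open>g\<close> on all normal functionals
  with the same bound \<open>c\<close>. On rank one functionals \<open>g\<close> is a bounded sesquilinear form, hence given by
  an operator \<open>G\<close>, and by continuity \<open>g\<close> is evaluation at \<open>G\<close> everywhere.

  The bounds use half the sum of the squared norms in place of their product: the two have the
  same infimum over all representations of a functional, but the sum is additive under
  interleaving.
\<close>

theorem dual_extension:
  assumes F: "F \<in> bounded_ops K" and c: "c \<ge> 0"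
    and bound: "\<And>x y. x \<in> seqs \<Longrightarrow> y \<in> seqs \<Longrightarrow> pairing K x y \<in> annihilator K S \<Longrightarrow>
      cmod (pairing K x y F) \<le> c * ((seq_norm x)\<^sup>2 + (seq_norm y)\<^sup>2) / 2"
  shows "\<exists>G\<in>bounded_ops K. (\<forall>x\<in>vecs K. hnorm K (G x) \<le> c * hnorm K x) \<and>
    (\<forall>\<sigma>\<in>annihilator K S. \<sigma> (F - G) = 0)"
proof -
  let ?N = "normal_functionals K" and ?A = "annihilator K S"
  note N = subspace_normal_functionals and A = subspace_annihilator[of S]
  define W where "W x y = c * ((seq_norm x)\<^sup>2 + (seq_norm y)\<^sup>2) / 2" for x y
  have W0: "W 0 0 = 0" by (simp add: W_def)
  have W_interleave: "W (interleave x x') (interleave y y') = W x y + W x' y'"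
    if "x \<in> seqs" "x' \<in> seqs" "y \<in> seqs" "y' \<in> seqs" for x x' y y'
    using that by (simp add: W_def interleave_norm algebra_simps add_divide_distrib)
  have W_scale: "W (a *\<^sub>C x) (b *\<^sub>C y) = t * W x y"
    if "x \<in> seqs" "y \<in> seqs" "(cmod a)\<^sup>2 = t" "(cmod b)\<^sup>2 = t" for x y a b t
    using that by (simp add: W_def seq.hnorm_scaleC power_mult_distrib algebra_simps)
  have AN: "\<sigma> \<in> ?N" if "\<sigma> \<in> ?A" for \<sigma> using that by (simp add: annihilator_def)
  \<comment> \<open>Being below \<open>p\<close> encodes both demands on the extension: the terms with \<open>\<sigma> = 0\<close> bound it by \<open>W\<close>, and
    those with \<open>x = y = 0\<close> force it to be evaluation at \<open>F\<close> on the annihilator.\<close>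
  define Z where "Z \<psi> = {W x y + Re (\<sigma> F) | x y \<sigma>. x \<in> seqs \<and> y \<in> seqs \<and> \<sigma> \<in> ?A \<and> \<psi> = pairing K x y + \<sigma>}" for \<psi>
  define p where "p \<psi> = Inf (Z \<psi>)" for \<psi>
  have ZI: "W x y + Re (\<sigma> F) \<in> Z (pairing K x y + \<sigma>)" if "x \<in> seqs" "y \<in> seqs" "\<sigma> \<in> ?A" for x y \<sigma>
    using that by (auto simp: Z_def)
  have Z_ne: "Z \<psi> \<noteq> {}" if "\<psi> \<in> ?N" for \<psi>
    using that ZI[OF _ _ complex_vector.subspace_0[OF A]] by (force simp: normal_functionals_def)
  have Z_bdd: "bdd_below (Z \<psi>)" if \<psi>: "\<psi> \<in> ?N" for \<psi>
  proof -
    obtain a b where ab: "a \<in> seqs" "b \<in> seqs" "\<psi> = pairing K a b"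
      using \<psi> by (auto simp: normal_functionals_def)
    have "- W a b \<le> z" if z: "z \<in> Z \<psi>" for z
    proof -
      obtain x y \<sigma> where xy: "x \<in> seqs" "y \<in> seqs" "\<sigma> \<in> ?A" "\<psi> = pairing K x y + \<sigma>"
        and z: "z = W x y + Re (\<sigma> F)" using z by (auto simp: Z_def)
      have nx: "(- 1) *\<^sub>C x \<in> seqs" using xy by simp
      have "pairing K (interleave a ((- 1) *\<^sub>C x)) (interleave b y) = \<psi> + (- 1) *\<^sub>C pairing K x y"
        by (simp only: pairing_interleave[OF ab(1) nx ab(2) xy(2)] pairing_scaleC_left[OF xy(1,2)] ab(3))
      also have "\<dots> = \<sigma>" using xy(4) by (auto simp: scaleC_apply scaleC_complex_def fun_eq_iff)
      finally have \<sigma>: "pairing K (interleave a ((- 1) *\<^sub>C x)) (interleave b y) = \<sigma>" .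
      \<comment> \<open>The difference of two representations of \<open>\<psi>\<close> represents \<open>\<sigma>\<close>, so the hypothesis bounds \<open>\<sigma> F\<close>.\<close>
      have "cmod (\<sigma> F) \<le> W (interleave a ((- 1) *\<^sub>C x)) (interleave b y)"
        using bound[OF interleave_seqs[OF ab(1) nx] interleave_seqs[OF ab(2) xy(2)]] xy(3)
        unfolding \<sigma> W_def by simp
      also have "\<dots> = W a b + W x y"
        using W_interleave[OF ab(1) nx ab(2) xy(2)] W_scale[OF xy(1,2), of "-1" 1 1] by (simp add: scaleC_one)
      finally show ?thesis using abs_Re_le_cmod[of "\<sigma> F"] unfolding z by linarith
    qed
    then show ?thesis by (rule bdd_belowI)
  qed
  have p_le: "p (pairing K x y + \<sigma>) \<le> W x y + Re (\<sigma> F)" if "x \<in> seqs" "y \<in> seqs" "\<sigma> \<in> ?A" for x y \<sigma>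
    unfolding p_def
    by (intro cInf_lower ZI that Z_bdd complex_vector.subspace_add[OF N] AN pairing_normal)
  have "sublinear_on ?N p"
    unfolding sublinear_on_def
  proof (intro conjI ballI allI impI)
    fix \<psi> \<psi>' assume "\<psi> \<in> ?N" "\<psi>' \<in> ?N"
    then show "p (\<psi> + \<psi>') \<le> p \<psi> + p \<psi>'"
      unfolding p_def[of \<psi>] p_def[of \<psi>']
    proof (intro le_Inf_add Z_ne)
      fix z z' assume "z \<in> Z \<psi>" "z' \<in> Z \<psi>'"
      then obtain x y \<sigma> x' y' \<sigma>' where 1: "x \<in> seqs" "y \<in> seqs" "\<sigma> \<in> ?A" "\<psi> = pairing K x y + \<sigma>"
          "z = W x y + Re (\<sigma> F)"
        and 2: "x' \<in> seqs" "y' \<in> seqs" "\<sigma>' \<in> ?A" "\<psi>' = pairing K x' y' + \<sigma>'"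
          "z' = W x' y' + Re (\<sigma>' F)" unfolding Z_def by blast
      have eq: "\<psi> + \<psi>' = pairing K (interleave x x') (interleave y y') + (\<sigma> + \<sigma>')"
        unfolding pairing_interleave[OF 1(1) 2(1) 1(2) 2(2)] 1 2 by (simp add: add_ac)
      show "p (\<psi> + \<psi>') \<le> z + z'"
        unfolding eq
        using p_le[OF interleave_seqs[OF 1(1) 2(1)] interleave_seqs[OF 1(2) 2(2)]
            complex_vector.subspace_add[OF A 1(3) 2(3)]] W_interleave[OF 1(1) 2(1) 1(2) 2(2)]
        by (simp add: 1(5) 2(5))
    qed
  next
    fix \<psi> and t :: real assume \<psi>: "\<psi> \<in> ?N" and t: "t > 0"
    show "t * p \<psi> \<le> p (of_real t *\<^sub>C \<psi>)"
      unfolding p_def[of "of_real t *\<^sub>C \<psi>"]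
    proof (rule cInf_greatest)
      show "Z (of_real t *\<^sub>C \<psi>) \<noteq> {}" by (intro Z_ne complex_vector.subspace_scale[OF N] \<psi>)
      fix z assume "z \<in> Z (of_real t *\<^sub>C \<psi>)"
      then obtain x y \<sigma> where xy: "x \<in> seqs" "y \<in> seqs" "\<sigma> \<in> ?A" "of_real t *\<^sub>C \<psi> = pairing K x y + \<sigma>"
          "z = W x y + Re (\<sigma> F)" unfolding Z_def by blast
      define s where "s = complex_of_real (1 / sqrt t)"
      have s: "s * cnj s = complex_of_real (1 / t)" "(cmod s)\<^sup>2 = 1 / t"
        using t by (simp_all add: s_def norm_divide power_divide flip: of_real_mult of_real_divide)
      have "\<psi> = of_real (1 / t) *\<^sub>C of_real t *\<^sub>C \<psi>"
        using t by (simp add: scaleC_scaleC scaleC_one flip: of_real_mult)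
      also have "\<dots> = of_real (1 / t) *\<^sub>C pairing K x y + of_real (1 / t) *\<^sub>C \<sigma>"
        unfolding xy(4) scaleC_add_right ..
      also have "of_real (1 / t) *\<^sub>C pairing K x y = pairing K (s *\<^sub>C x) (s *\<^sub>C y)"
        unfolding s(1)[symmetric] using xy
        by (simp add: pairing_scaleC_left pairing_scaleC_right scaleC_scaleC)
      finally have \<psi>: "\<psi> = pairing K (s *\<^sub>C x) (s *\<^sub>C y) + of_real (1 / t) *\<^sub>C \<sigma>" .
      have "p \<psi> \<le> W (s *\<^sub>C x) (s *\<^sub>C y) + Re ((of_real (1 / t) *\<^sub>C \<sigma>) F)"
        unfolding \<psi> by (intro p_le seq.scaleC_vecs xy complex_vector.subspace_scale[OF A])
      also have "\<dots> = z / t"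
        using W_scale[OF xy(1,2) s(2) s(2)] unfolding xy(5)
        by (simp add: scaleC_apply scaleC_complex_def add_divide_distrib)
      finally show "t * p \<psi> \<le> z" using t by (simp add: field_simps)
    qed
  qed
  from Hahn_Banach_sublinear_complex[OF N this]
  obtain g where g_le: "\<And>\<psi>. \<psi> \<in> ?N \<Longrightarrow> Re (g \<psi>) \<le> p \<psi>"
    and g_add: "\<And>\<psi> \<psi>'. \<psi> \<in> ?N \<Longrightarrow> \<psi>' \<in> ?N \<Longrightarrow> g (\<psi> + \<psi>') = g \<psi> + g \<psi>'"
    and g_scale: "\<And>\<psi> a. \<psi> \<in> ?N \<Longrightarrow> g (a *\<^sub>C \<psi>) = a * g \<psi>" by blast
  have g0: "g 0 = 0" using g_scale[OF complex_vector.subspace_0[OF N], of 0] by simp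
  have g_sum: "g (sum f I) = (\<Sum>i\<in>I. g (f i))" if "\<And>i. f i \<in> ?N" for f and I :: "nat set"
    using that by (induction I rule: infinite_finite_induct)
      (simp_all add: g0 g_add complex_vector.subspace_sum[OF N])
  have g_W: "cmod (g (pairing K x y)) \<le> W x y" if xy: "x \<in> seqs" "y \<in> seqs" for x y
  proof -
    \<comment> \<open>Rotating \<open>x\<close> by a unimodular \<open>w\<close> turns the bound on the real part into one on the modulus.\<close>
    obtain w where w: "cmod w = 1" "w * g (pairing K x y) = of_real (cmod (g (pairing K x y)))"
    proof (cases "g (pairing K x y) = 0")
      case False
      let ?z = "g (pairing K x y)"
      have "cnj ?z / of_real (cmod ?z) * ?z = of_real (cmod ?z)"
        using False complex_norm_square[of ?z] by (simp add: field_simps power2_eq_square)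
      then show ?thesis using that[of "cnj ?z / of_real (cmod ?z)"] False by (simp add: norm_divide)
    qed (use that[of 1] in simp)
    have "cmod (g (pairing K x y)) = Re (g (pairing K (w *\<^sub>C x) y))"
      using xy w(2) by (simp add: pairing_scaleC_left g_scale pairing_normal)
    also have "\<dots> \<le> p (pairing K (w *\<^sub>C x) y)"
      using xy by (intro g_le pairing_normal) auto
    also have "\<dots> \<le> W (w *\<^sub>C x) y"
      using p_le[of "w *\<^sub>C x" y 0] xy complex_vector.subspace_0[OF A] by simp
    also have "\<dots> = W x y" using W_scale[OF xy, of w 1 1] w by (simp add: scaleC_one)
    finally show ?thesis .
  qed
  have p_ann: "Re (g \<sigma>) \<le> Re (\<sigma> F)" if \<sigma>: "\<sigma> \<in> ?A" for \<sigma>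
  proof -
    have "pairing K 0 0 = 0" using pairing_scaleC_left[of 0 0 0] by simp
    then show ?thesis using g_le[OF AN[OF \<sigma>]] p_le[of 0 0 \<sigma>] \<sigma> W0 by simp
  qed
  have Re_ann: "Re (g \<sigma>) = Re (\<sigma> F)" if \<sigma>: "\<sigma> \<in> ?A" for \<sigma>
    using p_ann[OF \<sigma>] p_ann[OF complex_vector.subspace_scale[OF A \<sigma>, of "-1"]] g_scale[OF AN[OF \<sigma>], of "-1"]
    by (simp add: scaleC_apply scaleC_complex_def)
  have g_ann: "g \<sigma> = \<sigma> F" if \<sigma>: "\<sigma> \<in> ?A" for \<sigma>
  proof -
    have "Re (g (\<i> *\<^sub>C \<sigma>)) = Re ((\<i> *\<^sub>C \<sigma>) F)"
      by (intro Re_ann complex_vector.subspace_scale[OF A \<sigma>])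
    then show ?thesis
      using Re_ann[OF \<sigma>] by (simp add: g_scale[OF AN[OF \<sigma>]] scaleC_apply scaleC_complex_def complex_eq_iff)
  qed
  define b where "b h k = g (pairing K (at_slot 0 h) (at_slot 0 k))" for h k
  have slot [simp]: "at_slot 0 h \<in> seqs" if "h \<in> vecs K" for h
    using at_slot_mem[of 0 \<infinity> h] that by simp
  have slot_norm: "seq_norm (at_slot 0 h) = hnorm K h" if "h \<in> vecs K" for h
    using hnorm_at_slot[of 0 \<infinity> h] that by simp
  have slot_W: "cmod (b h k) \<le> c * ((hnorm K h)\<^sup>2 + (hnorm K k)\<^sup>2) / 2" if "h \<in> vecs K" "k \<in> vecs K" for h k
    using g_W[of "at_slot 0 h" "at_slot 0 k"] that by (simp add: b_def W_def slot_norm)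
  have b_sl: "b (a *\<^sub>C h) k = a * b h k" if "h \<in> vecs K" "k \<in> vecs K" for a h k
    using that by (simp add: b_def at_slot_scaleC pairing_scaleC_left g_scale pairing_normal)
  have b_sr: "b h (a *\<^sub>C k) = cnj a * b h k" if "h \<in> vecs K" "k \<in> vecs K" for a h k
    using that by (simp add: b_def at_slot_scaleC pairing_scaleC_right g_scale pairing_normal)
  \<comment> \<open>Rescaling \<open>h\<close> and \<open>k\<close> to equal norm turns the bound by half the sum of squares into the
    bound by the product.\<close>
  have b_bound: "cmod (b h k) \<le> c * hnorm K h * hnorm K k" if hk: "h \<in> vecs K" "k \<in> vecs K" for h k
  proof (cases "hnorm K h = 0 \<or> hnorm K k = 0")
    case True
    then have "h = 0 \<or> k = 0" using hk hnorm_eq_0 by blast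
    then have "b h k = 0" using b_sl[of 0 k 0] b_sr[of h 0 0] hk by auto
    then show ?thesis using hk c by simp
  next
    case False
    then have pos: "hnorm K h > 0" "hnorm K k > 0"
      using hnorm_nonneg[OF hk(1)] hnorm_nonneg[OF hk(2)] by linarith+
    define t where "t = sqrt (hnorm K k / hnorm K h)"
    have t: "t > 0" "t\<^sup>2 = hnorm K k / hnorm K h" using pos by (simp_all add: t_def)
    define h' where "h' = of_real t *\<^sub>C h"
    define k' where "k' = of_real (1 / t) *\<^sub>C k"
    have v: "h' \<in> vecs K" "k' \<in> vecs K" using hk by (simp_all add: h'_def k'_def)
    have "b h' k' = of_real t * (of_real (1 / t) * b h k)"
      unfolding h'_def k'_def using hk by (simp add: b_sl b_sr del: of_real_divide)
    also have "\<dots> = b h k" using t by simp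
    finally have e: "b h' k' = b h k" .
    have "(hnorm K h')\<^sup>2 = t\<^sup>2 * (hnorm K h)\<^sup>2"
      using hk t by (simp add: h'_def hnorm_scaleC power_mult_distrib)
    also have "\<dots> = hnorm K h * hnorm K k" unfolding t(2) using pos by (simp add: power2_eq_square)
    finally have 1: "(hnorm K h')\<^sup>2 = hnorm K h * hnorm K k" .
    have "(hnorm K k')\<^sup>2 = (hnorm K k)\<^sup>2 / t\<^sup>2"
      using hk t by (simp add: k'_def hnorm_scaleC power_mult_distrib power_divide norm_divide)
    also have "\<dots> = hnorm K h * hnorm K k" unfolding t(2) using pos by (simp add: power2_eq_square)
    finally have 2: "(hnorm K k')\<^sup>2 = hnorm K h * hnorm K k" .
    show ?thesis using slot_W[OF v] unfolding e 1 2 by simp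
  qed
  obtain G where G: "G \<in> bounded_ops K" "\<forall>x\<in>vecs K. \<forall>y\<in>vecs K. hinner K (G x) y = b x y"
    and Gc: "\<forall>x\<in>vecs K. hnorm K (G x) \<le> c * hnorm K x"
    using op_of_sesquilinear_form[of b c] b_sl b_sr b_bound c
    by (auto simp: b_def at_slot_add pairing_add_left pairing_add_right g_add pairing_normal)
  have gG: "g (pairing K x y) = pairing K x y G" if xy: "x \<in> seqs" "y \<in> seqs" for x y
  proof -
    have "g (pairing K x y) - (\<Sum>n<m. hinner K (G (x n)) (y n)) =
        g (pairing K (drop_seq m x) (drop_seq m y))" for m
      by (subst pairing_split[OF xy, of m])
        (use xy G(2) in \<open>simp add: g_add g_sum pairing_normal drop_seq_seqs complex_vector.subspace_sum[OF N] b_def\<close>)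
    then have le: "cmod (g (pairing K x y) - (\<Sum>n<m. hinner K (G (x n)) (y n))) \<le> W (drop_seq m x) (drop_seq m y)" for m
      using g_W[OF drop_seq_seqs[OF xy(1)] drop_seq_seqs[OF xy(2)]] by metis
    have W_lim: "(\<lambda>m. W (drop_seq m x) (drop_seq m y)) \<longlonglongrightarrow> 0"
    proof -
      have "(\<lambda>m. W (drop_seq m x) (drop_seq m y)) \<longlonglongrightarrow> c * (0 + 0) / 2"
        unfolding W_def by (intro tendsto_intros drop_seq_norm_tendsto xy) simp
      then show ?thesis by simp
    qed
    have "(\<lambda>m. g (pairing K x y) - (\<Sum>n<m. hinner K (G (x n)) (y n))) \<longlonglongrightarrow> 0"
      by (rule Lim_null_comparison[OF always_eventually W_lim]) (use le in blast)
    from tendsto_diff[OF tendsto_const[of "g (pairing K x y)"] this]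
    have "(\<lambda>m. \<Sum>n<m. hinner K (G (x n)) (y n)) \<longlonglongrightarrow> g (pairing K x y)" by simp
    then show ?thesis using pairing_sums[OF G(1) xy] LIMSEQ_unique unfolding sums_def by blast
  qed
  have "\<sigma> (F - G) = 0" if \<sigma>: "\<sigma> \<in> ?A" for \<sigma>
  proof -
    obtain x y where xy: "x \<in> seqs" "y \<in> seqs" "\<sigma> = pairing K x y"
      using AN[OF \<sigma>] by (auto simp: normal_functionals_def)
    then show ?thesis using g_ann[OF \<sigma>] gG[OF xy(1,2)] pairing_op_diff[OF F G(1) xy(1,2)] by simp
  qed
  then show ?thesis using G Gc by blast
qed

text \<open>
  In the finite-dimensional space of values of the functionals in \<open>P\<close>, the point given by \<open>G\<close> is not
  in the image of \<open>W\<close>, so a linear combination of the coordinates vanishes on this image and not at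
  the point. The induction on \<open>P\<close> constructs this combination.
\<close>

lemma finitely_many_functionals_separate:
  assumes "finite P" and PN: "P \<subseteq> N"
    and N: "complex_vector.subspace N"
    and lin: "\<And>\<phi>. \<phi> \<in> N \<Longrightarrow> (\<forall>S\<in>V. \<forall>T\<in>V. \<phi> (S + T) = \<phi> S + \<phi> T) \<and> (\<forall>c. \<forall>T\<in>V. \<phi> (c *\<^sub>C T) = c * \<phi> T)"
    and V: "complex_vector.subspace V" and W: "complex_vector.subspace W" and WV: "W \<subseteq> V"
    and G: "G \<in> V" and sep: "\<And>w. w \<in> W \<Longrightarrow> \<exists>\<phi>\<in>P. \<phi> w \<noteq> \<phi> G"
  shows "\<exists>\<psi>\<in>N. (\<forall>w\<in>W. \<psi> w = 0) \<and> \<psi> (G :: 'a::complex_vector) \<noteq> (0::complex)"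
  using assms(1,2) W WV G sep
proof (induction P arbitrary: W G rule: finite_induct)
  case empty
  then show ?case using complex_vector.subspace_0 by blast
next
  case (insert \<phi> P)
  have \<phi>: "\<phi> \<in> N" using insert.prems by simp
  have add: "\<And>\<psi> S T. \<psi> \<in> N \<Longrightarrow> S \<in> V \<Longrightarrow> T \<in> V \<Longrightarrow> \<psi> (S + T) = \<psi> S + \<psi> T"
    and scale: "\<And>\<psi> c T. \<psi> \<in> N \<Longrightarrow> T \<in> V \<Longrightarrow> \<psi> (c *\<^sub>C T) = c * \<psi> T" using lin by blast+
  show ?case
  proof (cases "\<forall>w\<in>W. \<phi> w = 0")
    case True
    show ?thesis
    proof (cases "\<phi> G = 0")
      case False then show ?thesis using True \<phi> by blast
    next
      case G0: True
      show ?thesis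
        by (rule insert.IH) (use insert.prems True G0 in fastforce)+
    qed
  next
    case False
    then obtain u where u: "u \<in> W" "\<phi> u \<noteq> 0" by blast
    define w0 where "w0 = inverse (\<phi> u) *\<^sub>C u"
    have w0: "w0 \<in> W" "w0 \<in> V" "\<phi> w0 = 1"
      using u insert.prems complex_vector.subspace_scale[OF insert.prems(2) u(1)]
      by (auto simp: w0_def scale[OF \<phi>])
    \<comment> \<open>Subtracting multiples of \<open>w0\<close> moves \<open>W\<close> and \<open>G\<close> into the kernel of \<open>\<phi>\<close>.\<close>
    define W' where "W' = {w \<in> W. \<phi> w = 0}"
    define G' where "G' = G + (- \<phi> G) *\<^sub>C w0"
    have w0V: "c *\<^sub>C w0 \<in> V" for c by (rule complex_vector.subspace_scale[OF V w0(2)])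
    have "G' \<in> V" unfolding G'_def by (rule complex_vector.subspace_add[OF V insert.prems(4) w0V])
    moreover have "\<phi> G' = 0"
      unfolding G'_def add[OF \<phi> insert.prems(4) w0V] scale[OF \<phi> w0(2)] using w0(3) by simp
    ultimately have G': "G' \<in> V" "\<phi> G' = 0" by auto
    have W'sub: "complex_vector.subspace W'"
    proof (rule complex_vector.subspaceI)
      show "0 \<in> W'"
        using complex_vector.subspace_0[OF insert.prems(2)] scale[OF \<phi> w0(2), of 0] by (simp add: W'_def)
    qed (use insert.prems(2,3) in \<open>auto simp: W'_def add[OF \<phi>] scale[OF \<phi>] subset_iff
        intro: complex_vector.subspace_add complex_vector.subspace_scale\<close>)
    have "\<exists>\<psi>\<in>N. (\<forall>w\<in>W'. \<psi> w = 0) \<and> \<psi> G' \<noteq> 0"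
    proof (rule insert.IH[OF _ W'sub _ G'(1)])
      show "P \<subseteq> N" "W' \<subseteq> V" using insert.prems by (auto simp: W'_def)
      fix w assume w: "w \<in> W'"
      then have wV: "w \<in> V" using insert.prems by (auto simp: W'_def)
      have wW: "w + \<phi> G *\<^sub>C w0 \<in> W"
        using w w0 insert.prems(2) by (auto simp: W'_def intro!: complex_vector.subspace_add complex_vector.subspace_scale)
      have e: "\<psi> (w + \<phi> G *\<^sub>C w0) - \<psi> G = \<psi> w - \<psi> G'" if "\<psi> \<in> N" for \<psi>
        by (simp only: G'_def add[OF that wV w0V] add[OF that insert.prems(4) w0V] scale[OF that w0(2)]) simp
      have "\<phi> (w + \<phi> G *\<^sub>C w0) = \<phi> G" using e[OF \<phi>] G'(2) w by (simp add: W'_def)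
      then obtain \<psi> where \<psi>: "\<psi> \<in> P" "\<psi> (w + \<phi> G *\<^sub>C w0) \<noteq> \<psi> G" using insert.prems(5)[OF wW] by blast
      then have "\<psi> w \<noteq> \<psi> G'" using e[of \<psi>] insert.prems(1) by auto
      with \<psi>(1) show "\<exists>\<psi>\<in>P. \<psi> w \<noteq> \<psi> G'" by blast
    qed
    then obtain \<psi> where \<psi>: "\<psi> \<in> N" "\<forall>w\<in>W'. \<psi> w = 0" "\<psi> G' \<noteq> 0" by blast
    define \<xi> where "\<xi> = \<psi> + (- \<psi> w0) *\<^sub>C \<phi>"
    have \<xi>: "\<xi> \<in> N" unfolding \<xi>_def
      by (intro complex_vector.subspace_add[OF N] complex_vector.subspace_scale[OF N] \<psi> \<phi>)
    have \<xi>_eq: "\<xi> T = \<psi> (T + (- \<phi> T) *\<^sub>C w0)" if "T \<in> V" for T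
      unfolding add[OF \<psi>(1) that w0V] scale[OF \<psi>(1) w0(2)]
      by (simp add: \<xi>_def scaleC_apply scaleC_complex_def)
    have "\<xi> w = 0" if w: "w \<in> W" for w
    proof -
      have "w + (- \<phi> w) *\<^sub>C w0 \<in> W'"
        unfolding W'_def mem_Collect_eq
      proof
        show "w + (- \<phi> w) *\<^sub>C w0 \<in> W"
          by (intro complex_vector.subspace_add[OF insert.prems(2)] complex_vector.subspace_scale[OF insert.prems(2)] w w0)
        show "\<phi> (w + (- \<phi> w) *\<^sub>C w0) = 0"
          unfolding add[OF \<phi> subsetD[OF insert.prems(3) w] w0V] scale[OF \<phi> w0(2)] using w0(3) by simp
      qed
      then show ?thesis using \<xi>_eq[of w] \<psi>(2) w insert.prems(3) by auto
    qed
    moreover have "\<xi> G \<noteq> 0" using \<xi>_eq[OF insert.prems(4)] \<psi>(3) by (simp add: G'_def)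
    ultimately show ?thesis using \<xi> by blast
  qed
qed

lemma subspace_bounded_ops: "complex_vector.subspace (bounded_ops K)"
proof (rule complex_vector.subspaceI)
  show "0 \<in> bounded_ops K" by (rule bounded_opsI[where C = 0]) (auto simp: complex_vector.scale_right_diff_distrib)
qed (auto intro: op_plus op_scale)

text \<open>
  An open set is a neighborhood of each of its points with respect to finitely many functionals. For
  separation from a subspace it is enough to know the points where these functionals take exactly
  the same values, so no radius occurs.
\<close>

lemma openin_weak_star_finite:
  assumes "openin (weak_star K) U" "T \<in> U"
  shows "\<exists>P. finite P \<and> P \<subseteq> normal_functionals K \<and> T \<in> bounded_ops K \<and>
    (\<forall>T'\<in>bounded_ops K. (\<forall>\<phi>\<in>P. \<phi> T' = \<phi> T) \<longrightarrow> T' \<in> U)"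
proof -
  have "generate_topology_on {{T \<in> bounded_ops K. (\<Sum>n. hinner K (T (x n)) (y n)) \<in> U} | x y U.
        x \<in> square_summable K \<and> y \<in> square_summable K \<and> open U} U"
    using assms(1) unfolding weak_star_def openin_topology_generated_by_iff .
  then show ?thesis using assms(2)
  proof (induction arbitrary: T)
    case (Int a b)
    obtain P where P: "finite P" "P \<subseteq> normal_functionals K" "T \<in> bounded_ops K"
      "\<forall>T'\<in>bounded_ops K. (\<forall>\<phi>\<in>P. \<phi> T' = \<phi> T) \<longrightarrow> T' \<in> a" using Int.IH(1)[of T] Int.prems by auto
    obtain Q where Q: "finite Q" "Q \<subseteq> normal_functionals K"
      "\<forall>T'\<in>bounded_ops K. (\<forall>\<phi>\<in>Q. \<phi> T' = \<phi> T) \<longrightarrow> T' \<in> b" using Int.IH(2)[of T] Int.prems by auto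
    show ?case by (rule exI[of _ "P \<union> Q"]) (use P Q in auto)
  next
    case (UN C)
    then obtain k where k: "k \<in> C" "T \<in> k" by blast
    then show ?case using UN.IH[OF k] by blast
  next
    case (Basis s)
    then obtain x y U where s: "s = {T \<in> bounded_ops K. (\<Sum>n. hinner K (T (x n)) (y n)) \<in> U}"
      and xy: "x \<in> seqs" "y \<in> seqs" unfolding seqs_eq by blast
    have "(\<Sum>n. hinner K (T (x n)) (y n)) = pairing K x y T" if "T \<in> bounded_ops K" for T
      using pairing_sums[OF that xy] sums_unique by metis
    then show ?case using Basis.prems xy
      by (intro exI[of _ "{pairing K x y}"]) (auto simp: s pairing_normal)
  qed simp
qed

lemma topspace_weak_star: "topspace (weak_star K) = bounded_ops K"
proof
  show "topspace (weak_star K) \<subseteq> bounded_ops K"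
    unfolding weak_star_def topology_generated_by_topspace by blast
  have "bounded_ops K = {T \<in> bounded_ops K. (\<Sum>n. hinner K (T ((\<lambda>n. 0) n)) ((\<lambda>n. 0) n)) \<in> UNIV}" by simp
  moreover have "(\<lambda>n. 0) \<in> square_summable K" by (simp add: square_summable_def)
  ultimately show "bounded_ops K \<subseteq> topspace (weak_star K)"
    unfolding weak_star_def topology_generated_by_topspace by blast
qed

text \<open>
  This is the part of the bipolar theorem that is used below. The finitely many functionals that
  describe a neighborhood of \<open>G\<close> disjoint from \<open>W\<close> reduce it to linear algebra.
\<close>

theorem weak_star_closed_annihilator:
  assumes W: "complex_vector.subspace W" and closed: "closedin (weak_star K) W"
    and G: "G \<in> bounded_ops K" "G \<notin> W"
  shows "\<exists>x\<in>seqs. \<exists>y\<in>seqs. pairing K x y \<in> annihilator K W \<and> pairing K x y G \<noteq> 0"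
proof -
  have WB: "W \<subseteq> bounded_ops K" and op: "openin (weak_star K) (bounded_ops K - W)"
    using closed topspace_weak_star by (auto simp: closedin_def)
  obtain P where P: "finite P" "P \<subseteq> normal_functionals K"
    "\<forall>T\<in>bounded_ops K. (\<forall>\<phi>\<in>P. \<phi> T = \<phi> G) \<longrightarrow> T \<in> bounded_ops K - W"
    using openin_weak_star_finite[OF op, of G] G by blast
  have "\<exists>\<psi>\<in>normal_functionals K. (\<forall>w\<in>W. \<psi> w = 0) \<and> \<psi> G \<noteq> 0"
  proof (rule finitely_many_functionals_separate[OF P(1,2) subspace_normal_functionals _ subspace_bounded_ops W WB G(1)])
    show "\<exists>\<phi>\<in>P. \<phi> w \<noteq> \<phi> G" if "w \<in> W" for w using P(3) that WB by blast
    show "(\<forall>S\<in>bounded_ops K. \<forall>T\<in>bounded_ops K. \<phi> (S + T) = \<phi> S + \<phi> T) \<and>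
        (\<forall>c. \<forall>T\<in>bounded_ops K. \<phi> (c *\<^sub>C T) = c * \<phi> T)" if "\<phi> \<in> normal_functionals K" for \<phi>
      using that by (auto simp: normal_functionals_def pairing_op_add pairing_op_scaleC)
  qed
  then show ?thesis by (auto simp: annihilator_def normal_functionals_def)
qed

end

section \<open>Compressions to invariant subspaces\<close>

context hilbert_space
begin

lemma closed_subspace_vecs_self: "closed_subspace K (vecs K)"
  using subspace_vecs by (auto simp: closed_subspace_def)

lemma closed_subspace_ominus:
  assumes L: "closed_subspace K L" and S: "S \<subseteq> vecs K"
  shows "closed_subspace K (ominus K L S)"
proof -
  have sub: "complex_vector.subspace L" and LK: "L \<subseteq> vecs K" using L by (auto simp: closed_subspace_def)
  note [simp] = subsetD[OF LK] subsetD[OF S]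
  show ?thesis
    unfolding closed_subspace_def
  proof (intro conjI allI impI)
    show "complex_vector.subspace (ominus K L S)"
    proof (rule complex_vector.subspaceI)
    qed (use sub in \<open>auto simp: ominus_def inner_simps complex_vector.subspace_0
        complex_vector.subspace_add complex_vector.subspace_scale\<close>)
    show "ominus K L S \<subseteq> vecs K" by (auto simp: ominus_def)
    fix u l assume *: "(\<forall>n. u n \<in> ominus K L S) \<and> l \<in> vecs K \<and> (\<lambda>n. hnorm K (u n - l)) \<longlonglongrightarrow> 0"
    then have uL: "u n \<in> L" and u0: "y \<in> S \<Longrightarrow> hinner K (u n) y = 0" for n y by (auto simp: ominus_def)
    have "l \<in> L" using L * uL unfolding closed_subspace_def by blast
    moreover have "hinner K l y = 0" if y: "y \<in> S" for y
    proof -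
      have "(\<lambda>n. hinner K (u n) y) \<longlonglongrightarrow> hinner K l y"
        by (rule tendsto_inner_left) (use * uL y in auto)
      then show ?thesis using u0[OF y] by (simp add: LIMSEQ_const_iff)
    qed
    ultimately show "l \<in> ominus K L S" by (simp add: ominus_def)
  qed
qed

end

text \<open>
  The common setting for the multiplication operators on \<open>H\<close> and for their ampliations: a
  representation of the algebra on \<open>K\<close> that is completely contractive with respect to the norms of
  matrices of multipliers on \<open>H\<close>.
\<close>

locale multiplier_action = hilbert_space K for K :: "'v::complex_vector hspace" +
  fixes H :: "('x \<Rightarrow> complex) hspace" and \<AA> :: "('x \<Rightarrow> complex) set"
    and \<rho> :: "('x \<Rightarrow> complex) \<Rightarrow> 'v \<Rightarrow> 'v"
  assumes hilbert_H: "hilbert_space H"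
    and algebra_subspace: "complex_vector.subspace \<AA>"
    and algebra_mult: "\<And>f g. f \<in> \<AA> \<Longrightarrow> g \<in> \<AA> \<Longrightarrow> f * g \<in> \<AA>"
    and algebra_one: "1 \<in> \<AA>"
    and mult_op_bounded: "\<And>f. f \<in> \<AA> \<Longrightarrow> mult_op H f \<in> bounded_ops H"
    and act_bounded: "\<And>f. f \<in> \<AA> \<Longrightarrow> \<rho> f \<in> bounded_ops K"
    and act_add: "\<And>f g x. f \<in> \<AA> \<Longrightarrow> g \<in> \<AA> \<Longrightarrow> x \<in> vecs K \<Longrightarrow> \<rho> (f + g) x = \<rho> f x + \<rho> g x"
    and act_scaleC: "\<And>c f x. f \<in> \<AA> \<Longrightarrow> x \<in> vecs K \<Longrightarrow> \<rho> (c *\<^sub>C f) x = c *\<^sub>C \<rho> f x"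
    and act_mult: "\<And>f g x. f \<in> \<AA> \<Longrightarrow> g \<in> \<AA> \<Longrightarrow> x \<in> vecs K \<Longrightarrow> \<rho> (f * g) x = \<rho> f (\<rho> g x)"
    and act_one: "\<And>x. x \<in> vecs K \<Longrightarrow> \<rho> 1 x = x"
    and act_norm: "\<And>r F X. F \<in> mats r \<AA> \<Longrightarrow> X \<in> vecs (direct_sum K (enat r)) \<Longrightarrow>
      hnorm (direct_sum K (enat r)) (mat_op K r (\<lambda>i j. \<rho> (F i j)) X)
        \<le> mult_norm H r F * hnorm (direct_sum K (enat r)) X"
begin

abbreviation "act_mat r F \<equiv> mat_op K r (\<lambda>i j. \<rho> (F i j))"
abbreviation "\<J> E \<equiv> vanishing_ideal \<AA> E"

definition compression ::
    "nat \<Rightarrow> (nat \<Rightarrow> nat \<Rightarrow> 'x \<Rightarrow> complex) \<Rightarrow> 'v set \<Rightarrow> (nat \<Rightarrow> 'v) \<Rightarrow> nat \<Rightarrow> 'v" where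
  "compression r F N = ampl K (enat r) (orth_proj K N) \<circ> act_mat r F \<circ> ampl K (enat r) (orth_proj K N)"

lemma ideal_subset: "g \<in> \<J> E \<Longrightarrow> g \<in> \<AA>"
  by (simp add: vanishing_ideal_def)

lemma ideal_mats: "G \<in> mats r (\<J> E) \<Longrightarrow> G \<in> mats r \<AA>"
  by (simp add: mats_def vanishing_ideal_def)

lemma ideal_mult: "f \<in> \<AA> \<Longrightarrow> g \<in> \<J> E \<Longrightarrow> f * g \<in> \<J> E" "f \<in> \<AA> \<Longrightarrow> g \<in> \<J> E \<Longrightarrow> g * f \<in> \<J> E"
  by (simp_all add: vanishing_ideal_def algebra_mult)

lemma ideal_zero: "0 \<in> \<J> E"
  using complex_vector.subspace_0[OF algebra_subspace] by (simp add: vanishing_ideal_def)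

lemma act_vecs [simp]: "f \<in> \<AA> \<Longrightarrow> x \<in> vecs K \<Longrightarrow> \<rho> f x \<in> vecs K"
  using act_bounded by simp

lemma act_zero: "x \<in> vecs K \<Longrightarrow> \<rho> 0 x = 0"
  using act_scaleC[OF algebra_one, of x 0] by simp

lemma act_diff:
  assumes "f \<in> \<AA>" "g \<in> \<AA>" "x \<in> vecs K"
  shows "\<rho> (f - g) x = \<rho> f x - \<rho> g x"
proof -
  have "\<rho> ((f - g) + g) x = \<rho> (f - g) x + \<rho> g x"
    by (intro act_add assms complex_vector.subspace_diff[OF algebra_subspace])
  then show ?thesis by simp
qed

lemma act_mat_bounded_op: "F \<in> mats r \<AA> \<Longrightarrow> act_mat r F \<in> bounded_ops (direct_sum K (enat r))"
  by (rule mat_op_bounded_op) (simp add: mats_def act_bounded)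

lemma inner_act_mat:
  assumes F: "F \<in> mats r \<AA>" and X: "X \<in> vecs (direct_sum K (enat r))" and Y: "Y \<in> vecs (direct_sum K (enat r))"
  shows "hinner (direct_sum K (enat r)) (act_mat r F X) Y = (\<Sum>i<r. \<Sum>j<r. hinner K (\<rho> (F i j) (X j)) (Y i))"
proof -
  interpret D: hilbert_space "direct_sum K (enat r)" by (rule hilbert_space_direct_sum)
  have "hinner (direct_sum K (enat r)) (act_mat r F X) Y = (\<Sum>i<r. hinner K (act_mat r F X i) (Y i))"
    by (rule fin_dsum_inner[OF D.op_vecs[OF act_mat_bounded_op[OF F] X] Y])
  also have "\<dots> = (\<Sum>i<r. \<Sum>j<r. hinner K (\<rho> (F i j) (X j)) (Y i))"
  proof (rule sum.cong[OF refl])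
    fix i assume "i \<in> {..<r}"
    then show "hinner K (act_mat r F X i) (Y i) = (\<Sum>j<r. hinner K (\<rho> (F i j) (X j)) (Y i))"
      using F dsum_vecs[OF X] dsum_vecs[OF Y]
      by (simp add: mat_op_apply[OF X] mats_def) (intro inner_sum_left, auto)
  qed
  finally show ?thesis .
qed

lemma N_space_closed:
  assumes "L \<in> Lat K (\<rho> ` \<AA>)"
  shows "closed_subspace K (N_space K \<rho> (\<J> E) L)" "N_space K \<rho> (\<J> E) L \<subseteq> L" "L \<subseteq> vecs K"
proof -
  have L: "closed_subspace K L" using assms by (simp add: Lat_def)
  then show LK: "L \<subseteq> vecs K" by (simp add: closed_subspace_def)
  show "closed_subspace K (N_space K \<rho> (\<J> E) L)"
    unfolding N_space_def using LK by (intro closed_subspace_ominus L) (auto simp: ideal_subset)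
  show "N_space K \<rho> (\<J> E) L \<subseteq> L" by (auto simp: N_space_def ominus_def)
qed

lemma compression_bounded_op:
  assumes F: "F \<in> mats r \<AA>" and N: "closed_subspace K N"
  shows "compression r F N \<in> bounded_ops (direct_sum K (enat r))"
proof -
  interpret D: hilbert_space "direct_sum K (enat r)" by (rule hilbert_space_direct_sum)
  show ?thesis
    unfolding compression_def
    by (intro D.op_comp ampl_bounded_op orth_proj_bounded_op N act_mat_bounded_op F)
qed

text \<open>
  For \<open>g\<close> in the ideal and \<open>n\<close> in \<open>N\<close>, the vector \<open>\<rho> g n\<close> lies in the range that \<open>N\<close> is orthogonal
  to by definition. Hence \<open>G\<close> is compressed to zero and \<open>F\<close> may be replaced by \<open>F - G\<close>.
\<close>

lemma compression_le:
  assumes F: "F \<in> mats r \<AA>" and G: "G \<in> mats r (\<J> E)" and L: "L \<in> Lat K (\<rho> ` \<AA>)"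
  shows "opnorm (direct_sum K (enat r)) (compression r F (N_space K \<rho> (\<J> E) L)) \<le> mult_norm H r (F - G)"
proof -
  let ?D = "direct_sum K (enat r)"
  interpret D: hilbert_space ?D by (rule hilbert_space_direct_sum)
  interpret H: hilbert_space H by (rule hilbert_H)
  interpret HD: hilbert_space "direct_sum H (enat r)" by (rule H.hilbert_space_direct_sum)
  define N where "N = N_space K \<rho> (\<J> E) L"
  note N = N_space_closed(1,2)[OF L, of E, folded N_def] N_space_closed(3)[OF L]
  define P where "P = ampl K (enat r) (orth_proj K N)"
  have Pop: "P \<in> bounded_ops ?D" unfolding P_def by (intro ampl_bounded_op orth_proj_bounded_op N)
  have P_apply: "P X = (\<lambda>i. orth_proj K N (X i))" if "X \<in> vecs ?D" for X
    unfolding P_def using that op_zero[OF orth_proj_bounded_op[OF N(1)]] by (rule ampl_apply)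
  have P_norm: "hnorm ?D (P X) \<le> hnorm ?D X" if X: "X \<in> vecs ?D" for X
  proof -
    have "hnorm ?D (P X) \<le> 1 * hnorm ?D X"
    proof (rule dsum_dominated(2)[OF X])
      have PX: "P X \<in> vecs ?D" using Pop X by simp
      show "P X i \<in> vecs K" "\<not> enat i < enat r \<Longrightarrow> P X i = 0" for i
        using dsum_vecs[OF PX] dsum_off[OF PX] by auto
      show "hnorm K (P X i) \<le> 1 * hnorm K (X i)" for i
        using hnorm_orth_proj_le[OF N(1) dsum_vecs[OF X]] by (simp add: P_apply[OF X])
    qed simp
    then show ?thesis by simp
  qed
  have GA: "G \<in> mats r \<AA>" using G by (rule ideal_mats)
  have FG: "F - G \<in> mats r \<AA>"
    using F GA complex_vector.subspace_diff[OF algebra_subspace] by (simp add: mats_def)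
  have compress_ideal: "orth_proj K N (\<rho> g n) = 0" if g: "g \<in> \<J> E" and n: "n \<in> N" for g n
  proof (rule orth_proj_unique[OF N(1)])
    have nK: "n \<in> vecs K" "n \<in> L" using n N by auto
    show "\<rho> g n \<in> vecs K" using g nK by (simp add: ideal_subset)
    show "0 \<in> N" using N(1) complex_vector.subspace_0 by (auto simp: closed_subspace_def)
    fix n' assume n': "n' \<in> N"
    then have "hinner K n' (\<rho> g n) = 0"
      using g nK unfolding N_def N_space_def ominus_def by blast
    moreover have "n' \<in> vecs K" using n' N by blast
    ultimately show "hinner K (\<rho> g n - 0) n' = 0"
      using inner_commute[of "\<rho> g n" n'] g nK by (simp add: ideal_subset)
  qed
  have "mult_norm H r (F - G) \<ge> 0"
    unfolding mult_norm_def
    by (intro HD.opnorm_nonneg H.mat_op_bounded_op mult_op_bounded) (use FG in \<open>auto simp: mats_def\<close>)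
  moreover have "hnorm ?D (compression r F N X) \<le> mult_norm H r (F - G) * hnorm ?D X" if X: "X \<in> vecs ?D" for X
  proof -
    have PX: "P X \<in> vecs ?D" using Pop X by simp
    have PXN: "P X j \<in> N" for j unfolding P_apply[OF X] by (intro orth_proj_in N dsum_vecs[OF X])
    have "P (act_mat r G (P X)) = 0"
    proof
      fix i
      have "orth_proj K N (act_mat r G (P X) i) = 0"
      proof (cases "i < r")
        case True
        have "orth_proj K N (act_mat r G (P X) i) = orth_proj K N (\<Sum>j<r. \<rho> (G i j) (P X j))"
          using True by (simp add: mat_op_apply[OF PX])
        also have "\<dots> = (\<Sum>j<r. orth_proj K N (\<rho> (G i j) (P X j)))"
          using GA True dsum_vecs[OF PX] by (intro op_sum orth_proj_bounded_op N) (auto simp: mats_def)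
        also have "\<dots> = 0"
          using G True PXN by (intro sum.neutral ballI compress_ideal) (auto simp: mats_def)
        finally show ?thesis .
      qed (simp add: mat_op_apply[OF PX] op_zero[OF orth_proj_bounded_op[OF N(1)]])
      then show "P (act_mat r G (P X)) i = 0 i"
        by (simp add: P_apply[OF D.op_vecs[OF act_mat_bounded_op[OF GA] PX]])
    qed
    moreover have "act_mat r (F - G) (P X) = act_mat r F (P X) - act_mat r G (P X)"
      unfolding mat_op_apply[OF PX]
      using F GA dsum_vecs[OF PX] by (auto simp: fun_eq_iff mats_def act_diff sum_subtractf)
    ultimately have "compression r F N X = P (act_mat r (F - G) (P X))"
      using D.op_diff[OF Pop D.op_vecs[OF act_mat_bounded_op[OF F] PX] D.op_vecs[OF act_mat_bounded_op[OF GA] PX]]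
      by (simp add: compression_def P_def)
    then have "hnorm ?D (compression r F N X) \<le> hnorm ?D (act_mat r (F - G) (P X))"
      using P_norm[OF D.op_vecs[OF act_mat_bounded_op[OF FG] PX]] by simp
    also have "\<dots> \<le> mult_norm H r (F - G) * hnorm ?D (P X)" by (rule act_norm[OF FG PX])
    also have "\<dots> \<le> mult_norm H r (F - G) * hnorm ?D X"
      using P_norm[OF X] \<open>mult_norm H r (F - G) \<ge> 0\<close> by (rule mult_left_mono)
    finally show ?thesis .
  qed
  ultimately show ?thesis unfolding N_def[symmetric] by (intro D.opnorm_le) auto
qed

text \<open>
  As an intersection it is closed without any closure being taken, and a property of its elements can
  be proved by showing that the vectors with the property form an invariant subspace.
\<close>

definition generated_subspace :: "'v set \<Rightarrow> 'v set" where
  "generated_subspace S = \<Inter> {L \<in> Lat K (\<rho> ` \<AA>). S \<subseteq> L}"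

lemma generated_subspace:
  assumes S: "S \<subseteq> vecs K"
  shows "generated_subspace S \<in> Lat K (\<rho> ` \<AA>)" "S \<subseteq> generated_subspace S"
    and "\<And>L. L \<in> Lat K (\<rho> ` \<AA>) \<Longrightarrow> S \<subseteq> L \<Longrightarrow> generated_subspace S \<subseteq> L"
proof -
  have top: "vecs K \<in> Lat K (\<rho> ` \<AA>)" using closed_subspace_vecs_self by (auto simp: Lat_def)
  show "S \<subseteq> generated_subspace S" by (auto simp: generated_subspace_def)
  show "\<And>L. L \<in> Lat K (\<rho> ` \<AA>) \<Longrightarrow> S \<subseteq> L \<Longrightarrow> generated_subspace S \<subseteq> L"
    by (auto simp: generated_subspace_def)
  have "closed_subspace K (generated_subspace S)"
    unfolding closed_subspace_def
  proof (intro conjI allI impI)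
    show "complex_vector.subspace (generated_subspace S)"
      unfolding generated_subspace_def
      by (rule complex_vector.subspace_Inter) (auto simp: Lat_def closed_subspace_def)
    show "generated_subspace S \<subseteq> vecs K" using top S by (auto simp: generated_subspace_def)
    fix u l assume u: "(\<forall>n. u n \<in> generated_subspace S) \<and> l \<in> vecs K \<and> (\<lambda>n. hnorm K (u n - l)) \<longlonglongrightarrow> 0"
    show "l \<in> generated_subspace S"
      unfolding generated_subspace_def
    proof
      fix L assume "L \<in> {L \<in> Lat K (\<rho> ` \<AA>). S \<subseteq> L}"
      then have "closed_subspace K L" "\<forall>n. u n \<in> L" using u by (auto simp: Lat_def generated_subspace_def)
      then show "l \<in> L" using u unfolding closed_subspace_def by blast
    qed
  qed
  then show "generated_subspace S \<in> Lat K (\<rho> ` \<AA>)"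
    unfolding Lat_def generated_subspace_def by auto
qed

text \<open>
  The subspace \<open>L\<close> is generated by the components of \<open>X\<close>. Replacing the components of \<open>Y\<close> by their
  projections to \<open>L\<close>, and those of \<open>X\<close> by their projections to \<open>N\<close>, keeps the inner product, because
  the former projections lie in \<open>N\<close>.
\<close>

lemma compression_ge:
  assumes F: "F \<in> mats r \<AA>" and X: "X \<in> vecs (direct_sum K (enat r))" and Y: "Y \<in> vecs (direct_sum K (enat r))"
    and ann: "\<And>G. G \<in> mats r (\<J> E) \<Longrightarrow> hinner (direct_sum K (enat r)) (act_mat r G X) Y = 0"
  shows "\<exists>L\<in>Lat K (\<rho> ` \<AA>). cmod (hinner (direct_sum K (enat r)) (act_mat r F X) Y) \<le>
    opnorm (direct_sum K (enat r)) (compression r F (N_space K \<rho> (\<J> E) L)) *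
      (hnorm (direct_sum K (enat r)) X * hnorm (direct_sum K (enat r)) Y)"
proof -
  let ?D = "direct_sum K (enat r)"
  interpret D: hilbert_space ?D by (rule hilbert_space_direct_sum)
  have XK [simp]: "X j \<in> vecs K" and YK [simp]: "Y j \<in> vecs K" for j using dsum_vecs[OF X] dsum_vecs[OF Y] by auto
  have ann1: "hinner K (\<rho> g (X j)) (Y i) = 0" if g: "g \<in> \<J> E" and ij: "i < r" "j < r" for g i j
  proof -
    \<comment> \<open>Test against the matrix whose only nonzero entry is \<open>g\<close>.\<close>
    define G where "G = (\<lambda>i' j'. if i' = i \<and> j' = j then g else 0)"
    have G: "G \<in> mats r (\<J> E)" using g ideal_zero by (auto simp: mats_def G_def)
    then have GA: "G \<in> mats r \<AA>" by (rule ideal_mats)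
    have e: "hinner K (\<rho> (G i' j') (X j')) (Y i') = (if j' = j then if i' = i then hinner K (\<rho> g (X j)) (Y i) else 0 else 0)" for i' j'
      by (auto simp: G_def act_zero)
    show ?thesis using ann[OF G] ij unfolding inner_act_mat[OF GA X Y] e by simp
  qed
  define L where "L = generated_subspace (range X)"
  have "range X \<subseteq> vecs K" by auto
  note L = generated_subspace[OF this, folded L_def]
  have closed: "closed_subspace K L" and inv: "\<And>f z. f \<in> \<AA> \<Longrightarrow> z \<in> L \<Longrightarrow> \<rho> f z \<in> L"
    using L(1) by (auto simp: Lat_def)
  define N where "N = N_space K \<rho> (\<J> E) L"
  note N = N_space_closed(1,2)[OF L(1), of E, folded N_def] N_space_closed(3)[OF L(1)]
  \<comment> \<open>The vectors that the ideal maps to the orthogonal complement of \<open>Y i\<close> form a closed invariant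
    subspace. It contains every \<open>X j\<close> and hence \<open>L\<close>.\<close>
  have perp: "hinner K (\<rho> g z) (Y i) = 0" if g: "g \<in> \<J> E" and z: "z \<in> L" and i: "i < r" for g z i
  proof -
    define M where "M = {z \<in> vecs K. \<forall>g\<in>\<J> E. hinner K (\<rho> g z) (Y i) = 0}"
    have "closed_subspace K M"
      unfolding closed_subspace_def
    proof (intro conjI allI impI)
      show "complex_vector.subspace M"
        by (rule complex_vector.subspaceI)
          (auto simp: M_def ideal_subset op_add[OF act_bounded] op_scaleC[OF act_bounded] op_zero[OF act_bounded] inner_simps)
      show "M \<subseteq> vecs K" by (auto simp: M_def)
      fix u l assume u: "(\<forall>n. u n \<in> M) \<and> l \<in> vecs K \<and> (\<lambda>n. hnorm K (u n - l)) \<longlonglongrightarrow> 0"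
      have "hinner K (\<rho> g l) (Y i) = 0" if g: "g \<in> \<J> E" for g
      proof -
        obtain w where w: "w \<in> vecs K" "\<forall>x\<in>vecs K. hinner K (\<rho> g x) (Y i) = hinner K x w"
          using adjoint_vector[OF act_bounded[OF ideal_subset[OF g]] YK] by blast
        have "(\<lambda>n. hinner K (u n) w) \<longlonglongrightarrow> hinner K l w"
          by (rule tendsto_inner_left) (use u w in \<open>auto simp: M_def\<close>)
        moreover have "hinner K (u n) w = 0" for n
        proof -
          have "u n \<in> vecs K" "hinner K (\<rho> g (u n)) (Y i) = 0" using u g by (auto simp: M_def)
          then show ?thesis using w by simp
        qed
        ultimately show ?thesis using w u by (simp add: LIMSEQ_const_iff)
      qed
      then show "l \<in> M" using u by (simp add: M_def)
    qed
    moreover have "\<rho> f z \<in> M" if f: "f \<in> \<AA>" and z: "z \<in> M" for f z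
    proof -
      have "hinner K (\<rho> g (\<rho> f z)) (Y i) = 0" if g: "g \<in> \<J> E" for g
      proof -
        have "\<rho> g (\<rho> f z) = \<rho> (g * f) z" using act_mult[OF ideal_subset[OF g] f] z by (simp add: M_def)
        then show ?thesis using z ideal_mult(2)[OF f g] by (simp add: M_def)
      qed
      then show ?thesis using f z by (simp add: M_def)
    qed
    ultimately have M: "M \<in> Lat K (\<rho> ` \<AA>)" by (auto simp: Lat_def)
    have "X j \<in> M" for j
    proof (cases "j < r")
      case False
      then have "X j = 0" using X by (simp add: fin_dsum_mem)
      then show ?thesis by (simp add: M_def op_zero[OF act_bounded[OF ideal_subset]])
    qed (use ann1 i in \<open>simp add: M_def\<close>)
    then have "L \<subseteq> M" using L(3)[OF M] by blast
    then show ?thesis using g z by (auto simp: M_def)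
  qed
  define y where "y i = orth_proj K L (Y i)" for i
  have yL: "y i \<in> L" for i unfolding y_def by (rule orth_proj_in[OF closed YK])
  then have yK [simp]: "y i \<in> vecs K" for i using N(3) by auto
  have yY: "hinner K z (y i) = hinner K z (Y i)" if "z \<in> L" for z i
    unfolding y_def by (rule inner_orth_proj(2)[OF closed YK that])
  have yN: "y i \<in> N" if i: "i < r" for i
  proof -
    have "hinner K (y i) (\<rho> g z) = 0" if g: "g \<in> \<J> E" and z: "z \<in> L" for g z
    proof -
      have "hinner K (\<rho> g z) (y i) = 0"
        using perp[OF g z i] yY inv[OF ideal_subset[OF g] z] by simp
      then show ?thesis
        using inner_commute[of "y i" "\<rho> g z"] g z N(3) by (auto simp: ideal_subset)
    qed
    then show ?thesis using yL by (auto simp: N_def N_space_def ominus_def)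
  qed
  have yD: "y \<in> vecs ?D" unfolding fin_dsum_mem
  proof (intro conjI allI impI)
    fix i assume "i \<ge> r"
    then have "Y i = 0" using Y by (simp add: fin_dsum_mem)
    then show "y i = 0" using op_zero[OF orth_proj_bounded_op[OF closed]] by (simp add: y_def)
  qed simp
  have y_norm: "hnorm ?D y \<le> hnorm ?D Y"
  proof -
    have "hnorm ?D y \<le> 1 * hnorm ?D Y"
      by (rule dsum_dominated(2)[OF Y])
        (use dsum_off[OF yD] hnorm_orth_proj_le[OF closed YK] in \<open>auto simp: y_def[symmetric]\<close>)
    then show ?thesis by simp
  qed
  define x where "x i = orth_proj K N (X i)" for i
  have xN: "x i \<in> N" for i unfolding x_def by (rule orth_proj_in[OF N(1) XK])
  then have xL: "x i \<in> L" and xK [simp]: "x i \<in> vecs K" for i using N by auto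
  have x_eq: "ampl K (enat r) (orth_proj K N) X = x"
    using ampl_apply[where T = "orth_proj K N", OF X op_zero[OF orth_proj_bounded_op[OF N(1)]]] by (simp add: x_def[abs_def])
  have xD: "x \<in> vecs ?D"
    using D.op_vecs[OF ampl_bounded_op[OF orth_proj_bounded_op[OF N(1)]] X] unfolding x_eq .
  \<comment> \<open>The compression to \<open>L\<close> of the adjoint of \<open>\<rho> f\<close> maps \<open>N\<close> into itself, so that replacing
    \<open>X j\<close> by its component in \<open>N\<close> does not change the inner products with \<open>N\<close>.\<close>
  have replace: "hinner K (\<rho> f (X j)) (y i) = hinner K (\<rho> f (x j)) (y i)"
    if f: "f \<in> \<AA>" and i: "i < r" for f i j
  proof -
    obtain w0 where w0: "w0 \<in> vecs K" "\<forall>x\<in>vecs K. hinner K (\<rho> f x) (y i) = hinner K x w0"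
      using adjoint_vector[OF act_bounded[OF f] yK] by blast
    define w where "w = orth_proj K L w0"
    have wL: "w \<in> L" unfolding w_def by (rule orth_proj_in[OF closed w0(1)])
    have w: "hinner K (\<rho> f z) (y i) = hinner K z w" if z: "z \<in> L" for z
      unfolding w_def inner_orth_proj(2)[OF closed w0(1) z] using w0 z N(3) by blast
    have wK: "w \<in> vecs K" using wL N by auto
    have "hinner K w (\<rho> g z) = 0" if g: "g \<in> \<J> E" and z: "z \<in> L" for g z
    proof -
      have zK: "z \<in> vecs K" using z N by auto
      have "hinner K (\<rho> g z) w = hinner K (\<rho> f (\<rho> g z)) (y i)"
        using w inv[OF ideal_subset[OF g] z] by simp
      also have "\<dots> = hinner K (\<rho> (f * g) z) (y i)" using act_mult[OF f ideal_subset[OF g] zK] by simp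
      also have "\<dots> = hinner K (\<rho> (f * g) z) (Y i)"
        using yY inv[OF ideal_subset[OF ideal_mult(1)[OF f g]] z] by simp
      also have "\<dots> = 0" using perp[OF ideal_mult(1)[OF f g] z i] .
      finally show ?thesis using inner_commute[of w "\<rho> g z"] wK zK g by (simp add: ideal_subset)
    qed
    then have wN: "w \<in> N" using wL by (auto simp: N_def N_space_def ominus_def)
    have XL: "X j \<in> L" using L(2) by auto
    have "hinner K (x j) w = hinner K (X j) w" unfolding x_def by (rule inner_orth_proj(1)[OF N(1) XK wN])
    then show ?thesis unfolding w[OF XL] w[OF xL] by simp
  qed
  have Fij: "F i j \<in> \<AA>" if "i < r" "j < r" for i j using F that by (simp add: mats_def)
  have "hinner ?D (compression r F N X) y = hinner ?D (ampl K (enat r) (orth_proj K N) (act_mat r F x)) y"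
    by (simp add: compression_def x_eq)
  also have "\<dots> = (\<Sum>i<r. hinner K (orth_proj K N (act_mat r F x i)) (y i))"
    unfolding ampl_apply[where T = "orth_proj K N", OF D.op_vecs[OF act_mat_bounded_op[OF F] xD] op_zero[OF orth_proj_bounded_op[OF N(1)]]]
    by (rule fin_dsum_inner[OF ampl_mem[OF orth_proj_bounded_op[OF N(1)]
          D.op_vecs[OF act_mat_bounded_op[OF F] xD]] yD])
  also have "\<dots> = (\<Sum>i<r. hinner K (act_mat r F x i) (y i))"
    using dsum_vecs[OF D.op_vecs[OF act_mat_bounded_op[OF F] xD]] yN
    by (intro sum.cong refl inner_orth_proj(1)[OF N(1)]) auto
  also have "\<dots> = hinner ?D (act_mat r F x) y"
    by (rule fin_dsum_inner[OF D.op_vecs[OF act_mat_bounded_op[OF F] xD] yD, symmetric])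
  also have "\<dots> = (\<Sum>i<r. \<Sum>j<r. hinner K (\<rho> (F i j) (x j)) (y i))" by (rule inner_act_mat[OF F xD yD])
  also have "\<dots> = (\<Sum>i<r. \<Sum>j<r. hinner K (\<rho> (F i j) (X j)) (Y i))"
  proof (intro sum.cong refl)
    fix i j assume "i \<in> {..<r}" "j \<in> {..<r}"
    then have ij: "i < r" "j < r" by auto
    have "\<rho> (F i j) (X j) \<in> L" using inv[OF Fij[OF ij]] L(2) by auto
    then show "hinner K (\<rho> (F i j) (x j)) (y i) = hinner K (\<rho> (F i j) (X j)) (Y i)"
      unfolding replace[OF Fij[OF ij] ij(1), symmetric] by (rule yY)
  qed
  also have "\<dots> = hinner ?D (act_mat r F X) Y" by (rule inner_act_mat[OF F X Y, symmetric])
  finally have eq: "hinner ?D (compression r F N X) y = hinner ?D (act_mat r F X) Y" .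
  note cb = compression_bounded_op[OF F N(1)]
  have "cmod (hinner ?D (act_mat r F X) Y) \<le> hnorm ?D (compression r F N X) * hnorm ?D y"
    unfolding eq[symmetric] by (rule D.Cauchy_Schwarz[OF D.op_vecs[OF cb X] yD])
  also have "\<dots> \<le> (opnorm ?D (compression r F N) * hnorm ?D X) * hnorm ?D Y"
    using X yD D.opnorm_nonneg[OF cb] by (intro mult_mono D.hnorm_le_opnorm[OF cb] y_norm) auto
  finally show ?thesis using L(1) unfolding N_def by (auto simp: mult.assoc)
qed

text \<open>
  If the supremum of the norms of the compressions were smaller than the distance, the vectors for a
  number \<open>c\<close> strictly between the two would contradict \<open>compression_ge\<close>.
\<close>

theorem NP_family_if_vector_functionals:
  assumes ex: "\<And>E F c. F \<in> mats r \<AA> \<Longrightarrow> 0 < c \<Longrightarrow> c < mult_dist H r F (mats r (\<J> E)) \<Longrightarrow>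
    \<exists>X\<in>vecs (direct_sum K (enat r)). \<exists>Y\<in>vecs (direct_sum K (enat r)).
      (\<forall>G\<in>mats r (\<J> E). hinner (direct_sum K (enat r)) (act_mat r G X) Y = 0) \<and>
      c * (hnorm (direct_sum K (enat r)) X * hnorm (direct_sum K (enat r)) Y)
        < cmod (hinner (direct_sum K (enat r)) (act_mat r F X) Y)"
  shows "NP_family_for H \<AA> r K \<rho>"
proof -
  let ?D = "direct_sum K (enat r)"
  interpret D: hilbert_space ?D by (rule hilbert_space_direct_sum)
  have "mult_dist H r F (mats r (\<J> E)) =
      (SUP L\<in>Lat K (\<rho> ` \<AA>). opnorm ?D (compression r F (N_space K \<rho> (\<J> E) L)))" (is "?d = ?s")
    if F: "F \<in> mats r \<AA>" for E F
  proof -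
    define q where "q L = opnorm ?D (compression r F (N_space K \<rho> (\<J> E) L))" for L
    have zero: "0 \<in> mats r (\<J> E)" using ideal_zero by (simp add: mats_def)
    have top: "vecs K \<in> Lat K (\<rho> ` \<AA>)" using closed_subspace_vecs_self by (auto simp: Lat_def)
    have le: "q L \<le> mult_norm H r (F - G)" if "L \<in> Lat K (\<rho> ` \<AA>)" "G \<in> mats r (\<J> E)" for L G
      unfolding q_def using compression_le[OF F that(2,1)] .
    have q_le: "q L \<le> ?s" if "L \<in> Lat K (\<rho> ` \<AA>)" for L
      unfolding q_def[symmetric]
      by (rule cSUP_upper[OF that bdd_aboveI2]) (rule le[OF _ zero])
    have "?s \<le> ?d"
      unfolding mult_dist_def q_def[symmetric]
      using zero top le by (intro cINF_greatest cSUP_least) auto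
    moreover have "\<not> ?s < ?d"
    proof
      assume less: "?s < ?d"
      have "0 \<le> q (vecs K)"
        unfolding q_def by (intro D.opnorm_nonneg compression_bounded_op F N_space_closed top)
      then have s0: "0 \<le> ?s" using q_le[OF top] by linarith
      define c where "c = (?s + ?d) / 2"
      have c: "0 < c" "c < ?d" "?s < c" using less s0 by (auto simp: c_def)
      obtain X Y where X: "X \<in> vecs ?D" and Y: "Y \<in> vecs ?D"
        and ann: "\<And>G. G \<in> mats r (\<J> E) \<Longrightarrow> hinner ?D (act_mat r G X) Y = 0"
        and big: "c * (hnorm ?D X * hnorm ?D Y) < cmod (hinner ?D (act_mat r F X) Y)"
        using ex[OF F c(1,2)] by blast
      obtain L where L: "L \<in> Lat K (\<rho> ` \<AA>)"
        and "cmod (hinner ?D (act_mat r F X) Y) \<le> q L * (hnorm ?D X * hnorm ?D Y)"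
        using compression_ge[OF F X Y ann] unfolding q_def by blast
      moreover have "q L * (hnorm ?D X * hnorm ?D Y) \<le> c * (hnorm ?D X * hnorm ?D Y)"
        using q_le[OF L] c X Y by (intro mult_right_mono) auto
      ultimately show False using big by linarith
    qed
    ultimately show ?thesis by linarith
  qed
  then show ?thesis unfolding NP_family_for_def Let_def compression_def by blast
qed

end

section \<open>Distance duality for multipliers\<close>

definition entry_op ::
    "'v::complex_vector hspace \<Rightarrow> ((nat \<Rightarrow> 'v) \<Rightarrow> nat \<Rightarrow> 'v) \<Rightarrow> nat \<Rightarrow> nat \<Rightarrow> 'v \<Rightarrow> 'v" where
  "entry_op K T i j h = (if h \<in> vecs K then T (at_slot j h) i else 0)"

context hilbert_space
begin

lemma entry_op_bounded_op:
  assumes T: "T \<in> bounded_ops (direct_sum K (enat r))" and j: "j < r"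
  shows "entry_op K T i j \<in> bounded_ops K"
proof -
  let ?D = "direct_sum K (enat r)"
  interpret D: hilbert_space ?D by (rule hilbert_space_direct_sum)
  obtain C where C: "C \<ge> 0" "\<forall>x\<in>vecs ?D. hnorm ?D (T x) \<le> C * hnorm ?D x" using D.op_bound[OF T] by blast
  have slot: "at_slot j h \<in> vecs ?D" if "h \<in> vecs K" for h using that j by (intro at_slot_mem) auto
  have Tv: "T (at_slot j h) i \<in> vecs K" if "h \<in> vecs K" for h
    by (rule dsum_vecs[OF D.op_vecs[OF T slot[OF that]]])
  show ?thesis
  proof (rule bounded_opsI)
    fix h assume h: "h \<in> vecs K"
    have "hnorm K (T (at_slot j h) i) \<le> hnorm ?D (T (at_slot j h))"
      by (rule dsum_hnorm_coord_le[OF D.op_vecs[OF T slot[OF h]]])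
    also have "\<dots> \<le> C * hnorm ?D (at_slot j h)" using C(2) slot[OF h] by blast
    also have "hnorm ?D (at_slot j h) = hnorm K h" using j h by (intro hnorm_at_slot) auto
    finally show "hnorm K (entry_op K T i j h) \<le> C * hnorm K h" using h by (simp add: entry_op_def)
  qed (simp_all add: entry_op_def Tv at_slot_add at_slot_scaleC D.op_add[OF T] D.op_scaleC[OF T] slot scaleC_apply)
qed

lemma mat_op_entry_op:
  assumes T: "T \<in> bounded_ops (direct_sum K (enat r))"
  shows "mat_op K r (entry_op K T) = T"
proof
  fix x
  let ?D = "direct_sum K (enat r)"
  interpret D: hilbert_space ?D by (rule hilbert_space_direct_sum)
  show "mat_op K r (entry_op K T) x = T x"
  proof (cases "x \<in> vecs ?D")
    case False then show ?thesis using D.op_off[OF T] by (simp add: mat_op_def)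
  next
    case True
    have slot: "at_slot j (x j) \<in> vecs ?D" if "j < r" for j
      using that dsum_vecs[OF True] by (intro at_slot_mem) auto
    have "x = (\<Sum>j<r. at_slot j (x j))"
      using True by (auto simp: fun_eq_iff sum_fun_apply at_slot_def fin_dsum_mem)
    then have "T x = (\<Sum>j<r. T (at_slot j (x j)))"
      using D.op_sum[OF T, of "{..<r}" "\<lambda>j. at_slot j (x j)"] slot by simp
    moreover have "T x i = 0" if "\<not> i < r" for i
      using D.op_vecs[OF T True] that by (simp add: fin_dsum_mem)
    ultimately show ?thesis
      using dsum_vecs[OF True] by (auto simp: mat_op_apply[OF True] fun_eq_iff sum_fun_apply entry_op_def)
  qed
qed

lemma entry_op_mat_op:
  assumes T: "\<And>i j. i < r \<Longrightarrow> j < r \<Longrightarrow> T i j \<in> bounded_ops K" and ij: "i < r" "j < r"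
  shows "entry_op K (mat_op K r T) i j = T i j"
proof
  fix h
  show "entry_op K (mat_op K r T) i j h = T i j h"
  proof (cases "h \<in> vecs K")
    case True
    have "at_slot j h \<in> vecs (direct_sum K (enat r))" using True ij by (intro at_slot_mem) auto
    moreover have "(\<Sum>j'<r. T i j' (at_slot j h j')) = (\<Sum>j'<r. if j' = j then T i j h else 0)"
      using ij T by (intro sum.cong) (auto simp: at_slot_def)
    ultimately show ?thesis using True ij by (simp add: entry_op_def mat_op_apply)
  qed (use op_off[OF T[OF ij]] in \<open>simp add: entry_op_def\<close>)
qed

lemma lift_seqs:
  assumes x: "x \<in> seqs" and j: "j < r"
  shows "(\<lambda>n. at_slot j (x n)) \<in> vecs (direct_sum (direct_sum K (enat r)) \<infinity>)"
proof -
  interpret D: hilbert_space "direct_sum K (enat r)" by (rule hilbert_space_direct_sum)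
  show ?thesis
    using dsum_summable[OF x] j dsum_vecs[OF x] by (simp add: D.dsum_mem at_slot_mem hnorm_at_slot)
qed

text \<open>
  Functionals on operators of \<open>K\<close> become functionals on operators of \<open>K\<^sup>r\<close> by reading off one entry.
  This reduces questions about matrices to their entries, where weak-* closedness is given.
\<close>

lemma pairing_entry_op:
  assumes T: "T \<in> bounded_ops (direct_sum K (enat r))" and ij: "i < r" "j < r"
    and x: "x \<in> seqs" and y: "y \<in> seqs"
  shows "pairing (direct_sum K (enat r)) (\<lambda>n. at_slot j (x n)) (\<lambda>n. at_slot i (y n)) T =
    pairing K x y (entry_op K T i j)"
proof -
  let ?D = "direct_sum K (enat r)"
  interpret D: hilbert_space ?D by (rule hilbert_space_direct_sum)
  have "hinner ?D (T (at_slot j (x n))) (at_slot i (y n)) = hinner K (entry_op K T i j (x n)) (y n)" for n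
  proof -
    have xn: "at_slot j (x n) \<in> vecs ?D" and yn: "at_slot i (y n) \<in> vecs ?D"
      using ij dsum_vecs[OF x] dsum_vecs[OF y] by (simp_all add: at_slot_mem)
    note Tx = D.op_vecs[OF T xn]
    have "hinner ?D (at_slot i (y n)) (T (at_slot j (x n))) = hinner K (y n) (T (at_slot j (x n)) i)"
      using ij dsum_vecs[OF y] Tx by (intro inner_at_slot) auto
    then have "hinner ?D (T (at_slot j (x n))) (at_slot i (y n)) = hinner K (T (at_slot j (x n)) i) (y n)"
      using D.inner_commute[OF Tx yn] inner_commute[OF dsum_vecs[OF Tx, of i] dsum_vecs[OF y, of n]] by simp
    then show ?thesis using dsum_vecs[OF x] by (simp add: entry_op_def)
  qed
  then have "(\<lambda>n. hinner K (entry_op K T i j (x n)) (y n)) sums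
      pairing ?D (\<lambda>n. at_slot j (x n)) (\<lambda>n. at_slot i (y n)) T"
    using D.pairing_sums[OF T lift_seqs[OF x ij(2)] lift_seqs[OF y ij(1)]] by simp
  then show ?thesis
    using pairing_sums[OF entry_op_bounded_op[OF T ij(2)] x y] sums_unique2 by blast
qed

lemma weak_star_functional_pairing:
  assumes x: "x \<in> seqs" and y: "y \<in> seqs" and B: "\<BB> \<subseteq> bounded_ops K"
  shows "weak_star_functional K \<BB> (pairing K x y)"
  unfolding weak_star_functional_def
proof (intro conjI ballI allI)
  fix S T assume "S \<in> \<BB>" "T \<in> \<BB>"
  then show "pairing K x y (S + T) = pairing K x y S + pairing K x y T"
    using B x y by (intro pairing_op_add) auto
next
  fix c T assume "T \<in> \<BB>"
  then show "pairing K x y (c *\<^sub>C T) = c * pairing K x y T"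
    using B x y by (intro pairing_op_scaleC) auto
next
  have "openin (subtopology (weak_star K) \<BB>) {T \<in> topspace (subtopology (weak_star K) \<BB>). pairing K x y T \<in> U}"
    if U: "open U" for U
  proof -
    have "(\<Sum>n. hinner K (T (x n)) (y n)) = pairing K x y T" if "T \<in> bounded_ops K" for T
      using pairing_sums[OF that x y] sums_unique by metis
    then have "{T \<in> bounded_ops K. pairing K x y T \<in> U} = {T \<in> bounded_ops K. (\<Sum>n. hinner K (T (x n)) (y n)) \<in> U}"
      by auto
    moreover have "openin (weak_star K) {T \<in> bounded_ops K. (\<Sum>n. hinner K (T (x n)) (y n)) \<in> U}"
      unfolding weak_star_def using U x y
      by (intro topology_generated_by_Basis) (auto simp: seqs_eq)
    ultimately have "openin (weak_star K) {T \<in> bounded_ops K. pairing K x y T \<in> U}" by simp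
    moreover have "{T \<in> topspace (subtopology (weak_star K) \<BB>). pairing K x y T \<in> U} =
        {T \<in> bounded_ops K. pairing K x y T \<in> U} \<inter> \<BB>"
      by (auto simp: topspace_weak_star)
    ultimately show ?thesis unfolding openin_subtopology by blast
  qed
  then show "continuous_map (subtopology (weak_star K) \<BB>) euclidean (pairing K x y)"
    by (simp add: continuous_map_def)
qed

text \<open>
  In the picture of sequences of \<open>r\<close>-tuples, a matrix of ampliations acts on each term of the sequence
  by the same matrix.
\<close>

lemma mat_op_ampl_transpose:
  assumes T: "\<And>i j. i < r \<Longrightarrow> j < r \<Longrightarrow> T i j \<in> bounded_ops K"
    and x: "x \<in> vecs (direct_sum (direct_sum K (enat r)) s)"
  shows "mat_op (direct_sum K s) r (\<lambda>i j. ampl K s (T i j)) (transpose_seq x) =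
    transpose_seq (\<lambda>n. mat_op K r T (x n))"
proof (intro ext)
  fix i n
  interpret S: hilbert_space "direct_sum K s" by (rule hilbert_space_direct_sum)
  interpret R: hilbert_space "direct_sum K (enat r)" by (rule hilbert_space_direct_sum)
  note tx = x[unfolded transpose_mem]
  have a: "ampl K s (T i j) (transpose_seq x j) n = T i j (x n j)" if "i < r" "j < r" for j
    using ampl_apply[OF S.dsum_vecs[OF tx], of "T i j" j] op_zero[OF T[OF that]] by (simp add: transpose_seq_def)
  show "mat_op (direct_sum K s) r (\<lambda>i j. ampl K s (T i j)) (transpose_seq x) i n =
      transpose_seq (\<lambda>n. mat_op K r T (x n)) i n"
    unfolding mat_op_apply[OF R.dsum_vecs[OF x]] S.mat_op_apply[OF tx]
    by (auto simp: sum_fun_apply transpose_seq_def a[unfolded transpose_seq_def])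
qed

end

lemma multiplier_action_mult_op:
  assumes H: "hilbert_space H" and sub: "complex_vector.subspace \<AA>"
    and mult: "\<And>f g. f \<in> \<AA> \<Longrightarrow> g \<in> \<AA> \<Longrightarrow> f * g \<in> \<AA>" and one: "1 \<in> \<AA>"
    and bd: "\<And>f. f \<in> \<AA> \<Longrightarrow> mult_op H f \<in> bounded_ops H"
  shows "multiplier_action H H \<AA> (mult_op H)"
proof -
  interpret H: hilbert_space H by (rule H)
  show ?thesis
  proof
    show "mult_op H (f * g) x = mult_op H f (mult_op H g x)" if "f \<in> \<AA>" "g \<in> \<AA>" "x \<in> vecs H" for f g x
    proof -
      have "mult_op H g x \<in> vecs H" using bd[OF that(2)] that(3) by simp
      then show ?thesis using that by (simp add: mult_op_def mult.assoc)
    qed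
    show "hnorm (direct_sum H (enat r)) (mat_op H r (\<lambda>i j. mult_op H (F i j)) X)
        \<le> mult_norm H r F * hnorm (direct_sum H (enat r)) X"
      if "F \<in> mats r \<AA>" "X \<in> vecs (direct_sum H (enat r))" for r F X
    proof -
      interpret D: hilbert_space "direct_sum H (enat r)" by (rule H.hilbert_space_direct_sum)
      show ?thesis unfolding mult_norm_def
        by (rule D.hnorm_le_opnorm[OF H.mat_op_bounded_op that(2)]) (use that bd in \<open>auto simp: mats_def\<close>)
    qed
  qed (use assms in \<open>auto simp: mult_op_def distrib_right scaleC_fun_def scaleC_complex_def fun_eq_iff mult.assoc\<close>)
qed

text \<open>
  Boundedness of multiplication operators comes for free here: a weak-* closed set consists of
  bounded operators.
\<close>

lemma dual_algebra_action:
  assumes "hilbert_space H" "dual_algebra_of_multipliers H \<AA>"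
  shows "multiplier_action H H \<AA> (mult_op H)"
proof (rule multiplier_action_mult_op)
  interpret H: hilbert_space H by fact
  show "mult_op H f \<in> bounded_ops H" if "f \<in> \<AA>" for f
    using assms(2) that closedin_subset H.topspace_weak_star
    unfolding dual_algebra_of_multipliers_def by blast
qed (use assms in \<open>auto simp: dual_algebra_of_multipliers_def\<close>)

text \<open>
  The norm bound holds because, after transposition, the matrix \<open>F\<close> acts separately on the \<open>s\<close>
  terms of a square-summable sequence in \<open>H\<^sup>r\<close>.
\<close>

lemma multiplier_action_ampl:
  assumes "multiplier_action H H \<AA> (mult_op H)"
  shows "multiplier_action (direct_sum H s) H \<AA> (ampl_mult_op H s)"
proof -
  interpret H: multiplier_action H H \<AA> "mult_op H" by fact
  interpret S: hilbert_space "direct_sum H s" by (rule H.hilbert_space_direct_sum)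
  have app: "ampl_mult_op H s f x = (\<lambda>i. mult_op H f (x i))" if "f \<in> \<AA>" "x \<in> vecs (direct_sum H s)" for f x
    unfolding ampl_mult_op_def using H.ampl_apply[where T = "mult_op H f", OF that(2) H.op_zero[OF H.mult_op_bounded[OF that(1)]]] .
  have bd: "ampl_mult_op H s f \<in> bounded_ops (direct_sum H s)" if "f \<in> \<AA>" for f
    unfolding ampl_mult_op_def by (rule H.ampl_bounded_op[OF H.mult_op_bounded[OF that]])
  note v = H.dsum_vecs
  show ?thesis
  proof
    fix f g x assume fg: "f \<in> \<AA>" "g \<in> \<AA>" and x: "x \<in> vecs (direct_sum H s)"
    have fg': "f + g \<in> \<AA>" "f * g \<in> \<AA>"
      using complex_vector.subspace_add[OF H.algebra_subspace] fg H.algebra_mult by auto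
    show "ampl_mult_op H s (f + g) x = ampl_mult_op H s f x + ampl_mult_op H s g x"
      using fg fg' x v[OF x] by (simp add: app H.act_add fun_eq_iff)
    show "ampl_mult_op H s (f * g) x = ampl_mult_op H s f (ampl_mult_op H s g x)"
      using fg fg' x v[OF x] S.op_vecs[OF bd[OF fg(2)] x] by (simp add: app H.act_mult fun_eq_iff)
  next
    fix c f x assume f: "f \<in> \<AA>" and x: "x \<in> vecs (direct_sum H s)"
    have "c *\<^sub>C f \<in> \<AA>" using complex_vector.subspace_scale[OF H.algebra_subspace f] .
    then show "ampl_mult_op H s (c *\<^sub>C f) x = c *\<^sub>C ampl_mult_op H s f x"
      using f x v[OF x] by (simp add: app H.act_scaleC scaleC_fun_def[of c "\<lambda>i. mult_op H f (x i)"])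
  next
    show "ampl_mult_op H s 1 x = x" if "x \<in> vecs (direct_sum H s)" for x
      using that v[OF that] by (simp add: app H.algebra_one H.act_one)
  next
    fix r F X assume F: "F \<in> mats r \<AA>" and X: "X \<in> vecs (direct_sum (direct_sum H s) (enat r))"
    interpret R: hilbert_space "direct_sum H (enat r)" by (rule H.hilbert_space_direct_sum)
    define x where "x = transpose_seq X"
    have Xx: "X = transpose_seq x" by (simp add: x_def transpose_seq_def)
    have x: "x \<in> vecs (direct_sum (direct_sum H (enat r)) s)" using X H.transpose_mem unfolding Xx by blast
    define M where "M = mat_op H r (\<lambda>i j. mult_op H (F i j))"
    have M: "M \<in> bounded_ops (direct_sum H (enat r))" unfolding M_def by (rule H.act_mat_bounded_op[OF F])
    have norm: "mult_norm H r F \<ge> 0" unfolding mult_norm_def M_def[symmetric] by (rule R.opnorm_nonneg[OF M])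
    have Mx: "(\<lambda>n. M (x n)) \<in> vecs (direct_sum (direct_sum H (enat r)) s)" by (rule R.ampl_mem[OF M x])
    have "mat_op (direct_sum H s) r (\<lambda>i j. ampl_mult_op H s (F i j)) X = transpose_seq (\<lambda>n. M (x n))"
      unfolding Xx M_def ampl_mult_op_def
      by (rule H.mat_op_ampl_transpose[OF H.mult_op_bounded x]) (use F in \<open>simp add: mats_def\<close>)
    then have "hnorm (direct_sum (direct_sum H s) (enat r)) (mat_op (direct_sum H s) r (\<lambda>i j. ampl_mult_op H s (F i j)) X)
        = hnorm (direct_sum (direct_sum H (enat r)) s) (\<lambda>n. M (x n))"
      by (simp add: H.transpose_hnorm[OF Mx])
    also have "\<dots> \<le> mult_norm H r F * hnorm (direct_sum (direct_sum H (enat r)) s) x"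
    proof (rule R.dsum_dominated(2)[OF x _ _ _ norm])
      show "M (x i) \<in> vecs (direct_sum H (enat r))" for i by (rule R.dsum_vecs[OF Mx])
      show "M (x i) = 0" if "\<not> enat i < s" for i by (rule R.dsum_off[OF Mx that])
      show "hnorm (direct_sum H (enat r)) (M (x i)) \<le> mult_norm H r F * hnorm (direct_sum H (enat r)) (x i)" for i
        unfolding M_def by (rule H.act_norm[OF F R.dsum_vecs[OF x]])
    qed
    also have "hnorm (direct_sum (direct_sum H (enat r)) s) x = hnorm (direct_sum (direct_sum H s) (enat r)) X"
      unfolding Xx by (rule H.transpose_hnorm[OF x, symmetric])
    finally show "hnorm (direct_sum (direct_sum H s) (enat r)) (mat_op (direct_sum H s) r (\<lambda>i j. ampl_mult_op H s (F i j)) X)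
        \<le> mult_norm H r F * hnorm (direct_sum (direct_sum H s) (enat r)) X" .
  qed (use H.hilbert_H H.algebra_subspace H.algebra_mult H.algebra_one H.mult_op_bounded bd in auto)
qed

text \<open>
  Otherwise \<open>dual_extension\<close> yields an operator \<open>G\<close> of norm at most \<open>c\<close> such that every functional
  annihilating the matrices over the ideal annihilates \<open>T = M F - G\<close>. The entries of \<open>T\<close> are
  multiplication operators by functions of the algebra since the algebra is weak-* closed, and these
  functions vanish on \<open>E\<close> since evaluation at a point is, up to a nonzero factor, the pairing with the
  kernel at that point. So \<open>G\<close> is \<open>F\<close> minus a matrix over the ideal, of norm at most \<open>c\<close>.
\<close>

theorem multiplier_distance_duality:
  fixes H :: "('x \<Rightarrow> complex) hspace"
  defines "D r \<equiv> direct_sum H (enat r)" and "M r F \<equiv> mat_op H r (\<lambda>i j. mult_op H (F i j))"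
  assumes H: "rkhs H" and alg: "dual_algebra_of_multipliers H \<AA>" and F: "F \<in> mats r \<AA>"
    and c: "0 < c" "c < mult_dist H r F (mats r (vanishing_ideal \<AA> E))"
  shows "\<exists>x\<in>vecs (direct_sum (D r) \<infinity>). \<exists>y\<in>vecs (direct_sum (D r) \<infinity>).
    (\<forall>G\<in>mats r (vanishing_ideal \<AA> E). pairing (D r) x y (M r G) = 0) \<and>
    c * (hnorm (direct_sum (D r) \<infinity>) x * hnorm (direct_sum (D r) \<infinity>) y) < cmod (pairing (D r) x y (M r F))"
proof (rule ccontr)
  assume neg: "\<not> ?thesis"
  interpret rkhs H by (rule H)
  interpret A: multiplier_action H H \<AA> "mult_op H"
    by (rule dual_algebra_action[OF hilbert_space_axioms alg])
  interpret D: hilbert_space "D r" unfolding D_def by (rule hilbert_space_direct_sum)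
  interpret S: hilbert_space "direct_sum (D r) \<infinity>" by (rule D.hilbert_space_direct_sum)
  let ?J = "vanishing_ideal \<AA> E"
  define \<S> where "\<S> = M r ` mats r ?J"
  have MF: "M r G \<in> bounded_ops (D r)" if "G \<in> mats r \<AA>" for G
    unfolding M_def D_def by (rule A.act_mat_bounded_op[OF that])
  have entry: "entry_op H (M r G) i j = mult_op H (G i j)" if "G \<in> mats r \<AA>" "i < r" "j < r" for G i j
    unfolding M_def by (rule entry_op_mat_op) (use that A.mult_op_bounded in \<open>auto simp: mats_def\<close>)
  obtain G where G: "G \<in> bounded_ops (D r)" and Gc: "\<forall>x\<in>vecs (D r). hnorm (D r) (G x) \<le> c * hnorm (D r) x"
    and G_ann: "\<forall>\<sigma>\<in>annihilator (D r) \<S>. \<sigma> (M r F - G) = 0"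
  proof -
    have "\<exists>G\<in>bounded_ops (D r). (\<forall>x\<in>vecs (D r). hnorm (D r) (G x) \<le> c * hnorm (D r) x) \<and>
        (\<forall>\<sigma>\<in>annihilator (D r) \<S>. \<sigma> (M r F - G) = 0)"
    proof (rule D.dual_extension[OF MF[OF F]])
      fix x y assume xy: "x \<in> D.seqs" "y \<in> D.seqs" and ann: "pairing (D r) x y \<in> annihilator (D r) \<S>"
      have "cmod (pairing (D r) x y (M r F)) \<le> c * (D.seq_norm x * D.seq_norm y)"
        using neg xy ann unfolding annihilator_def \<S>_def by fastforce
      also have "\<dots> \<le> c * (((D.seq_norm x)\<^sup>2 + (D.seq_norm y)\<^sup>2) / 2)"
        using sum_squares_bound[of "D.seq_norm x" "D.seq_norm y"] c(1) by (intro mult_left_mono) auto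
      finally show "cmod (pairing (D r) x y (M r F)) \<le> c * ((D.seq_norm x)\<^sup>2 + (D.seq_norm y)\<^sup>2) / 2" by simp
    qed (use c in simp)
    then show ?thesis using that by blast
  qed
  define T where "T = M r F - G"
  have T: "T \<in> bounded_ops (D r)" unfolding T_def by (rule D.op_minus[OF MF[OF F] G])
  \<comment> \<open>Read as a functional of the entry \<open>(i, j)\<close>, a functional annihilating the ideal annihilates all
    matrices over the ideal.\<close>
  have T_entry: "pairing H x y (entry_op H T i j) = 0"
    if xy: "x \<in> seqs" "y \<in> seqs" and ij: "i < r" "j < r" and ann: "\<And>g. g \<in> ?J \<Longrightarrow> pairing H x y (mult_op H g) = 0" for x y i j
  proof -
    have "pairing (D r) (\<lambda>n. at_slot j (x n)) (\<lambda>n. at_slot i (y n)) \<in> annihilator (D r) \<S>"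
      unfolding annihilator_def mem_Collect_eq
    proof (intro conjI ballI)
      show "pairing (D r) (\<lambda>n. at_slot j (x n)) (\<lambda>n. at_slot i (y n)) \<in> normal_functionals (D r)"
        by (rule D.pairing_normal) (use lift_seqs xy ij in \<open>auto simp: D_def\<close>)
      fix R assume "R \<in> \<S>"
      then obtain B where B: "B \<in> mats r ?J" "R = M r B" by (auto simp: \<S>_def)
      note BA = A.ideal_mats[OF B(1)]
      have "pairing (D r) (\<lambda>n. at_slot j (x n)) (\<lambda>n. at_slot i (y n)) R = pairing H x y (mult_op H (B i j))"
        unfolding B(2) entry[OF BA ij, symmetric] unfolding D_def
        by (rule pairing_entry_op[OF _ ij xy]) (use MF[OF BA] in \<open>simp add: D_def\<close>)
      then show "pairing (D r) (\<lambda>n. at_slot j (x n)) (\<lambda>n. at_slot i (y n)) R = 0"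
        using ann B(1) ij by (simp add: mats_def)
    qed
    then have "pairing (D r) (\<lambda>n. at_slot j (x n)) (\<lambda>n. at_slot i (y n)) T = 0" using G_ann by (simp add: T_def)
    then show ?thesis using pairing_entry_op[OF T[unfolded D_def] ij xy] by (simp add: D_def)
  qed
  have "\<exists>g\<in>?J. entry_op H T i j = mult_op H g" if ij: "i < r" "j < r" for i j
  proof -
    have Tij: "entry_op H T i j \<in> bounded_ops H" by (rule entry_op_bounded_op[OF T[unfolded D_def] ij(2)])
    have "complex_vector.subspace (mult_op H ` \<AA>)"
    proof (rule complex_vector.subspaceI)
      have "mult_op H 0 = 0" by (auto simp: mult_op_def)
      then show "0 \<in> mult_op H ` \<AA>" using complex_vector.subspace_0[OF A.algebra_subspace] by force
      fix a b assume "a \<in> mult_op H ` \<AA>" "b \<in> mult_op H ` \<AA>"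
      then obtain f g where fg: "f \<in> \<AA>" "g \<in> \<AA>" "a = mult_op H f" "b = mult_op H g" by blast
      have "a + b = mult_op H (f + g)" unfolding fg by (auto simp: mult_op_def distrib_right fun_eq_iff)
      then show "a + b \<in> mult_op H ` \<AA>" using complex_vector.subspace_add[OF A.algebra_subspace fg(1,2)] by blast
    next
      fix k a assume "a \<in> mult_op H ` \<AA>"
      then obtain f where f: "f \<in> \<AA>" "a = mult_op H f" by blast
      have "k *\<^sub>C a = mult_op H (k *\<^sub>C f)"
        unfolding f by (auto simp: mult_op_def scaleC_fun_def scaleC_complex_def fun_eq_iff)
      then show "k *\<^sub>C a \<in> mult_op H ` \<AA>" using complex_vector.subspace_scale[OF A.algebra_subspace f(1)] by blast
    qed
    note weak = weak_star_closed_annihilator[OF this _ Tij]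
    have "entry_op H T i j \<in> mult_op H ` \<AA>"
    proof (rule ccontr)
      assume "entry_op H T i j \<notin> mult_op H ` \<AA>"
      then obtain x y where xy: "x \<in> seqs" "y \<in> seqs" "pairing H x y \<in> annihilator H (mult_op H ` \<AA>)"
        "pairing H x y (entry_op H T i j) \<noteq> 0"
        using weak alg unfolding dual_algebra_of_multipliers_def by blast
      have "pairing H x y (mult_op H g) = 0" if "g \<in> ?J" for g
        using xy(3) A.ideal_subset[OF that] by (auto simp: annihilator_def)
      then show False using T_entry[OF xy(1,2) ij] xy(4) by blast
    qed
    then obtain f where f: "f \<in> \<AA>" "entry_op H T i j = mult_op H f" by blast
    have "f z = 0" if z: "z \<in> E" for z
    proof -
      obtain k where k: "k \<in> vecs H" "k \<noteq> 0" "\<And>h. h \<in> vecs H \<Longrightarrow> h z = hinner H h k" using kernel[of z] by blast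
      have kz: "k z \<noteq> 0" using k inner_definite by metis
      have eval: "pairing H (at_slot 0 k) (at_slot 0 k) (mult_op H g) = g z * k z" if g: "g \<in> \<AA>" for g
      proof -
        have "mult_op H g k \<in> vecs H" using A.act_vecs[OF g k(1)] .
        then have "hinner H (mult_op H g k) k = mult_op H g k z" using k(3) by simp
        then show ?thesis
          using pairing_at_slot[OF A.mult_op_bounded[OF g] k(1) k(1)] k(1) by (simp add: mult_op_def)
      qed
      have ks: "at_slot 0 k \<in> seqs" using at_slot_mem[of 0 \<infinity> k] k(1) by simp
      have "pairing H (at_slot 0 k) (at_slot 0 k) (mult_op H g) = 0" if "g \<in> ?J" for g
        using eval[OF A.ideal_subset[OF that]] that z by (simp add: vanishing_ideal_def)
      then have "pairing H (at_slot 0 k) (at_slot 0 k) (entry_op H T i j) = 0" using T_entry[OF ks ks ij] by blast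
      then show ?thesis using eval[OF f(1)] f(2) kz by simp
    qed
    then have "f \<in> ?J" using f(1) by (simp add: vanishing_ideal_def)
    then show ?thesis using f(2) by blast
  qed
  then obtain B where B: "\<And>i j. i < r \<Longrightarrow> j < r \<Longrightarrow> B i j \<in> ?J"
    "\<And>i j. i < r \<Longrightarrow> j < r \<Longrightarrow> entry_op H T i j = mult_op H (B i j)" by metis
  have BJ: "B \<in> mats r ?J" using B(1) by (simp add: mats_def)
  note BA = A.ideal_mats[OF BJ]
  have "hnorm (D r) (M r (F - B) x) \<le> c * hnorm (D r) x" if x: "x \<in> vecs (D r)" for x
  proof -
    have TB: "T x = M r B x"
    proof -
      have "mat_op H r (entry_op H T) x = M r B x"
        using x B(2) by (auto simp: M_def mat_op_def D_def)
      then show ?thesis using mat_op_entry_op[OF T[unfolded D_def]] by simp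
    qed
    have "M r (F - B) x = M r F x - M r B x"
      using F BA x dsum_vecs[of x "enat r"]
      by (auto simp: M_def mat_op_apply D_def fun_eq_iff[of "\<lambda>i. _ i"] mats_def A.act_diff sum_subtractf)
    also have "\<dots> = G x" unfolding TB[symmetric] by (simp add: T_def)
    finally show ?thesis using Gc x by simp
  qed
  then have "mult_norm H r (F - B) \<le> c"
    unfolding mult_norm_def M_def[symmetric] D_def[symmetric] by (rule D.opnorm_le) (auto intro: less_imp_le[OF c(1)])
  moreover have "mult_dist H r F (mats r ?J) \<le> mult_norm H r (F - B)"
    unfolding mult_dist_def
  proof (rule cINF_lower[OF _ BJ], rule bdd_belowI2)
    fix B' assume B': "B' \<in> mats r ?J"
    have FB': "F - B' \<in> mats r \<AA>"
      using F A.ideal_mats[OF B'] complex_vector.subspace_diff[OF A.algebra_subspace] by (simp add: mats_def)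
    then show "0 \<le> mult_norm H r (F - B')"
      unfolding mult_norm_def using D.opnorm_nonneg[OF MF[OF FB']] by (simp add: M_def D_def)
  qed
  ultimately show False using c by linarith
qed


context multiplier_action
begin

text \<open>
  The map \<open>V\<close> embeds \<open>H\<close> into \<open>K\<close> compatibly with the actions; it is the identity for \<open>K = H\<close> and the
  inclusion of the first summand for an ampliation. Along \<open>V\<close>, a functional on matrices of multipliers
  on \<open>H\<close> becomes a weak-* continuous functional on matrices over the represented algebra, to which property
  A1(1) applies.
\<close>

lemma NP_family_if_property_A1_1:
  assumes A1: "property_A1_1 (direct_sum K (enat r)) (mat_alg K r (\<rho> ` \<AA>))"
    and H: "rkhs H" and alg: "dual_algebra_of_multipliers H \<AA>"
    and V: "\<And>h. h \<in> vecs H \<Longrightarrow> V h \<in> vecs K"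
    and inter: "\<And>f h k. f \<in> \<AA> \<Longrightarrow> h \<in> vecs H \<Longrightarrow> k \<in> vecs H \<Longrightarrow>
      hinner K (\<rho> f (V h)) (V k) = hinner H (mult_op H f h) k"
  shows "NP_family_for H \<AA> r K \<rho>"
proof (rule NP_family_if_vector_functionals)
  fix E F c assume F: "F \<in> mats r \<AA>" and c: "0 < c" "c < mult_dist H r F (mats r (\<J> E))"
  let ?D = "direct_sum K (enat r)" and ?DH = "direct_sum H (enat r)"
  interpret D: hilbert_space ?D by (rule hilbert_space_direct_sum)
  interpret S: hilbert_space "direct_sum ?D \<infinity>" by (rule D.hilbert_space_direct_sum)
  interpret H: hilbert_space H by (rule hilbert_H)
  interpret DH: hilbert_space ?DH by (rule H.hilbert_space_direct_sum)
  interpret SH: hilbert_space "direct_sum ?DH \<infinity>" by (rule DH.hilbert_space_direct_sum)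
  interpret A: multiplier_action H H \<AA> "mult_op H" by (rule dual_algebra_action[OF hilbert_H alg])
  define M where "M G = mat_op H r (\<lambda>i j. mult_op H (G i j))" for G
  obtain x y where x: "x \<in> DH.seqs" and y: "y \<in> DH.seqs"
    and ann: "\<And>G. G \<in> mats r (\<J> E) \<Longrightarrow> pairing ?DH x y (M G) = 0"
    and big: "c * (DH.seq_norm x * DH.seq_norm y) < cmod (pairing ?DH x y (M F))"
    using multiplier_distance_duality[OF H alg F c] unfolding M_def by blast
  have V_norm: "hnorm K (V h) = hnorm H h" if h: "h \<in> vecs H" for h
    using inter[OF algebra_one h h] h V[OF h] by (simp add: hnorm_def act_one A.act_one)
  define lift where "lift v = (\<lambda>n j. if j < r then V (v n j) else 0)" for v :: "nat \<Rightarrow> nat \<Rightarrow> 'x \<Rightarrow> complex"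
  have lift_D: "lift v n \<in> vecs ?D" if v: "v \<in> DH.seqs" for v n
    using V H.dsum_vecs[OF DH.dsum_vecs[OF v]] by (simp add: fin_dsum_mem lift_def)
  have lift_n: "hnorm ?D (lift v n) = hnorm ?DH (v n)" if v: "v \<in> DH.seqs" for v n
  proof -
    have "(hnorm ?D (lift v n))\<^sup>2 = (hnorm ?DH (v n))\<^sup>2"
      unfolding fin_dsum_hnorm_power2[OF lift_D[OF v]] H.fin_dsum_hnorm_power2[OF DH.dsum_vecs[OF v]]
      using V_norm H.dsum_vecs[OF DH.dsum_vecs[OF v]] by (simp add: lift_def)
    then show ?thesis using lift_D[OF v] DH.dsum_vecs[OF v] by (simp add: power2_eq_iff_nonneg)
  qed
  have lift_seqs: "lift v \<in> D.seqs" if v: "v \<in> DH.seqs" for v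
    using DH.dsum_summable[OF v] lift_D[OF v] by (simp add: D.dsum_mem lift_n[OF v])
  have lift_norm: "D.seq_norm (lift v) = DH.seq_norm v" if v: "v \<in> DH.seqs" for v
  proof -
    have "(D.seq_norm (lift v))\<^sup>2 = (DH.seq_norm v)\<^sup>2"
      unfolding D.dsum_hnorm_power2[OF lift_seqs[OF v]] DH.dsum_hnorm_power2[OF v] lift_n[OF v] ..
    then show ?thesis using lift_seqs[OF v] v by (simp add: power2_eq_iff_nonneg)
  qed
  have pair: "pairing ?D (lift x) (lift y) (act_mat r G) = pairing ?DH x y (M G)" if G: "G \<in> mats r \<AA>" for G
  proof -
    have "hinner ?D (act_mat r G (lift x n)) (lift y n) = hinner ?DH (M G (x n)) (y n)" for n
      unfolding inner_act_mat[OF G lift_D[OF x] lift_D[OF y]] M_def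
        A.inner_act_mat[OF G DH.dsum_vecs[OF x] DH.dsum_vecs[OF y]]
      using G H.dsum_vecs[OF DH.dsum_vecs[OF x]] H.dsum_vecs[OF DH.dsum_vecs[OF y]]
      by (intro sum.cong) (auto simp: lift_def inter mats_def)
    then show ?thesis
      using D.pairing_sums[OF act_mat_bounded_op[OF G] lift_seqs[OF x] lift_seqs[OF y]]
        DH.pairing_sums[OF A.act_mat_bounded_op[OF G, folded M_def] x y] sums_unique2 by simp
  qed
  define n where "n = DH.seq_norm x * DH.seq_norm y"
  define b where "b = cmod (pairing ?DH x y (M F))"
  have n: "n \<ge> 0" using x y by (simp add: n_def)
  have nb: "c * n < b" using big by (simp add: n_def b_def)
  \<comment> \<open>Any \<open>t\<close> strictly between \<open>n\<close> and \<open>b / c\<close> scales the functional to norm below one while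
    keeping its value at \<open>F\<close> above \<open>c\<close>.\<close>
  obtain t where t: "n < t" "t < b / c" using nb c(1) dense[of n "b / c"] by (auto simp: field_simps)
  then have t0: "t > 0" and ct: "c < b / t" using n c(1) by (auto simp: field_simps)
  define X where "X = of_real (1 / t) *\<^sub>C lift x"
  have X: "X \<in> D.seqs" unfolding X_def by (intro S.scaleC_vecs lift_seqs x)
  note Y = lift_seqs[OF y]
  define \<phi> where "\<phi> = pairing ?D X (lift y)"
  have \<phi>_eq: "\<phi> (act_mat r G) = of_real (1 / t) * pairing ?DH x y (M G)" if "G \<in> mats r \<AA>" for G
    unfolding \<phi>_def X_def D.pairing_scaleC_left[OF lift_seqs[OF x] Y]
    by (simp add: scaleC_apply scaleC_complex_def pair[OF that])
  let ?B = "mat_alg K r (\<rho> ` \<AA>)"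
  have act_in: "act_mat r G \<in> ?B" if "G \<in> mats r \<AA>" for G
    unfolding mat_alg_def using that by (intro imageI) (simp add: mats_def)
  have B_bd: "?B \<subseteq> bounded_ops ?D"
  proof
    fix T assume "T \<in> ?B"
    then obtain R where R: "R \<in> mats r (\<rho> ` \<AA>)" "T = mat_op K r R" by (auto simp: mat_alg_def)
    show "T \<in> bounded_ops ?D"
      unfolding R(2)
    proof (rule mat_op_bounded_op)
      fix i j assume "i < r" "j < r"
      then have "R i j \<in> \<rho> ` \<AA>" using R(1) by (simp add: mats_def)
      then obtain f where "f \<in> \<AA>" "R i j = \<rho> f" by (rule imageE)
      then show "R i j \<in> bounded_ops K" using act_bounded by simp
    qed
  qed
  have "functional_norm ?D ?B \<phi> \<le> n / t"
    unfolding functional_norm_def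
  proof (rule cSUP_least)
    have zero: "(\<lambda>i j. 0) \<in> mats r \<AA>"
      using complex_vector.subspace_0[OF algebra_subspace] by (simp add: mats_def)
    have "opnorm ?D (act_mat r (\<lambda>i j. 0)) \<le> 0"
    proof (rule D.opnorm_le)
      fix v assume v: "v \<in> vecs ?D"
      have "act_mat r (\<lambda>i j. 0) v = 0"
        using dsum_vecs[OF v] by (auto simp: mat_op_apply[OF v] act_zero fun_eq_iff)
      then show "hnorm ?D (act_mat r (\<lambda>i j. 0) v) \<le> 0 * hnorm ?D v" by simp
    qed simp
    then show "{T \<in> ?B. opnorm ?D T \<le> 1} \<noteq> {}" using act_in[OF zero] by force
    fix T assume T: "T \<in> {T \<in> ?B. opnorm ?D T \<le> 1}"
    then have Tb: "T \<in> bounded_ops ?D" using B_bd by blast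
    have "cmod (\<phi> T) \<le> 1 * D.seq_norm X * D.seq_norm (lift y)"
      unfolding \<phi>_def
    proof (rule D.pairing_bound[OF Tb X Y])
      fix v assume v: "v \<in> vecs ?D"
      have "hnorm ?D (T v) \<le> opnorm ?D T * hnorm ?D v" by (rule D.hnorm_le_opnorm[OF Tb v])
      also have "\<dots> \<le> 1 * hnorm ?D v" using T v by (intro mult_right_mono) auto
      finally show "hnorm ?D (T v) \<le> 1 * hnorm ?D v" .
    qed simp
    also have "\<dots> = n / t"
      unfolding X_def S.hnorm_scaleC[OF lift_seqs[OF x]] lift_norm[OF x] lift_norm[OF y]
      using t0 by (simp add: n_def norm_divide)
    finally show "cmod (\<phi> T) \<le> n / t" .
  qed
  also have "n / t < 1" using t t0 by simp
  finally have "functional_norm ?D ?B \<phi> < 1" .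
  moreover have "weak_star_functional ?D ?B \<phi>"
    unfolding \<phi>_def by (rule D.weak_star_functional_pairing[OF X Y B_bd])
  ultimately obtain u v where u: "u \<in> vecs ?D" and v: "v \<in> vecs ?D" and uv: "hnorm ?D u * hnorm ?D v < 1"
    and \<phi>_uv: "\<And>T. T \<in> ?B \<Longrightarrow> \<phi> T = hinner ?D (T u) v"
    using A1 unfolding property_A1_1_def by blast
  have "hinner ?D (act_mat r G u) v = 0" if G: "G \<in> mats r (\<J> E)" for G
    using \<phi>_uv[OF act_in[OF ideal_mats[OF G]]] \<phi>_eq[OF ideal_mats[OF G]] ann[OF G] by simp
  moreover have "c * (hnorm ?D u * hnorm ?D v) < cmod (hinner ?D (act_mat r F u) v)"
  proof -
    have "c * (hnorm ?D u * hnorm ?D v) \<le> c * 1" using uv c by (intro mult_left_mono) auto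
    also have "\<dots> < b / t" using ct by simp
    also have "\<dots> = cmod (\<phi> (act_mat r F))" using t0 by (simp add: \<phi>_eq[OF F] b_def norm_mult norm_divide)
    finally show ?thesis using \<phi>_uv[OF act_in[OF F]] by simp
  qed
  ultimately show "\<exists>X\<in>vecs ?D. \<exists>Y\<in>vecs ?D.
      (\<forall>G\<in>mats r (\<J> E). hinner ?D (act_mat r G X) Y = 0) \<and>
      c * (hnorm ?D X * hnorm ?D Y) < cmod (hinner ?D (act_mat r F X) Y)"
    using u v by blast
qed

end

text \<open>
  A pair of square-summable sequences in \<open>H\<^sup>r\<close> is a pair of vectors in \<open>r\<close> copies of the infinite
  ampliation, so the functional from \<open>multiplier_distance_duality\<close> is already a vector functional.
\<close>

lemma Lat_ampl_infinity_NP_family: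
  assumes H: "rkhs H" and alg: "dual_algebra_of_multipliers H \<AA>"
  shows "Lat_ampl_NP_family H \<AA> \<infinity> r"
proof -
  interpret rkhs H by (rule H)
  interpret A: multiplier_action H H \<AA> "mult_op H" by (rule dual_algebra_action[OF hilbert_space_axioms alg])
  interpret I: multiplier_action "direct_sum H \<infinity>" H \<AA> "ampl_mult_op H \<infinity>"
    by (rule multiplier_action_ampl[OF A.multiplier_action_axioms])
  let ?D = "direct_sum H (enat r)" and ?K = "direct_sum (direct_sum H \<infinity>) (enat r)"
  interpret D: hilbert_space ?D by (rule hilbert_space_direct_sum)
  show ?thesis
    unfolding Lat_ampl_NP_family_def
  proof (rule I.NP_family_if_vector_functionals)
    fix E F c assume F: "F \<in> mats r \<AA>" and c: "0 < c" "c < mult_dist H r F (mats r (vanishing_ideal \<AA> E))"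
    define M where "M G = mat_op H r (\<lambda>i j. mult_op H (G i j))" for G
    obtain x y where x: "x \<in> D.seqs" and y: "y \<in> D.seqs"
      and ann: "\<And>G. G \<in> mats r (vanishing_ideal \<AA> E) \<Longrightarrow> pairing ?D x y (M G) = 0"
      and big: "c * (D.seq_norm x * D.seq_norm y) < cmod (pairing ?D x y (M F))"
      using multiplier_distance_duality[OF H alg F c] unfolding M_def by blast
    have pair: "hinner ?K (I.act_mat r G (transpose_seq x)) (transpose_seq y) = pairing ?D x y (M G)"
      if G: "G \<in> mats r \<AA>" for G
    proof -
      have M: "M G \<in> bounded_ops ?D" unfolding M_def by (rule A.act_mat_bounded_op[OF G])
      have "I.act_mat r G (transpose_seq x) = transpose_seq (\<lambda>n. M G (x n))"
        unfolding M_def ampl_mult_op_def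
        by (rule mat_op_ampl_transpose[OF A.mult_op_bounded x]) (use G in \<open>simp add: mats_def\<close>)
      then show ?thesis
        using transpose_inner[OF D.op_seqs[OF M x] y] M by (simp add: pairing_def)
    qed
    have "\<forall>G\<in>mats r (vanishing_ideal \<AA> E). hinner ?K (I.act_mat r G (transpose_seq x)) (transpose_seq y) = 0"
      using pair[OF A.ideal_mats] ann by simp
    moreover have "c * (hnorm ?K (transpose_seq x) * hnorm ?K (transpose_seq y)) <
        cmod (hinner ?K (I.act_mat r F (transpose_seq x)) (transpose_seq y))"
      unfolding pair[OF F] transpose_hnorm[OF x] transpose_hnorm[OF y] by (rule big)
    ultimately show "\<exists>X\<in>vecs ?K. \<exists>Y\<in>vecs ?K.
      (\<forall>G\<in>mats r (vanishing_ideal \<AA> E). hinner ?K (I.act_mat r G X) Y = 0) \<and>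
      c * (hnorm ?K X * hnorm ?K Y) < cmod (hinner ?K (I.act_mat r F X) Y)"
      using x y unfolding transpose_mem by blast
  qed
qed

theorem theorem7p2:
  fixes H :: "('x \<Rightarrow> complex) hspace"
    and \<AA> :: "('x \<Rightarrow> complex) set"
    and r :: nat
  assumes "rkhs H"
    and "dual_algebra_of_multipliers H \<AA>"
    and "r \<ge> 1"
  shows "(property_A1_1 (direct_sum H (enat r)) (mat_alg H r (mult_op H ` \<AA>))
            \<longrightarrow> Lat_NP_family H \<AA> r) \<and>
         (\<forall>s\<ge>1. property_A1_1 (direct_sum (direct_sum H s) (enat r))
                    (mat_alg (direct_sum H s) r (ampl_mult_op H s ` \<AA>))
            \<longrightarrow> Lat_ampl_NP_family H \<AA> s r) \<and>
         Lat_ampl_complete_NP_family H \<AA> \<infinity>"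
proof (intro conjI impI allI)
  interpret rkhs H by fact
  interpret A: multiplier_action H H \<AA> "mult_op H"
    by (rule dual_algebra_action[OF hilbert_space_axioms assms(2)])
  show "Lat_NP_family H \<AA> r" if "property_A1_1 (direct_sum H (enat r)) (mat_alg H r (mult_op H ` \<AA>))"
    unfolding Lat_NP_family_def
    by (rule A.NP_family_if_property_A1_1[OF that assms(1,2), of "\<lambda>h. h"]) auto
  show "Lat_ampl_NP_family H \<AA> s r"
    if s: "s \<ge> 1" and A1: "property_A1_1 (direct_sum (direct_sum H s) (enat r))
      (mat_alg (direct_sum H s) r (ampl_mult_op H s ` \<AA>))" for s
  proof -
    interpret I: multiplier_action "direct_sum H s" H \<AA> "ampl_mult_op H s"
      by (rule multiplier_action_ampl[OF A.multiplier_action_axioms])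
    have s0: "enat 0 < s" using s by (cases s) (auto simp: one_enat_def zero_enat_def)
    show ?thesis
      unfolding Lat_ampl_NP_family_def
    proof (rule I.NP_family_if_property_A1_1[OF A1 assms(1,2), of "at_slot 0"])
      show "at_slot 0 h \<in> vecs (direct_sum H s)" if "h \<in> vecs H" for h by (rule at_slot_mem[OF s0 that])
      fix f h k assume f: "f \<in> \<AA>" and h: "h \<in> vecs H" and k: "k \<in> vecs H"
      have "ampl_mult_op H s f (at_slot 0 h) = (\<lambda>i. mult_op H f (at_slot 0 h i))"
        unfolding ampl_mult_op_def
        using ampl_apply[OF at_slot_mem[OF s0 h], of "mult_op H f"] op_zero[OF A.mult_op_bounded[OF f]] by simp
      also have "\<dots> = at_slot 0 (mult_op H f h)"
        using op_zero[OF A.mult_op_bounded[OF f]] by (auto simp: at_slot_def)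
      finally show "hinner (direct_sum H s) (ampl_mult_op H s f (at_slot 0 h)) (at_slot 0 k) = hinner H (mult_op H f h) k"
        using inner_at_slot[OF s0 A.act_vecs[OF f h] at_slot_mem[OF s0 k]] by (simp add: at_slot_def)
    qed
  qed
  show "Lat_ampl_complete_NP_family H \<AA> \<infinity>"
    unfolding Lat_ampl_complete_NP_family_def using Lat_ampl_infinity_NP_family[OF assms(1,2)] by blast
qed

end
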